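(* Let $\mathfrak M$ be a separable Hilbert space and let $\mu$ be a probability $\mathbf L(\mathfrak M)$-valued Borel measure on the unit circle $\mathbb T$ (so $\mu(\mathbb T)=I_{\mathfrak M}$). Define $$F(\lambda)=\int_{\mathbb T}\frac{\xi+\lambda}{\xi-\lambda}\,\mu(d\xi),\qquad E(\lambda)=\frac1\lambda\bigl(F(\lambda)-I_{\mathfrak M}\bigr)\bigl(F(\lambda)+I_{\mathfrak M}\bigr)^{-1},\quad\lambda\in\mathbb D .$$ Then $E$ belongs to the Schur class $\mathbf S(\mathfrak M,\mathfrak M)$. Let $\{G_n\}_{n\ge0}$ be the Schur parameters of $E$, let $\mathfrak H_0=\mathfrak H_0(\{G_n\}_{n\ge0})$, $\widetilde{\mathfrak H}_0=\widetilde{\mathfrak H}_0(\{G_n\}_{n\ge0})$, $\mathcal H_0=\mathfrak M\oplus\mathfrak H_0$, $\widetilde{\mathcal H}_0=\mathfrak M\oplus\widetilde{\mathfrak H}_0$, and let $\mathcal U_0=\mathcal U_0(\{G_n\}_{n\ge0})$, $\widetilde{\mathcal U}_0=\widetilde{\mathcal U}_0(\{G_n\}_{n\ge0})$ be the block operator CMV matrices constructed from $\{G_n\}_{n\ge0}$. Then the pairs $\{\mathcal H_0,\mathcal U_0\}$ and $\{\widetilde{\mathcal H}_0,\widetilde{\mathcal U}_0\}$ are unitarily equivalent minimal Naimark dilations of the measure $\mu$.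
   Context: $\mathbb D=\{\lambda\in\mathbb C:|\lambda|<1\}$, $\mathbb T=\{|\xi|=1\}$. An $\mathbf L(\mathfrak M)$-valued Borel measure on $\mathbb T$ is a map $\mu$ from the Borel sets of $\mathbb T$ to nonnegative bounded operators on $\mathfrak M$ with $\mu(\emptyset)=0$ that is $\sigma$-additive in the strong operator topology. With $S_n=\int_{\mathbb T}\xi^{-n}\mu(d\xi)$, $n\in\mathbb Z$, a Naimark dilation of a probability measure $\mu$ is a pair $\{\mathcal H,\mathcal U\}$ where $\mathcal H$ is a separable Hilbert space containing $\mathfrak M$ as a subspace and $\mathcal U$ is a unitary operator in $\mathcal H$ with $S_n=P_{\mathfrak M}\mathcal U^n\!\upharpoonright\mathfrak M$ for all $n\in\mathbb Z$ ($P_{\mathfrak M}$ the orthogonal projection onto $\mathfrak M$). It is minimal if $\overline{\mathrm{span}}\{\mathcal U^n\mathfrak M:\ n\in\mathbb Z\}=\mathcal H$. The value $E(0)$ is understood by continuity. $\mathbf L(\mathfrak H_1,\mathfrak H_2)$ denotes the bounded linear operators from the complex Hilbert space $\mathfrak H_1$ to $\mathfrak H_2$. For a contraction $T\in\mathbf L(\mathfrak H_1,\mathfrak H_2)$: $D_T=(I-T^*T)^{1/2}$, $D_{T^*}=(I-TT^* )^{1/2}$, $\mathfrak D_T=\overline{\mathrm{ran}}\,D_T$, $\mathfrak D_{T^*}=\overline{\mathrm{ran}}\,D_{T^*}$ (either may be $\{0\}$). The elementary rotation of $T$ is the unitary operator $$\mathbf J_T=\begin{bmatrix}T&D_{T^*}\\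 D_T&-T^*\end{bmatrix}:\mathfrak H_1\oplus\mathfrak D_{T^*}\to\mathfrak H_2\oplus\mathfrak D_T ,$$ with rows/columns belonging to zero spaces omitted: it is the row $[T\ \ I_{\mathfrak D_{T^*}}]$ if $T$ is isometric, the column $\begin{bmatrix}T\\ D_T\end{bmatrix}$ if $T$ is co-isometric, and $T$ if $T$ is unitary. Schur class and Schur parameters. $\mathbf S(\mathfrak M,\mathfrak N)$ is the set of holomorphic functions on $\mathbb D$ whose values are contractions in $\mathbf L(\mathfrak M,\mathfrak N)$. For $\Theta\in\mathbf S(\mathfrak M,\mathfrak N)$ put $\Theta_0=\Theta$, $\Gamma_0=\Theta(0)$; given $\Theta_n$ and $\Gamma_n=\Theta_n(0)$, let $\Theta_{n+1}\in\mathbf S(\mathfrak D_{\Gamma_n},\mathfrak D_{\Gamma_n^*})$ be the unique function with $$\Theta_n(\lambda)=\Gamma_n+\lambda D_{\Gamma_n^*}\Theta_{n+1}(\lambda)\bigl(I+\lambda\Gamma_n^*\Theta_{n+1}(\lambda)\bigr)^{-1}D_{\Gamma_n},\quad\lambda\in\mathbb D,$$ and $\Gamma_{n+1}=\Theta_{n+1}(0)$. The contractions $\Gamma_0\in\mathbf L(\mathfrak M,\mathfrak N)$, $\Gamma_n\in\mathbf L(\mathfrak D_{\Gamma_{n-1}},\mathfrak D_{\Gamma_{n-1}^*})$ are the Schur parameters of $\Theta$. If some $\Gamma_N$ is unitary the process terminates at $N$; then for $n>N$ all the spaces $\mathfrak D_{\Gamma_n},\mathfrak D_{\Gamma_n^*}$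 are taken to be $\{0\}$ and $\Gamma_n=0$. If $\Gamma_N$ is isometric or co-isometric then $\Gamma_n=0$ for $n>N$. Block operator CMV matrices. For such a sequence let $$\mathfrak H_0(\{\Gamma_n\}_{n\ge0})=\bigoplus_{n\ge0}(\mathfrak D_{\Gamma_{2n}}\oplus\mathfrak D_{\Gamma^*_{2n+1}}),\qquad \widetilde{\mathfrak H}_0(\{\Gamma_n\}_{n\ge0})=\bigoplus_{n\ge0}(\mathfrak D_{\Gamma^*_{2n}}\oplus\mathfrak D_{\Gamma_{2n+1}})$$ (Hilbert space orthogonal sums; zero summands omitted), abbreviated $\mathfrak H_0,\widetilde{\mathfrak H}_0$. Here $\mathbf J_{\Gamma_0}:\mathfrak M\oplus\mathfrak D_{\Gamma_0^*}\to\mathfrak N\oplus\mathfrak D_{\Gamma_0}$ and $\mathbf J_{\Gamma_k}:\mathfrak D_{\Gamma_{k-1}}\oplus\mathfrak D_{\Gamma_k^*}\to\mathfrak D_{\Gamma_{k-1}^*}\oplus\mathfrak D_{\Gamma_k}$, $k\ge1$. Writing $\mathfrak M\oplus\widetilde{\mathfrak H}_0=(\mathfrak M\oplus\mathfrak D_{\Gamma_0^*})\oplus\bigoplus_{n\ge1}(\mathfrak D_{\Gamma_{2n-1}}\oplus\mathfrak D_{\Gamma_{2n}^*})$ and $\mathfrak N\oplus\mathfrak H_0=(\mathfrak N\oplus\mathfrak D_{\Gamma_0})\oplus\bigoplus_{n\ge1}(\mathfrak D_{\Gamma_{2n-1}^*}\oplus\mathfrak D_{\Gamma_{2n}})$,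 define the unitary operators $$\mathcal L_0=\mathbf J_{\Gamma_0}\oplus\bigoplus_{n\ge1}\mathbf J_{\Gamma_{2n}}:\mathfrak M\oplus\widetilde{\mathfrak H}_0\to\mathfrak N\oplus\mathfrak H_0,\qquad \mathcal V_0=\bigoplus_{n\ge1}\mathbf J_{\Gamma_{2n-1}}:\mathfrak H_0\to\widetilde{\mathfrak H}_0,$$ $$\mathcal U_0(\{\Gamma_n\}_{n\ge0})=\mathcal L_0(I_{\mathfrak M}\oplus\mathcal V_0):\mathfrak M\oplus\mathfrak H_0\to\mathfrak N\oplus\mathfrak H_0,\qquad \widetilde{\mathcal U}_0(\{\Gamma_n\}_{n\ge0})=(I_{\mathfrak N}\oplus\mathcal V_0)\mathcal L_0:\mathfrak M\oplus\widetilde{\mathfrak H}_0\to\mathfrak N\oplus\widetilde{\mathfrak H}_0 .$$ In the present statement $\mathfrak N=\mathfrak M$ and the construction is applied to $\{G_n\}_{n\ge 0}$. *)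

theory Defs
  imports "HOL-Analysis.Analysis"
begin

section \<open>Complex Hilbert spaces\<close>

class complex_normed_vector = real_normed_vector +
  fixes scaleC :: "complex \<Rightarrow> 'a \<Rightarrow> 'a"  (infixr "*\<^sub>C" 75)
  assumes scaleC_add_right: "c *\<^sub>C (x + y) = c *\<^sub>C x + c *\<^sub>C y"
    and scaleC_add_left: "(c + d) *\<^sub>C x = c *\<^sub>C x + d *\<^sub>C x"
    and scaleC_scaleC: "c *\<^sub>C d *\<^sub>C x = (c * d) *\<^sub>C x"
    and scaleC_of_real: "complex_of_real r *\<^sub>C x = r *\<^sub>R x"
    and norm_scaleC: "norm (c *\<^sub>C x) = cmod c * norm x"

text \<open>The complex inner product is linear in its first argument; its real part is the inner
  product of the underlying real Hilbert space, so that norm, topology and completeness are those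
  of the library.\<close>

class chilbert = complex_normed_vector + real_inner + complete_space +
  fixes cinner :: "'a \<Rightarrow> 'a \<Rightarrow> complex"
  assumes cinner_commute: "cinner x y = cnj (cinner y x)"
    and cinner_add_left: "cinner (x + y) z = cinner x z + cinner y z"
    and cinner_scaleC_left: "cinner (c *\<^sub>C x) y = c * cinner x y"
    and Re_cinner: "Re (cinner x y) = inner x y"

global_interpretation complex_vector:
  vector_space "scaleC :: complex \<Rightarrow> 'a \<Rightarrow> 'a::complex_normed_vector"
  defines csubspace = complex_vector.subspace
    and cspan = complex_vector.span
proof
  show "1 *\<^sub>C x = x" for x :: 'a
    using scaleC_of_real[of 1 x] by simp
qed (simp_all add: scaleC_add_right scaleC_add_left scaleC_scaleC)

abbreviation clinear :: "('a::complex_normed_vector \<Rightarrow> 'b::complex_normed_vector) \<Rightarrow> bool" where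
  "clinear \<equiv> Vector_Spaces.linear scaleC scaleC"

definition closed_csubspace :: "'a::complex_normed_vector set \<Rightarrow> bool" where
  "closed_csubspace A \<longleftrightarrow> csubspace A \<and> closed A"

lemma cinner_add_right: "cinner x (y + z) = cinner x y + cinner x (z :: 'a::chilbert)"
  by (metis cinner_commute cinner_add_left complex_cnj_add)

lemma cinner_scaleC_right: "cinner x (c *\<^sub>C y) = cnj c * cinner x (y :: 'a::chilbert)"
  by (metis cinner_commute cinner_scaleC_left complex_cnj_mult)

lemma cinner_Cauchy_Schwarz: "cmod (cinner x y) \<le> norm x * norm (y :: 'a::chilbert)"
proof (cases "cinner x y = 0")
  case False
  define c where "c = cnj (cinner x y) / cmod (cinner x y)"
  have c1: "cmod c = 1"
    using False by (simp add: c_def norm_divide)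
  have "cinner (c *\<^sub>C x) y = cmod (cinner x y)"
    using False
    by (simp add: cinner_scaleC_left c_def complex_norm_square[symmetric] power2_eq_square
        mult.commute)
  then have "cmod (cinner x y) = inner (c *\<^sub>C x) y"
    by (metis Re_cinner Re_complex_of_real)
  also have "\<dots> \<le> norm (c *\<^sub>C x) * norm y"
    by (rule norm_cauchy_schwarz)
  finally show ?thesis
    by (simp add: norm_scaleC c1)
qed simp

subsection \<open>Direct sums of two spaces\<close>

instantiation prod :: (complex_normed_vector, complex_normed_vector) complex_normed_vector
begin

definition scaleC_prod :: "complex \<Rightarrow> 'a \<times> 'b \<Rightarrow> 'a \<times> 'b" where
  "c *\<^sub>C p = (c *\<^sub>C fst p, c *\<^sub>C snd p)"

instance
proof
  show "norm (c *\<^sub>C p) = cmod c * norm p" for c and p :: "'a \<times> 'b"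
    by (simp add: scaleC_prod_def norm_prod_def norm_scaleC power_mult_distrib
        distrib_left[symmetric] real_sqrt_mult)
qed (auto simp: scaleC_prod_def prod_eq_iff scaleC_add_right scaleC_add_left scaleC_scaleC
    scaleC_of_real)

end

instantiation prod :: (chilbert, chilbert) chilbert
begin

definition cinner_prod :: "'a \<times> 'b \<Rightarrow> 'a \<times> 'b \<Rightarrow> complex" where
  "cinner p q = cinner (fst p) (fst q) + cinner (snd p) (snd q)"

instance
proof
  show "cinner p q = cnj (cinner q p)" for p q :: "'a \<times> 'b"
    unfolding cinner_prod_def
    by (metis cinner_commute complex_cnj_add)
qed (auto simp: cinner_prod_def scaleC_prod_def cinner_add_left cinner_scaleC_left Re_cinner
    algebra_simps inner_prod_def)

end

subsection \<open>The Hilbert sum of countably many copies of a space\<close>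

typedef (overloaded) 'a l2 = "{f :: nat \<Rightarrow> 'a::real_normed_vector. summable (\<lambda>n. (norm (f n))\<^sup>2)}"
  morphisms l2_nth Abs_l2
  by (rule exI[of _ "\<lambda>_. 0"]) simp

setup_lifting type_definition_l2

lemma l2_summable: "summable (\<lambda>n. (norm (l2_nth f n))\<^sup>2)"
  using l2_nth[of f] by simp

lemma l2_eqI: "(\<And>n. l2_nth f n = l2_nth g n) \<Longrightarrow> f = g"
  by (metis l2_nth_inject ext)

lemma l2_add_summable:
  fixes f g :: "nat \<Rightarrow> 'a::real_normed_vector"
  assumes "summable (\<lambda>n. (norm (f n))\<^sup>2)" "summable (\<lambda>n. (norm (g n))\<^sup>2)"
  shows "summable (\<lambda>n. (norm (f n + g n))\<^sup>2)"
proof (rule summable_comparison_test')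
  show "summable (\<lambda>n. 2 * (norm (f n))\<^sup>2 + 2 * (norm (g n))\<^sup>2)"
    by (intro summable_add summable_mult assms)
  show "norm ((norm (f n + g n))\<^sup>2) \<le> 2 * (norm (f n))\<^sup>2 + 2 * (norm (g n))\<^sup>2"
    if "n \<ge> 0" for n
  proof -
    have "(norm (f n + g n))\<^sup>2 \<le> (norm (f n) + norm (g n))\<^sup>2"
      by (intro power_mono norm_triangle_ineq) simp
    also have "\<dots> \<le> 2 * (norm (f n))\<^sup>2 + 2 * (norm (g n))\<^sup>2"
      using sum_squares_bound[of "norm (f n)" "norm (g n)"] by (simp add: power2_sum)
    finally show ?thesis by simp
  qed
qed

instantiation l2 :: (real_normed_vector) real_vector
begin

lift_definition zero_l2 :: "'a l2" is "\<lambda>_. 0" by simp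

lift_definition plus_l2 :: "'a l2 \<Rightarrow> 'a l2 \<Rightarrow> 'a l2" is "\<lambda>f g n. f n + g n"
  by (rule l2_add_summable)

lift_definition uminus_l2 :: "'a l2 \<Rightarrow> 'a l2" is "\<lambda>f n. - f n" by simp

lift_definition minus_l2 :: "'a l2 \<Rightarrow> 'a l2 \<Rightarrow> 'a l2" is "\<lambda>f g n. f n - g n"
  using l2_add_summable[where g = "\<lambda>n. - g n" for g] by fastforce

lift_definition scaleR_l2 :: "real \<Rightarrow> 'a l2 \<Rightarrow> 'a l2" is "\<lambda>r f n. r *\<^sub>R f n"
  by (simp add: power_mult_distrib summable_mult)

instance
  by standard (transfer; auto simp: algebra_simps fun_eq_iff)+

end

instantiation l2 :: (real_normed_vector) real_normed_vector
begin

definition norm_l2 :: "'a l2 \<Rightarrow> real" where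
  "norm f = sqrt (\<Sum>n. (norm (l2_nth f n))\<^sup>2)"

definition sgn_l2 :: "'a l2 \<Rightarrow> 'a l2" where
  "sgn_l2 f = f /\<^sub>R norm f"

definition dist_l2 :: "'a l2 \<Rightarrow> 'a l2 \<Rightarrow> real" where
  "dist_l2 f g = norm (f - g)"

definition uniformity_l2 :: "('a l2 \<times> 'a l2) filter" where
  "uniformity_l2 = (INF e\<in>{0 <..}. principal {(f, g). dist f g < e})"

definition open_l2 :: "'a l2 set \<Rightarrow> bool" where
  "open_l2 S \<longleftrightarrow> (\<forall>x\<in>S. \<forall>\<^sub>F (x', y) in uniformity. x' = x \<longrightarrow> y \<in> S)"

instance
proof
  fix f g :: "'a l2" and r :: real
  show "norm f = 0 \<longleftrightarrow> f = 0"
  proof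
    assume "norm f = 0"
    then have "\<forall>n. (norm (l2_nth f n))\<^sup>2 = 0"
      using suminf_eq_zero_iff[OF l2_summable[of f]] by (simp add: norm_l2_def)
    then show "f = 0"
      by (intro l2_eqI) (simp add: zero_l2.rep_eq)
  qed (simp add: norm_l2_def zero_l2.rep_eq)
  have "(\<Sum>n. (norm (l2_nth (r *\<^sub>R f) n))\<^sup>2) = r\<^sup>2 * (\<Sum>n. (norm (l2_nth f n))\<^sup>2)"
    by (simp add: scaleR_l2.rep_eq power_mult_distrib suminf_mult l2_summable)
  then show "norm (r *\<^sub>R f) = \<bar>r\<bar> * norm f"
    by (simp add: norm_l2_def real_sqrt_mult)
  have L2: "L2_set (\<lambda>n. norm (l2_nth h n)) {..<N} \<le> norm h" for h :: "'a l2" and N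
    unfolding L2_set_def norm_l2_def
    by (intro real_sqrt_le_mono sum_le_suminf l2_summable) auto
  have "(\<Sum>n. (norm (l2_nth (f + g) n))\<^sup>2) \<le> (norm f + norm g)\<^sup>2"
  proof (rule suminf_le_const[OF l2_summable])
    fix N :: nat
    have "L2_set (\<lambda>n. norm (l2_nth (f + g) n)) {..<N}
        \<le> L2_set (\<lambda>n. norm (l2_nth f n) + norm (l2_nth g n)) {..<N}"
      by (intro L2_set_mono) (auto simp: plus_l2.rep_eq norm_triangle_ineq)
    also have "\<dots> \<le> norm f + norm g"
      using L2_set_triangle_ineq[of "\<lambda>n. norm (l2_nth f n)" "\<lambda>n. norm (l2_nth g n)" "{..<N}"]
        L2[of f N] L2[of g N] by simp
    finally have "(L2_set (\<lambda>n. norm (l2_nth (f + g) n)) {..<N})\<^sup>2 \<le> (norm f + norm g)\<^sup>2"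
      by (intro power_mono) simp_all
    then show "(\<Sum>n<N. (norm (l2_nth (f + g) n))\<^sup>2) \<le> (norm f + norm g)\<^sup>2"
      by (simp add: L2_set_def sum_nonneg)
  qed
  moreover have "0 \<le> norm f + norm g"
    by (simp add: norm_l2_def suminf_nonneg l2_summable)
  ultimately show "norm (f + g) \<le> norm f + norm g"
    unfolding norm_l2_def[of "f + g"] by (intro real_le_lsqrt)
qed (simp_all add: sgn_l2_def dist_l2_def uniformity_l2_def open_l2_def)

end

lemma norm_l2_power2: "(norm f)\<^sup>2 = (\<Sum>n. (norm (l2_nth f n))\<^sup>2)"
  by (simp add: norm_l2_def suminf_nonneg l2_summable)

lemma norm_l2_nth_sum_le: "(\<Sum>n<N. (norm (l2_nth f n))\<^sup>2) \<le> (norm f)\<^sup>2"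
  unfolding norm_l2_power2 by (rule sum_le_suminf[OF l2_summable]) auto

lemma norm_l2_nth_le: "norm (l2_nth f n) \<le> norm f"
proof -
  have "(norm (l2_nth f n))\<^sup>2 \<le> (\<Sum>k<Suc n. (norm (l2_nth f k))\<^sup>2)"
    by (simp add: sum_nonneg)
  also note norm_l2_nth_sum_le
  finally show ?thesis by (rule power2_le_imp_le) simp
qed

instance l2 :: ("{real_normed_vector, complete_space}") complete_space
proof
  fix X :: "nat \<Rightarrow> 'a l2"
  assume X: "Cauchy X"
  have nth_diff: "l2_nth (f - g) n = l2_nth f n - l2_nth g n" for f g :: "'a l2" and n
    by (simp add: minus_l2.rep_eq)
  have "Cauchy (\<lambda>k. l2_nth (X k) n)" for n
  proof (rule CauchyI)
    fix e :: real assume "e > 0"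
    then obtain M where M: "\<forall>m\<ge>M. \<forall>k\<ge>M. norm (X m - X k) < e"
      using CauchyD[OF X] by blast
    have "norm (l2_nth (X m) n - l2_nth (X k) n) < e" if "m \<ge> M" "k \<ge> M" for m k
      using norm_l2_nth_le[of "X m - X k" n] M[rule_format, OF that] by (simp add: nth_diff)
    then show "\<exists>M. \<forall>m\<ge>M. \<forall>k\<ge>M. norm (l2_nth (X m) n - l2_nth (X k) n) < e"
      by blast
  qed
  then have "\<exists>l. (\<lambda>k. l2_nth (X k) n) \<longlonglongrightarrow> l" for n
    using Cauchy_convergent unfolding convergent_def by blast
  then obtain f where f: "\<And>n. (\<lambda>k. l2_nth (X k) n) \<longlonglongrightarrow> f n"
    by metis
  have bound: "\<exists>M. \<forall>m\<ge>M. \<forall>N. (\<Sum>n<N. (norm (l2_nth (X m) n - f n))\<^sup>2) \<le> e\<^sup>2"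
    if e: "e > 0" for e :: real
  proof -
    obtain M where M: "\<forall>m\<ge>M. \<forall>k\<ge>M. norm (X m - X k) < e"
      using CauchyD[OF X e] by blast
    have "(\<Sum>n<N. (norm (l2_nth (X m) n - f n))\<^sup>2) \<le> e\<^sup>2" if m: "m \<ge> M" for m N
    proof (rule tendsto_upperbound)
      show "(\<lambda>k. \<Sum>n<N. (norm (l2_nth (X m) n - l2_nth (X k) n))\<^sup>2)
        \<longlonglongrightarrow> (\<Sum>n<N. (norm (l2_nth (X m) n - f n))\<^sup>2)"
        by (intro tendsto_intros f)
      show "\<forall>\<^sub>F k in sequentially. (\<Sum>n<N. (norm (l2_nth (X m) n - l2_nth (X k) n))\<^sup>2) \<le> e\<^sup>2"
        using eventually_ge_at_top[of M]
      proof eventually_elim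
        case (elim k)
        have "(\<Sum>n<N. (norm (l2_nth (X m) n - l2_nth (X k) n))\<^sup>2) \<le> (norm (X m - X k))\<^sup>2"
          using norm_l2_nth_sum_le[of "X m - X k" N] by (simp add: nth_diff)
        also have "\<dots> \<le> e\<^sup>2"
          using M m elim by (intro power_mono) (auto intro: less_imp_le)
        finally show ?case .
      qed
    qed simp
    then show ?thesis by blast
  qed
  obtain M where M: "\<And>m N. m \<ge> M \<Longrightarrow> (\<Sum>n<N. (norm (l2_nth (X m) n - f n))\<^sup>2) \<le> 1\<^sup>2"
    using bound[of 1] by auto
  have dsum: "summable (\<lambda>n. (norm (l2_nth (X M) n - f n))\<^sup>2)"
    using M[of M] by (intro summableI_nonneg_bounded[where x = "1\<^sup>2"]) auto
  have "summable (\<lambda>n. (norm (f n))\<^sup>2)"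
  proof -
    have "summable (\<lambda>n. (norm (- (l2_nth (X M) n - f n)))\<^sup>2)"
      using dsum by (simp only: norm_minus_cancel)
    from l2_add_summable[OF l2_summable[of "X M"] this] show ?thesis by simp
  qed
  then have F: "l2_nth (Abs_l2 f) = f"
    by (simp add: Abs_l2_inverse)
  have "X \<longlonglongrightarrow> Abs_l2 f"
  proof (rule LIMSEQ_I)
    fix e :: real assume "e > 0"
    then obtain M where M: "\<And>m N. m \<ge> M \<Longrightarrow> (\<Sum>n<N. (norm (l2_nth (X m) n - f n))\<^sup>2) \<le> (e/2)\<^sup>2"
      using bound[of "e/2"] by auto
    have "norm (X m - Abs_l2 f) < e" if "m \<ge> M" for m
    proof -
      have "(norm (X m - Abs_l2 f))\<^sup>2 \<le> (e/2)\<^sup>2"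
        unfolding norm_l2_power2
        using M[OF that]
        by (intro suminf_le_const l2_summable) (simp add: nth_diff F)
      then have "norm (X m - Abs_l2 f) \<le> e/2"
        using \<open>e > 0\<close> power2_le_imp_le[of "norm (X m - Abs_l2 f)" "e/2"] by linarith
      then show ?thesis using \<open>e > 0\<close> by simp
    qed
    then show "\<exists>M. \<forall>m\<ge>M. norm (X m - Abs_l2 f) < e" by blast
  qed
  then show "convergent X" by (rule convergentI)
qed

lemma l2_inner_summable:
  fixes f g :: "'a::real_inner l2"
  shows "summable (\<lambda>n. inner (l2_nth f n) (l2_nth g n))"
proof (rule summable_comparison_test')
  show "summable (\<lambda>n. (norm (l2_nth f n))\<^sup>2 + (norm (l2_nth g n))\<^sup>2)"
    by (intro summable_add l2_summable)
  show "norm (inner (l2_nth f n) (l2_nth g n)) \<le> (norm (l2_nth f n))\<^sup>2 + (norm (l2_nth g n))\<^sup>2"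
    if "n \<ge> 0" for n
  proof -
    have "2 * (norm (l2_nth f n) * norm (l2_nth g n)) \<le> (norm (l2_nth f n))\<^sup>2 + (norm (l2_nth g n))\<^sup>2"
      using sum_squares_bound[of "norm (l2_nth f n)" "norm (l2_nth g n)"] by simp
    moreover have "0 \<le> norm (l2_nth f n) * norm (l2_nth g n)" by simp
    ultimately show ?thesis
      using Cauchy_Schwarz_ineq2[of "l2_nth f n" "l2_nth g n"] by simp
  qed
qed

instantiation l2 :: (real_inner) real_inner
begin

definition inner_l2 :: "'a l2 \<Rightarrow> 'a l2 \<Rightarrow> real" where
  "inner f g = (\<Sum>n. inner (l2_nth f n) (l2_nth g n))"

instance
proof
  fix f g h :: "'a l2" and r :: real
  have norm: "(norm f)\<^sup>2 = inner f f"
    by (simp add: norm_l2_power2 inner_l2_def power2_norm_eq_inner)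
  show "inner f g = inner g f"
    by (simp add: inner_l2_def inner_commute)
  show "inner (f + g) h = inner f h + inner g h"
    by (simp add: inner_l2_def plus_l2.rep_eq inner_add_left suminf_add l2_inner_summable)
  show "inner (r *\<^sub>R f) g = r * inner f g"
    by (simp add: inner_l2_def scaleR_l2.rep_eq suminf_mult l2_inner_summable)
  show "0 \<le> inner f f"
    unfolding norm[symmetric] by simp
  show "inner f f = 0 \<longleftrightarrow> f = 0"
    unfolding norm[symmetric] by simp
  show "norm f = sqrt (inner f f)"
    unfolding norm[symmetric] by simp
qed

end

lemma l2_cinner_summable:
  fixes f g :: "'a::chilbert l2"
  shows "summable (\<lambda>n. cinner (l2_nth f n) (l2_nth g n))"
proof (rule summable_comparison_test')
  show "summable (\<lambda>n. (norm (l2_nth f n))\<^sup>2 + (norm (l2_nth g n))\<^sup>2)"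
    by (intro summable_add l2_summable)
  show "norm (cinner (l2_nth f n) (l2_nth g n)) \<le> (norm (l2_nth f n))\<^sup>2 + (norm (l2_nth g n))\<^sup>2"
    if "n \<ge> 0" for n
  proof -
    have "2 * (norm (l2_nth f n) * norm (l2_nth g n)) \<le> (norm (l2_nth f n))\<^sup>2 + (norm (l2_nth g n))\<^sup>2"
      using sum_squares_bound[of "norm (l2_nth f n)" "norm (l2_nth g n)"] by simp
    moreover have "0 \<le> norm (l2_nth f n) * norm (l2_nth g n)" by simp
    moreover have "cmod (cinner (l2_nth f n) (l2_nth g n)) \<le> norm (l2_nth f n) * norm (l2_nth g n)"
      by (rule cinner_Cauchy_Schwarz)
    ultimately show ?thesis by linarith
  qed
qed

instantiation l2 :: (chilbert) chilbert
begin

lift_definition scaleC_l2 :: "complex \<Rightarrow> 'a l2 \<Rightarrow> 'a l2" is "\<lambda>c f n. c *\<^sub>C f n"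
  by (simp add: norm_scaleC power_mult_distrib summable_mult)

definition cinner_l2 :: "'a l2 \<Rightarrow> 'a l2 \<Rightarrow> complex" where
  "cinner f g = (\<Sum>n. cinner (l2_nth f n) (l2_nth g n))"

instance
proof
  fix f g h :: "'a l2" and c d :: complex and r :: real
  show "c *\<^sub>C (f + g) = c *\<^sub>C f + c *\<^sub>C g"
    by transfer (simp add: scaleC_add_right)
  show "(c + d) *\<^sub>C f = c *\<^sub>C f + d *\<^sub>C f"
    by transfer (simp add: scaleC_add_left)
  show "c *\<^sub>C d *\<^sub>C f = (c * d) *\<^sub>C f"
    by transfer (simp add: scaleC_scaleC)
  show "complex_of_real r *\<^sub>C f = r *\<^sub>R f"
    by transfer (simp add: scaleC_of_real)
  have "(norm (c *\<^sub>C f))\<^sup>2 = (cmod c * norm f)\<^sup>2"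
    unfolding power_mult_distrib norm_l2_power2 scaleC_l2.rep_eq norm_scaleC
    by (intro suminf_mult l2_summable)
  then show "norm (c *\<^sub>C f) = cmod c * norm f"
    by (simp add: power2_eq_iff_nonneg)
  have "cnj (\<Sum>n. cinner (l2_nth g n) (l2_nth f n)) = (\<Sum>n. cnj (cinner (l2_nth g n) (l2_nth f n)))"
    by (rule bounded_linear.suminf[OF bounded_linear_cnj l2_cinner_summable])
  then show "cinner f g = cnj (cinner g f)"
    by (simp add: cinner_l2_def cinner_commute[symmetric])
  show "cinner (f + g) h = cinner f h + cinner g h"
    by (simp add: cinner_l2_def plus_l2.rep_eq cinner_add_left suminf_add l2_cinner_summable)
  show "cinner (c *\<^sub>C f) g = c * cinner f g"
    by (simp add: cinner_l2_def scaleC_l2.rep_eq cinner_scaleC_left suminf_mult l2_cinner_summable)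
  show "Re (cinner f g) = inner f g"
    by (simp add: cinner_l2_def inner_l2_def Re_cinner[symmetric]
        bounded_linear.suminf[OF bounded_linear_Re] l2_cinner_summable)
qed

end

section \<open>Operators\<close>

instantiation blinfun :: (real_normed_vector, complex_normed_vector) complex_normed_vector
begin

lemma bounded_linear_scaleC: "bounded_linear (\<lambda>x :: 'z::complex_normed_vector. c *\<^sub>C x)"
proof (rule bounded_linear_intro[where K = "cmod c"])
  fix x y :: 'z and r :: real
  show "c *\<^sub>C (x + y) = c *\<^sub>C x + c *\<^sub>C y"
    by (rule scaleC_add_right)
  show "c *\<^sub>C r *\<^sub>R x = r *\<^sub>R c *\<^sub>C x"
    by (metis scaleC_of_real scaleC_scaleC mult.commute)
  show "norm (c *\<^sub>C x) \<le> norm x * cmod c"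
    by (simp add: norm_scaleC)
qed

lift_definition scaleC_blinfun :: "complex \<Rightarrow> 'a \<Rightarrow>\<^sub>L 'b \<Rightarrow> 'a \<Rightarrow>\<^sub>L 'b" is "\<lambda>c T x. c *\<^sub>C T x"
  by (rule bounded_linear_compose[OF bounded_linear_scaleC])

instance
proof
  fix S T :: "'a \<Rightarrow>\<^sub>L 'b" and c d :: complex and r :: real
  show "c *\<^sub>C (S + T) = c *\<^sub>C S + c *\<^sub>C T"
    by transfer (simp add: scaleC_add_right)
  show "(c + d) *\<^sub>C T = c *\<^sub>C T + d *\<^sub>C T"
    by transfer (simp add: scaleC_add_left)
  show "c *\<^sub>C d *\<^sub>C T = (c * d) *\<^sub>C T"
    by transfer (simp add: scaleC_scaleC)
  show "complex_of_real r *\<^sub>C T = r *\<^sub>R T"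
    by transfer (simp add: scaleC_of_real)
  have le: "norm (c *\<^sub>C T) \<le> cmod c * norm T" for c :: complex and T :: "'a \<Rightarrow>\<^sub>L 'b"
  proof (rule norm_blinfun_bound)
    show "norm (blinfun_apply (c *\<^sub>C T) x) \<le> cmod c * norm T * norm x" for x
      using mult_left_mono[OF norm_blinfun[of T x], of "cmod c"]
      by (simp add: scaleC_blinfun.rep_eq norm_scaleC mult.assoc)
  qed simp
  show "norm (c *\<^sub>C T) = cmod c * norm T"
  proof (cases "c = 0")
    case True
    then show ?thesis using le[of c T] by simp
  next
    case False
    have "inverse c *\<^sub>C c *\<^sub>C T = T"
      using False by (intro blinfun_eqI) (simp add: scaleC_blinfun.rep_eq scaleC_scaleC)
    then have "norm T \<le> cmod (inverse c) * norm (c *\<^sub>C T)"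
      using le[of "inverse c" "c *\<^sub>C T"] by simp
    then show ?thesis
      using le[of c T] False by (simp add: norm_divide inverse_eq_divide field_simps)
  qed
qed

end

text \<open>
  A bounded operator \<open>T\<close> from a closed subspace \<open>A\<close> of \<open>'a\<close> into a closed subspace \<open>B\<close> of \<open>'b\<close>
  is represented by its extension by zero to the orthogonal complement of \<open>A\<close>. This
  identifies \<open>L(A,B)\<close> isometrically with \<open>bop A B\<close> and is compatible with composition and
  adjoints; the identity of \<open>A\<close> becomes the orthogonal projection \<open>proj A\<close>.
\<close>

definition bop :: "'a::chilbert set \<Rightarrow> 'b::chilbert set \<Rightarrow> ('a \<Rightarrow>\<^sub>L 'b) set" where
  "bop A B = {T. clinear (blinfun_apply T) \<and> range (blinfun_apply T) \<subseteq> B \<and>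
     (\<forall>x. (\<forall>a\<in>A. cinner x a = 0) \<longrightarrow> blinfun_apply T x = 0)}"

definition proj :: "'a::chilbert set \<Rightarrow> 'a \<Rightarrow>\<^sub>L 'a" where
  "proj A = (THE P. \<forall>x. blinfun_apply P x \<in> A \<and> (\<forall>a\<in>A. cinner (x - blinfun_apply P x) a = 0))"

definition adj :: "('a::chilbert \<Rightarrow>\<^sub>L 'b::chilbert) \<Rightarrow> 'b \<Rightarrow>\<^sub>L 'a" where
  "adj T = (THE S. \<forall>x y. cinner (blinfun_apply T x) y = cinner x (blinfun_apply S y))"

definition nonneg_op :: "('a::chilbert \<Rightarrow>\<^sub>L 'a) \<Rightarrow> bool" where
  "nonneg_op T \<longleftrightarrow> clinear (blinfun_apply T) \<and>
     (\<forall>x. cinner (blinfun_apply T x) x \<in> \<real> \<and> 0 \<le> Re (cinner (blinfun_apply T x) x))"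

definition op_sqrt :: "('a::chilbert \<Rightarrow>\<^sub>L 'a) \<Rightarrow> 'a \<Rightarrow>\<^sub>L 'a" where
  "op_sqrt S = (THE R. nonneg_op R \<and> R o\<^sub>L R = S)"

text \<open>The inverse in \<open>L(A,A)\<close>.\<close>

definition op_inv :: "'a::chilbert set \<Rightarrow> ('a \<Rightarrow>\<^sub>L 'a) \<Rightarrow> 'a \<Rightarrow>\<^sub>L 'a" where
  "op_inv A S = (THE R. R \<in> bop A A \<and> R o\<^sub>L S = proj A \<and> S o\<^sub>L R = proj A)"

text \<open>
  For a contraction \<open>T\<close> from \<open>A\<close> to \<open>B\<close>, the defect operators and defect spaces of \<open>T\<close> and of its
  adjoint are \<open>defect A T\<close>, \<open>defect_space A T\<close> and \<open>defect B (adj T)\<close>, \<open>defect_space B (adj T)\<close>.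
\<close>

definition defect :: "'a::chilbert set \<Rightarrow> ('a \<Rightarrow>\<^sub>L 'b::chilbert) \<Rightarrow> 'a \<Rightarrow>\<^sub>L 'a" where
  "defect A T = op_sqrt (proj A - (adj T o\<^sub>L T))"

definition defect_space :: "'a::chilbert set \<Rightarrow> ('a \<Rightarrow>\<^sub>L 'b::chilbert) \<Rightarrow> 'a set" where
  "defect_space A T = closure (range (blinfun_apply (defect A T)))"

text \<open>
  The block matrix \<open>J\<^sub>T\<close>, to be applied to pairs in \<open>A \<oplus> defect_space B (adj T)\<close>. If a defect space
  is zero, the corresponding row or column acts on (or maps to) a zero summand.
\<close>

definition elementary_rotation ::
  "'a::chilbert set \<Rightarrow> 'b::chilbert set \<Rightarrow> ('a \<Rightarrow>\<^sub>L 'b) \<Rightarrow> 'a \<times> 'b \<Rightarrow> 'b \<times> 'a" where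
  "elementary_rotation A B T = (\<lambda>(x, y).
     (blinfun_apply T x + blinfun_apply (defect B (adj T)) y,
      blinfun_apply (defect A T) x - blinfun_apply (adj T) y))"

definition unitary_between ::
  "'h::chilbert set \<Rightarrow> 'k::chilbert set \<Rightarrow> ('h \<Rightarrow> 'k) \<Rightarrow> bool" where
  "unitary_between H K W \<longleftrightarrow>
     (\<forall>x\<in>H. \<forall>y\<in>H. W (x + y) = W x + W y) \<and>
     (\<forall>c. \<forall>x\<in>H. W (c *\<^sub>C x) = c *\<^sub>C W x) \<and>
     (\<forall>x\<in>H. \<forall>y\<in>H. cinner (W x) (W y) = cinner x y) \<and>
     W ` H = K"

definition int_power :: "'h set \<Rightarrow> ('h \<Rightarrow> 'h) \<Rightarrow> int \<Rightarrow> 'h \<Rightarrow> 'h" where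
  "int_power H U n = (if 0 \<le> n then U ^^ nat n else inv_into H U ^^ nat (- n))"

section \<open>The Schur class and Schur parameters\<close>

definition holomorphic_op :: "(complex \<Rightarrow> 'a::complex_normed_vector) \<Rightarrow> complex set \<Rightarrow> bool" where
  "holomorphic_op f S \<longleftrightarrow> (\<forall>z\<in>S. \<exists>D. (f has_derivative (\<lambda>h. h *\<^sub>C D)) (at z within S))"

definition schur_class ::
  "'a::chilbert set \<Rightarrow> 'b::chilbert set \<Rightarrow> (complex \<Rightarrow> 'a \<Rightarrow>\<^sub>L 'b) set" where
  "schur_class A B = {\<Theta>. (\<forall>z\<in>ball 0 1. \<Theta> z \<in> bop A B \<and> norm (\<Theta> z) \<le> 1) \<and>
     holomorphic_op \<Theta> (ball 0 1)}"

text \<open>The last conjunct only normalizes the values outside the disk.\<close>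

definition schur_next ::
  "'a::chilbert set \<Rightarrow> 'b::chilbert set \<Rightarrow> (complex \<Rightarrow> 'a \<Rightarrow>\<^sub>L 'b) \<Rightarrow> complex \<Rightarrow> 'a \<Rightarrow>\<^sub>L 'b" where
  "schur_next A B \<Theta> = (let \<Gamma> = \<Theta> 0; A' = defect_space A \<Gamma>; B' = defect_space B (adj \<Gamma>) in
     THE \<Psi>. \<Psi> \<in> schur_class A' B' \<and>
       (\<forall>z\<in>ball 0 1. \<Theta> z = \<Gamma> + z *\<^sub>C (defect B (adj \<Gamma>) o\<^sub>L \<Psi> z o\<^sub>L
          op_inv A' (proj A' + z *\<^sub>C (adj \<Gamma> o\<^sub>L \<Psi> z)) o\<^sub>L defect A \<Gamma>)) \<and>
       (\<forall>z. z \<notin> ball 0 1 \<longrightarrow> \<Psi> z = 0))"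

text \<open>
  \<open>schur_iterate n A B \<Theta>\<close> is \<open>\<Theta>\<^sub>n\<close>. No separate termination rule is needed: once a parameter is
  isometric, co-isometric or unitary, one or both of the next spaces are zero, and all later
  functions vanish.
\<close>

primrec schur_iterate ::
  "nat \<Rightarrow> 'a::chilbert set \<Rightarrow> 'b::chilbert set \<Rightarrow> (complex \<Rightarrow> 'a \<Rightarrow>\<^sub>L 'b) \<Rightarrow> complex \<Rightarrow> 'a \<Rightarrow>\<^sub>L 'b"
where
  "schur_iterate 0 A B \<Theta> = \<Theta>"
| "schur_iterate (Suc n) A B \<Theta> =
     schur_iterate n (defect_space A (\<Theta> 0)) (defect_space B (adj (\<Theta> 0))) (schur_next A B \<Theta>)"

definition schur_parameter ::
  "'a::chilbert set \<Rightarrow> 'b::chilbert set \<Rightarrow> (complex \<Rightarrow> 'a \<Rightarrow>\<^sub>L 'b) \<Rightarrow> nat \<Rightarrow> 'a \<Rightarrow>\<^sub>L 'b" where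
  "schur_parameter A B \<Theta> n = schur_iterate n A B \<Theta> 0"

section \<open>Block operator CMV matrices\<close>

text \<open>
  \<open>\<Gamma>\<^sub>n\<close> maps \<open>param_dom \<Gamma> n\<close> to \<open>param_cod \<Gamma> n\<close>, so \<open>param_dom \<Gamma> (Suc n)\<close> and \<open>param_cod \<Gamma> (Suc n)\<close>
  are the defect spaces of \<open>\<Gamma>\<^sub>n\<close> and of its adjoint.
\<close>

primrec param_dom :: "(nat \<Rightarrow> 'a::chilbert \<Rightarrow>\<^sub>L 'b::chilbert) \<Rightarrow> nat \<Rightarrow> 'a set" where
  "param_dom \<Gamma> 0 = UNIV"
| "param_dom \<Gamma> (Suc n) = defect_space (param_dom \<Gamma> n) (\<Gamma> n)"

primrec param_cod :: "(nat \<Rightarrow> 'a::chilbert \<Rightarrow>\<^sub>L 'b::chilbert) \<Rightarrow> nat \<Rightarrow> 'b set" where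
  "param_cod \<Gamma> 0 = UNIV"
| "param_cod \<Gamma> (Suc n) = defect_space (param_cod \<Gamma> n) (adj (\<Gamma> n))"

definition param_rotation ::
  "(nat \<Rightarrow> 'a::chilbert \<Rightarrow>\<^sub>L 'b::chilbert) \<Rightarrow> nat \<Rightarrow> 'a \<times> 'b \<Rightarrow> 'b \<times> 'a" where
  "param_rotation \<Gamma> n = elementary_rotation (param_dom \<Gamma> n) (param_cod \<Gamma> n) (\<Gamma> n)"

text \<open>The \<open>n\<close>-th entry of a vector of \<open>cmv_sum \<Gamma>\<close> is a pair in \<open>D(\<Gamma>\<^sub>2\<^sub>n) \<oplus> D(\<Gamma>\<^sub>2\<^sub>n\<^sub>+\<^sub>1\<^sup>*)\<close>;
  for \<open>cmv_sum' \<Gamma>\<close> it is a pair in \<open>D(\<Gamma>\<^sub>2\<^sub>n\<^sup>*) \<oplus> D(\<Gamma>\<^sub>2\<^sub>n\<^sub>+\<^sub>1)\<close>.\<close>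

definition cmv_sum :: "(nat \<Rightarrow> 'a::chilbert \<Rightarrow>\<^sub>L 'b::chilbert) \<Rightarrow> ('a \<times> 'b) l2 set" where
  "cmv_sum \<Gamma> = {h. \<forall>n. l2_nth h n \<in> param_dom \<Gamma> (Suc (2 * n)) \<times> param_cod \<Gamma> (Suc (2 * n + 1))}"

definition cmv_sum' :: "(nat \<Rightarrow> 'a::chilbert \<Rightarrow>\<^sub>L 'b::chilbert) \<Rightarrow> ('b \<times> 'a) l2 set" where
  "cmv_sum' \<Gamma> = {g. \<forall>n. l2_nth g n \<in> param_cod \<Gamma> (Suc (2 * n)) \<times> param_dom \<Gamma> (Suc (2 * n + 1))}"

definition cmv_V :: "(nat \<Rightarrow> 'a::chilbert \<Rightarrow>\<^sub>L 'b::chilbert) \<Rightarrow> ('a \<times> 'b) l2 \<Rightarrow> ('b \<times> 'a) l2" where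
  "cmv_V \<Gamma> h = Abs_l2 (\<lambda>n. param_rotation \<Gamma> (2 * n + 1) (l2_nth h n))"

text \<open>
  \<open>cmv_L_block \<Gamma> (m, g) n\<close> is the image under the rotation of \<open>\<Gamma>\<^sub>2\<^sub>n\<close> of the \<open>n\<close>-th summand of
  \<open>(m, g)\<close> in the regrouped direct sum: \<open>(m, fst g\<^sub>0)\<close> for \<open>n = 0\<close>, and
  \<open>(snd g\<^sub>n\<^sub>-\<^sub>1, fst g\<^sub>n)\<close> for \<open>n \<ge> 1\<close>.
  In \<open>cmv_L\<close> the resulting pairs are regrouped back.
\<close>

definition cmv_L_block ::
  "(nat \<Rightarrow> 'a::chilbert \<Rightarrow>\<^sub>L 'b::chilbert) \<Rightarrow> 'a \<times> ('b \<times> 'a) l2 \<Rightarrow> nat \<Rightarrow> 'b \<times> 'a" where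
  "cmv_L_block \<Gamma> v n = param_rotation \<Gamma> (2 * n)
     (case n of 0 \<Rightarrow> fst v | Suc k \<Rightarrow> snd (l2_nth (snd v) k), fst (l2_nth (snd v) n))"

definition cmv_L ::
  "(nat \<Rightarrow> 'a::chilbert \<Rightarrow>\<^sub>L 'b::chilbert) \<Rightarrow> 'a \<times> ('b \<times> 'a) l2 \<Rightarrow> 'b \<times> ('a \<times> 'b) l2" where
  "cmv_L \<Gamma> v = (fst (cmv_L_block \<Gamma> v 0),
     Abs_l2 (\<lambda>n. (snd (cmv_L_block \<Gamma> v n), fst (cmv_L_block \<Gamma> v (Suc n)))))"

definition cmv ::
  "(nat \<Rightarrow> 'a::chilbert \<Rightarrow>\<^sub>L 'b::chilbert) \<Rightarrow> 'a \<times> ('a \<times> 'b) l2 \<Rightarrow> 'b \<times> ('a \<times> 'b) l2" where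
  "cmv \<Gamma> = cmv_L \<Gamma> \<circ> map_prod id (cmv_V \<Gamma>)"

definition cmv' ::
  "(nat \<Rightarrow> 'a::chilbert \<Rightarrow>\<^sub>L 'b::chilbert) \<Rightarrow> 'a \<times> ('b \<times> 'a) l2 \<Rightarrow> 'b \<times> ('b \<times> 'a) l2" where
  "cmv' \<Gamma> = map_prod id (cmv_V \<Gamma>) \<circ> cmv_L \<Gamma>"

section \<open>Operator-valued measures on the circle and Naimark dilations\<close>

definition circle_sets :: "complex set set" where
  "circle_sets = sets (restrict_space borel (sphere 0 1))"

definition op_measure :: "(complex set \<Rightarrow> 'm::chilbert \<Rightarrow>\<^sub>L 'm) \<Rightarrow> bool" where
  "op_measure \<mu> \<longleftrightarrow> (\<forall>X\<in>circle_sets. nonneg_op (\<mu> X)) \<and> \<mu> {} = 0 \<and>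
     (\<forall>X :: nat \<Rightarrow> complex set. range X \<subseteq> circle_sets \<longrightarrow> disjoint_family X \<longrightarrow>
        (\<forall>x. (\<lambda>n. blinfun_apply (\<mu> (X n)) x) sums blinfun_apply (\<mu> (\<Union>n. X n)) x))"

definition probability_op_measure :: "(complex set \<Rightarrow> 'm::chilbert \<Rightarrow>\<^sub>L 'm) \<Rightarrow> bool" where
  "probability_op_measure \<mu> \<longleftrightarrow> op_measure \<mu> \<and> \<mu> (sphere 0 1) = id_blinfun"

definition scalar_measure :: "(complex set \<Rightarrow> 'm::chilbert \<Rightarrow>\<^sub>L 'm) \<Rightarrow> 'm \<Rightarrow> complex measure" where
  "scalar_measure \<mu> x =
     measure_of (sphere 0 1) circle_sets (\<lambda>X. ennreal (Re (cinner (blinfun_apply (\<mu> X) x) x)))"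

text \<open>The weak integral; on a complex Hilbert space an operator is determined by its quadratic form.\<close>

definition op_integral ::
  "(complex set \<Rightarrow> 'm::chilbert \<Rightarrow>\<^sub>L 'm) \<Rightarrow> (complex \<Rightarrow> complex) \<Rightarrow> 'm \<Rightarrow>\<^sub>L 'm" where
  "op_integral \<mu> f = (THE T. clinear (blinfun_apply T) \<and>
     (\<forall>x. cinner (blinfun_apply T x) x = (\<integral>\<xi>. f \<xi> \<partial>scalar_measure \<mu> x)))"

definition moment :: "(complex set \<Rightarrow> 'm::chilbert \<Rightarrow>\<^sub>L 'm) \<Rightarrow> int \<Rightarrow> 'm \<Rightarrow>\<^sub>L 'm" where
  "moment \<mu> n = op_integral \<mu> (\<lambda>\<xi>. \<xi> powi (- n))"

definition F_fun :: "(complex set \<Rightarrow> 'm::chilbert \<Rightarrow>\<^sub>L 'm) \<Rightarrow> complex \<Rightarrow> 'm \<Rightarrow>\<^sub>L 'm" where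
  "F_fun \<mu> z = op_integral \<mu> (\<lambda>\<xi>. (\<xi> + z) / (\<xi> - z))"

definition E_quotient :: "(complex set \<Rightarrow> 'm::chilbert \<Rightarrow>\<^sub>L 'm) \<Rightarrow> complex \<Rightarrow> 'm \<Rightarrow>\<^sub>L 'm" where
  "E_quotient \<mu> z =
     (1 / z) *\<^sub>C ((F_fun \<mu> z - id_blinfun) o\<^sub>L op_inv UNIV (F_fun \<mu> z + id_blinfun))"

definition E_fun :: "(complex set \<Rightarrow> 'm::chilbert \<Rightarrow>\<^sub>L 'm) \<Rightarrow> complex \<Rightarrow> 'm \<Rightarrow>\<^sub>L 'm" where
  "E_fun \<mu> z = (if z = 0 then Lim (at 0) (E_quotient \<mu>) else E_quotient \<mu> z)"

text \<open>
  The dilation space is a closed subspace \<open>H\<close> of a Hilbert space; it contains the space \<open>'m\<close> through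
  the isometric embedding \<open>\<iota>\<close>.
\<close>

definition naimark_dilation ::
  "(complex set \<Rightarrow> 'm::chilbert \<Rightarrow>\<^sub>L 'm) \<Rightarrow> ('m \<Rightarrow> 'h::chilbert) \<Rightarrow> 'h set \<Rightarrow> ('h \<Rightarrow> 'h) \<Rightarrow> bool" where
  "naimark_dilation \<mu> \<iota> H U \<longleftrightarrow>
     closed_csubspace H \<and> separable_space (top_of_set H) \<and>
     clinear \<iota> \<and> (\<forall>x y. cinner (\<iota> x) (\<iota> y) = cinner x y) \<and> range \<iota> \<subseteq> H \<and>
     unitary_between H H U \<and>
     (\<forall>n x. \<iota> (blinfun_apply (moment \<mu> n) x) =
        blinfun_apply (proj (range \<iota>)) (int_power H U n (\<iota> x)))"

definition minimal_naimark_dilation ::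
  "(complex set \<Rightarrow> 'm::chilbert \<Rightarrow>\<^sub>L 'm) \<Rightarrow> ('m \<Rightarrow> 'h::chilbert) \<Rightarrow> 'h set \<Rightarrow> ('h \<Rightarrow> 'h) \<Rightarrow> bool" where
  "minimal_naimark_dilation \<mu> \<iota> H U \<longleftrightarrow> naimark_dilation \<mu> \<iota> H U \<and>
     closure (cspan (\<Union>n. int_power H U n ` range \<iota>)) = H"

text \<open>The intertwining unitary operator fixes the space \<open>'m\<close>.\<close>

definition unitarily_equivalent_dilations ::
  "('m \<Rightarrow> 'h::chilbert) \<Rightarrow> 'h set \<Rightarrow> ('h \<Rightarrow> 'h) \<Rightarrow>
   ('m \<Rightarrow> 'k::chilbert) \<Rightarrow> 'k set \<Rightarrow> ('k \<Rightarrow> 'k) \<Rightarrow> bool" where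
  "unitarily_equivalent_dilations \<iota> H U \<kappa> K V \<longleftrightarrow>
     (\<exists>W. unitary_between H K W \<and> (\<forall>h\<in>H. W (U h) = V (W h)) \<and> (\<forall>x. W (\<iota> x) = \<kappa> x))"

end

theory Submission
  imports Defs "HOL-Complex_Analysis.Complex_Analysis"
begin

text \<open>
  Let \<open>U = L (I \<oplus> V)\<close> be the CMV matrix. It is unitary because elementary rotations are, and
  \<open>I \<oplus> V\<close> fixes \<open>M\<close> and intertwines \<open>U\<close> with the second matrix \<open>(I \<oplus> V) L\<close>. Hence it is enough to
  compute the moments of \<open>U\<close> and to show that \<open>M\<close> generates the whole space.

  Moments. Let \<open>\<Theta>\<^sub>n\<close> be the Schur iterates of \<open>E\<close>. One step of the Schur algorithm says that the
  rotation of \<open>G\<^sub>n\<close> sends \<open>(X\<^sub>n, z Y\<^sub>n\<^sub>+\<^sub>1)\<close> to \<open>(Y\<^sub>n, X\<^sub>n\<^sub>+\<^sub>1)\<close> where \<open>Y\<^sub>n = \<Theta>\<^sub>n(z) X\<^sub>n\<close> (\<open>schur_next_props\<close>).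
  A chain of such vectors that starts at \<open>X\<^sub>0\<close>, weighted with powers of \<open>z\<close>, is a square summable
  vector \<open>v\<close> with \<open>v = (X\<^sub>0 - z E(z) X\<^sub>0, 0) + z U v\<close> for \<open>|z| \<le> 1/2\<close> (\<open>cmv_resolvent_vector\<close>). So \<open>v\<close> is the
  resolvent of \<open>U\<close> at a vector of \<open>M\<close>, and its first component is \<open>X\<^sub>0\<close>. For \<open>X\<^sub>0 = (F(z) + I) x / 2\<close> the
  definition of \<open>E\<close> gives \<open>X\<^sub>0 - z E(z) X\<^sub>0 = x\<close>, and therefore
  \<open>\<Sum> z\<^sup>k \<langle>U\<^sup>k x, x\<rangle> = \<langle>(F(z) + I) x, x\<rangle> / 2 = \<Sum> z\<^sup>k \<integral> \<xi>\<^sup>-\<^sup>k d\<langle>\<mu> x, x\<rangle>\<close>. Comparing coefficients identifies the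
  nonnegative moments (\<open>cmv_moments\<close>); adjoints give the negative ones, and polarization passes from
  quadratic forms to operators.

  Minimality. The vectors orthogonal to all \<open>U\<^sup>n M\<close> form a reducing subspace in which every first
  component vanishes. Injectivity of the defect operators on the defect spaces then makes the other coordinates
  vanish one after the other along the chain of rotations (\<open>cmv_minimal\<close>).

  The Schur algorithm. For a Schur function with \<open>\<Theta>(0) = \<Gamma>\<close>, averaging over circles shows that the
  Taylor coefficients, and hence \<open>\<Theta>(z) - \<Gamma>\<close>, factor as \<open>D\<^sub>\<Gamma>\<^sub>* W(z) D\<^sub>\<Gamma>\<close> with \<open>W\<close> holomorphic. Wherever
  \<open>I - \<Gamma>\<^sup>* W(z)\<close> is invertible, \<open>Z = W (I - \<Gamma>\<^sup>* W)\<^sup>-\<^sup>1\<close> is a contraction, because rotations preserve norms,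
  and then the inverse \<open>I + \<Gamma>\<^sup>* Z\<close> has norm at most 2. With this uniform bound invertibility spreads
  over the disk, and the Schwarz lemma gives \<open>Z(z) = z \<Theta>\<^sub>1(z)\<close> (\<open>schur_step_exists\<close>).

  The function \<open>E\<close>. Since \<open>Re F \<ge> 0\<close>, the Cayley transform \<open>(F - I) (F + I)\<^sup>-\<^sup>1\<close> is a contraction; it vanishes
  at 0, so that the Schwarz lemma applies once more.

  Operators are obtained throughout from bounded sesquilinear forms (\<open>form_operator\<close>), and holomorphic
  operator functions from families of such forms (\<open>form_family_holomorphic\<close>).
\<close>

section \<open>Complex inner products and complex-linear operators\<close>

instance chilbert \<subseteq> banach ..

abbreviation cbl :: "('a::complex_normed_vector \<Rightarrow>\<^sub>L 'b::complex_normed_vector) \<Rightarrow> bool" where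
  "cbl T \<equiv> clinear (blinfun_apply T)"

lemma clinear_iff:
  "clinear f \<longleftrightarrow> (\<forall>x y. f (x + y) = f x + f y) \<and> (\<forall>c x. f (c *\<^sub>C x) = c *\<^sub>C f x)"
  by (auto simp: Vector_Spaces.linear_def module_hom_def module_hom_axioms_def
      complex_vector.vector_space_axioms complex_vector.module_axioms)

lemma clinearD:
  assumes "clinear f"
  shows "f (x + y) = f x + f y" "f (c *\<^sub>C x) = c *\<^sub>C f x"
  using assms unfolding clinear_iff by blast+

lemma bounded_bilinear_scaleC: "bounded_bilinear (scaleC :: complex \<Rightarrow> 'a::complex_normed_vector \<Rightarrow> 'a)"
proof
  fix a b :: complex and x y :: 'a and r :: real
  show "(a + b) *\<^sub>C x = a *\<^sub>C x + b *\<^sub>C x" by (rule scaleC_add_left)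
  show "a *\<^sub>C (x + y) = a *\<^sub>C x + a *\<^sub>C y" by (rule scaleC_add_right)
  show "(r *\<^sub>R a) *\<^sub>C x = r *\<^sub>R a *\<^sub>C x"
    by (simp add: scaleC_of_real[symmetric] scaleC_scaleC scaleR_conv_of_real)
  show "a *\<^sub>C r *\<^sub>R x = r *\<^sub>R a *\<^sub>C x"
    by (simp add: scaleC_of_real[symmetric] scaleC_scaleC mult.commute)
  show "\<exists>K. \<forall>a (x :: 'a). norm (a *\<^sub>C x) \<le> norm a * norm x * K"
    by (rule exI[of _ 1]) (simp add: norm_scaleC)
qed

interpretation scaleC: bounded_bilinear "scaleC :: complex \<Rightarrow> 'a::complex_normed_vector \<Rightarrow> 'a"
  by (rule bounded_bilinear_scaleC)

lemma bounded_bilinear_cinner: "bounded_bilinear (cinner :: 'a::chilbert \<Rightarrow> 'a \<Rightarrow> complex)"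
proof
  fix a b x y :: 'a and r :: real
  show "cinner (a + b) x = cinner a x + cinner b x" by (rule cinner_add_left)
  show "cinner a (x + y) = cinner a x + cinner a y" by (rule cinner_add_right)
  show "cinner (r *\<^sub>R a) x = r *\<^sub>R cinner a x"
    by (simp add: scaleC_of_real[symmetric] cinner_scaleC_left scaleR_conv_of_real)
  show "cinner a (r *\<^sub>R x) = r *\<^sub>R cinner a x"
    by (simp add: scaleC_of_real[symmetric] cinner_scaleC_right scaleR_conv_of_real)
  show "\<exists>K. \<forall>a x :: 'a. norm (cinner a x) \<le> norm a * norm x * K"
    by (rule exI[of _ 1]) (simp add: cinner_Cauchy_Schwarz)
qed

interpretation cinner: bounded_bilinear "cinner :: 'a::chilbert \<Rightarrow> 'a \<Rightarrow> complex"
  by (rule bounded_bilinear_cinner)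

declare cinner.zero_left [simp] cinner.zero_right [simp] scaleC.zero_left [simp] scaleC.zero_right [simp]

lemma clinear_ident [simp]: "clinear (\<lambda>x :: 'a::complex_normed_vector. x)"
  by (simp add: clinear_iff)

lemma scaleC_one [simp]: "1 *\<^sub>C x = (x :: 'a::complex_normed_vector)"
  using scaleC_of_real[of 1 x] by simp

lemma scaleC_minus1 [simp]: "(-1) *\<^sub>C x = - (x :: 'a::complex_normed_vector)"
  using scaleC.minus_left[of 1 x] by simp

lemmas cinner_simps = cinner_add_left cinner_add_right cinner.diff_left cinner.diff_right
  cinner.minus_left cinner.minus_right cinner_scaleC_left cinner_scaleC_right

lemma cinner_self: "cinner x x = complex_of_real ((norm x)\<^sup>2)" for x :: "'a::chilbert"
proof -
  have "Im (cinner x x) = 0"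
    using arg_cong[OF cinner_commute[of x x], of Im] by simp
  moreover have "Re (cinner x x) = (norm x)\<^sup>2"
    by (simp add: Re_cinner power2_norm_eq_inner)
  ultimately show ?thesis by (simp add: complex_eq_iff)
qed

lemma cinner_eq_0_imp: "(\<And>y. cinner x y = 0) \<Longrightarrow> x = 0" for x :: "'a::chilbert"
  by (metis cinner_self norm_eq_zero of_real_eq_0_iff power_eq_0_iff)

lemma cinner_extI: "(\<And>y. cinner x y = cinner x' y) \<Longrightarrow> x = x'" for x :: "'a::chilbert"
  using cinner_eq_0_imp[of "x - x'"] by (simp add: cinner_simps)

lemma cinner_extI_right: "(\<And>x. cinner x y = cinner x y') \<Longrightarrow> y = y'" for y :: "'a::chilbert"
  by (metis cinner_commute cinner_extI)

lemma cinner_sym_zero: "cinner x y = 0 \<longleftrightarrow> cinner y x = 0" for x :: "'a::chilbert"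
  by (metis cinner_commute complex_cnj_zero)

lemma norm_add_square:
  "(norm (x + y))\<^sup>2 = (norm x)\<^sup>2 + (norm y)\<^sup>2 + 2 * Re (cinner x y)" for x :: "'a::chilbert"
  unfolding power2_norm_eq_inner Re_cinner by (simp add: inner_simps inner_commute)

lemma norm_diff_square:
  "(norm (x - y))\<^sup>2 = (norm x)\<^sup>2 + (norm y)\<^sup>2 - 2 * Re (cinner x y)" for x :: "'a::chilbert"
  unfolding power2_norm_eq_inner Re_cinner by (simp add: inner_simps inner_commute)

text \<open>Over the complex numbers the quadratic form of an operator determines the operator.\<close>

lemma polarization:
  fixes f :: "'a::chilbert \<Rightarrow> 'a"
  assumes "clinear f"
  shows "4 * cinner (f x) y = cinner (f (x + y)) (x + y) - cinner (f (x - y)) (x - y)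
    + \<i> * cinner (f (x + \<i> *\<^sub>C y)) (x + \<i> *\<^sub>C y) - \<i> * cinner (f (x - \<i> *\<^sub>C y)) (x - \<i> *\<^sub>C y)"
proof -
  have f_diff: "f (u - v) = f u - f v" for u v
    using clinearD(1)[OF assms, of "u - v" v] by simp
  show ?thesis
    by (simp add: clinearD[OF assms] f_diff cinner_simps algebra_simps)
qed

lemma quadratic_form_determines:
  fixes S T :: "'a::chilbert \<Rightarrow>\<^sub>L 'a"
  assumes "cbl S" "cbl T" "\<And>x. cinner (S x) x = cinner (T x) x"
  shows "S = T"
proof (intro blinfun_eqI cinner_extI)
  fix x y
  show "cinner (S x) y = cinner (T x) y"
    using polarization[OF assms(1), of x y] polarization[OF assms(2), of x y]
    unfolding assms(3) by (metis mult_cancel_left zero_neq_numeral)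
qed

text \<open>
  By polarization the form at \<open>x, y\<close> is at most \<open>c (|x|\<^sup>2 + |y|\<^sup>2)\<close>; the choice of \<open>y\<close> as the multiple
  of \<open>T x\<close> with norm \<open>|x|\<close> turns this into a bound of \<open>T x\<close>.
\<close>

lemma norm_le_quadratic_form:
  fixes T :: "'a::chilbert \<Rightarrow>\<^sub>L 'a"
  assumes T: "cbl T" and c0: "0 \<le> c" and b: "\<And>x. cmod (cinner (T x) x) \<le> c * (norm x)\<^sup>2"
  shows "norm T \<le> 2 * c"
proof -
  have *: "cmod (cinner (T x) y) \<le> c * ((norm x)\<^sup>2 + (norm y)\<^sup>2)" for x y
  proof -
    have "4 * cmod (cinner (T x) y) = cmod (4 * cinner (T x) y)"
      by (simp add: norm_mult)
    also have "\<dots> \<le> cmod (cinner (T (x + y)) (x + y)) + cmod (cinner (T (x - y)) (x - y))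
      + cmod (\<i> * cinner (T (x + \<i> *\<^sub>C y)) (x + \<i> *\<^sub>C y))
      + cmod (\<i> * cinner (T (x - \<i> *\<^sub>C y)) (x - \<i> *\<^sub>C y))"
      unfolding polarization[OF T] by (smt (verit) norm_triangle_ineq norm_triangle_ineq4)
    also have "\<dots> \<le> c * (norm (x + y))\<^sup>2 + c * (norm (x - y))\<^sup>2
      + c * (norm (x + \<i> *\<^sub>C y))\<^sup>2 + c * (norm (x - \<i> *\<^sub>C y))\<^sup>2"
      using b[of "x + y"] b[of "x - y"] b[of "x + \<i> *\<^sub>C y"] b[of "x - \<i> *\<^sub>C y"]
      by (simp add: norm_mult)
    also have "\<dots> = 4 * (c * ((norm x)\<^sup>2 + (norm y)\<^sup>2))"
      unfolding norm_add_square norm_diff_square by (simp add: norm_scaleC algebra_simps)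
    finally show ?thesis by simp
  qed
  show ?thesis
  proof (rule norm_blinfun_bound)
    fix x
    show "norm (T x) \<le> 2 * c * norm x"
    proof (cases "T x = 0")
      case False
      then have x: "x \<noteq> 0" by auto
      define r where "r = norm x / norm (T x)"
      have r: "r > 0" using False x by (simp add: r_def)
      have n: "norm (r *\<^sub>R T x) = norm x" "r * (norm (T x))\<^sup>2 = norm x * norm (T x)"
        using r False by (simp_all add: r_def power2_eq_square)
      have "cinner (T x) (r *\<^sub>R T x) = complex_of_real (r * (norm (T x))\<^sup>2)"
        by (simp add: cinner.scaleR_right cinner_self scaleR_conv_of_real)
      then have "cmod (cinner (T x) (r *\<^sub>R T x)) = norm x * norm (T x)"
        unfolding n by (simp only: norm_of_real) simp
      then have "norm x * norm (T x) \<le> norm x * (2 * c * norm x)"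
        using *[of x "r *\<^sub>R T x"] unfolding n by (simp add: power2_eq_square algebra_simps)
      then show ?thesis using x by simp
    qed (use c0 in simp)
  qed (use c0 in simp)
qed

section \<open>The Riesz theorem and operators given by bounded forms\<close>

lemma csubspaceD:
  assumes "csubspace V"
  shows "0 \<in> V" "x \<in> V \<Longrightarrow> y \<in> V \<Longrightarrow> x + y \<in> V" "x \<in> V \<Longrightarrow> y \<in> V \<Longrightarrow> x - y \<in> V"
    "x \<in> V \<Longrightarrow> c *\<^sub>C x \<in> V" "x \<in> V \<Longrightarrow> r *\<^sub>R x \<in> V" "x \<in> V \<Longrightarrow> - x \<in> V"
  using complex_vector.subspace_0[OF assms] complex_vector.subspace_add[OF assms]
    complex_vector.subspace_diff[OF assms] complex_vector.subspace_scale[OF assms]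
    complex_vector.subspace_neg[OF assms]
  by (auto simp: scaleC_of_real[symmetric])

lemma cinner_zero_closure:
  assumes "t \<in> closure V" "\<And>v. v \<in> V \<Longrightarrow> cinner v x = 0"
  shows "cinner t x = (0::complex)"
proof -
  have "closed {v. cinner v x = 0}"
    by (intro closed_Collect_eq continuous_intros cinner.continuous_on)
  then have "closure V \<subseteq> {v. cinner v x = 0}"
    using assms(2) by (intro closure_minimal) auto
  then show ?thesis using assms(1) by auto
qed

lemma closure_orthogonal_zero:
  fixes t :: "'a::chilbert"
  assumes "t \<in> closure V" "\<And>v. v \<in> V \<Longrightarrow> cinner v t = 0"
  shows "t = 0"
  using cinner_zero_closure[OF assms] by (simp add: cinner_self)

lemma quadratic_nonneg_imp_zero:
  fixes a b :: real
  assumes "\<And>s. 0 \<le> 2 * s * a + s\<^sup>2 * b" "0 \<le> b"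
  shows "a = 0"
proof -
  define e where "e = 1 / (b + 1)"
  have e: "e > 0" "e * b < 1"
    unfolding e_def using assms(2) by (simp_all add: add_nonneg_pos divide_less_eq)
  have "0 \<le> a\<^sup>2 * (e * (e * b - 2))"
    using assms(1)[of "- a * e"] by (simp add: power2_eq_square algebra_simps)
  moreover have "e * (e * b - 2) < 0" using e by (simp add: mult_less_0_iff)
  ultimately show "a = 0" by (smt (verit) mult_pos_neg zero_less_power2)
qed

text \<open>
  A minimizing sequence of \<open>|v|\<^sup>2 - 2 Re f(v)\<close> in \<open>V\<close> is Cauchy by the parallelogram law, and its limit
  represents \<open>f\<close>. For closed \<open>V\<close> this yields orthogonal projections; the general case serves for the
  ranges of defect operators.
\<close>

lemma riesz_on_subspace:
  fixes f :: "'a::chilbert \<Rightarrow> complex"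
  assumes V: "csubspace V"
    and add: "\<And>x y. x \<in> V \<Longrightarrow> y \<in> V \<Longrightarrow> f (x + y) = f x + f y"
    and scale: "\<And>c x. x \<in> V \<Longrightarrow> f (c *\<^sub>C x) = c * f x"
    and b: "\<And>x. x \<in> V \<Longrightarrow> cmod (f x) \<le> K * norm x"
    and K: "0 \<le> K"
  obtains t where "t \<in> closure V" "\<And>v. v \<in> V \<Longrightarrow> f v = cinner v t" "norm t \<le> K"
proof -
  define J where "J v = (norm v)\<^sup>2 - 2 * Re (f v)" for v
  define m where "m = (INF v\<in>V. J v)"
  have fR: "f (r *\<^sub>R x) = r *\<^sub>R f x" if "x \<in> V" for r x
    using scale[OF that, of "complex_of_real r"] by (simp add: scaleC_of_real scaleR_conv_of_real)
  have low: "- K\<^sup>2 \<le> J v" if "v \<in> V" for v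
  proof -
    have "Re (f v) \<le> K * norm v"
      using b[OF that] complex_Re_le_cmod[of "f v"] by linarith
    moreover have "0 \<le> (norm v - K)\<^sup>2" by simp
    ultimately show ?thesis unfolding J_def power2_diff by (simp add: mult.commute)
  qed
  have bdd: "bdd_below (J ` V)"
    using low by (intro bdd_belowI[where m = "- K\<^sup>2"]) auto
  have m: "m \<le> J v" if "v \<in> V" for v
    unfolding m_def by (rule cINF_lower[OF bdd that])
  have ne: "V \<noteq> {}" using csubspaceD(1)[OF V] by auto
  have "\<exists>v\<in>V. J v < m + 1 / real (Suc n)" for n
    using cINF_less_iff[OF ne bdd, of "m + 1 / real (Suc n)"] by (simp add: m_def)
  then obtain v where v: "\<And>n. v n \<in> V" "\<And>n. J (v n) < m + 1 / real (Suc n)"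
    by metis
  have par: "(norm (x - y))\<^sup>2 \<le> 2 * (J x - m) + 2 * (J y - m)" if xy: "x \<in> V" "y \<in> V" for x y
  proof -
    have "m \<le> J ((1/2) *\<^sub>R (x + y))"
      using xy by (intro m csubspaceD[OF V])
    also have "\<dots> = (norm (x + y))\<^sup>2 / 4 - Re (f x + f y)"
      unfolding J_def fR[OF csubspaceD(2)[OF V xy]] add[OF xy]
      by (simp add: power_mult_distrib power2_eq_square add_divide_distrib)
    finally show ?thesis
      unfolding J_def norm_diff_square norm_add_square by (simp add: algebra_simps)
  qed
  have "Cauchy v"
  proof (rule metric_CauchyI)
    fix e :: real assume e: "e > 0"
    then obtain M where M: "4 / e\<^sup>2 < real M" using reals_Archimedean2 by blast
    have "dist (v i) (v j) < e" if "i \<ge> M" "j \<ge> M" for i j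
    proof -
      have d: "1 / real (Suc k) < e\<^sup>2 / 4" if "k \<ge> M" for k
      proof -
        have "4 / e\<^sup>2 < real (Suc k)" using M that by linarith
        then show ?thesis using e by (simp add: field_simps)
      qed
      have "J (v k) - m < e\<^sup>2 / 4" if "k \<ge> M" for k
        using v(2)[of k] d[OF that] by linarith
      from add_strict_mono[OF this[OF that(1)] this[OF that(2)]]
      have "2 * (J (v i) - m) + 2 * (J (v j) - m) < e\<^sup>2" by (simp add: field_simps)
      with par[OF v(1)[of i] v(1)[of j]] have "(norm (v i - v j))\<^sup>2 < e\<^sup>2"
        by (rule le_less_trans)
      then show ?thesis
        using e power_less_imp_less_base[of "norm (v i - v j)" 2 e] unfolding dist_norm by simp
    qed
    then show "\<exists>M. \<forall>i\<ge>M. \<forall>j\<ge>M. dist (v i) (v j) < e" by blast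
  qed
  then obtain t where t: "v \<longlonglongrightarrow> t"
    using Cauchy_convergent convergent_def by blast
  have tV: "t \<in> closure V"
    using t v(1) unfolding closure_sequential by blast
  have Re_eq: "Re (f w) = Re (cinner w t)" if w: "w \<in> V" for w
  proof -
    define a where "a = Re (cinner t w) - Re (f w)"
    have ineq: "0 \<le> 2 * s * a + s\<^sup>2 * (norm w)\<^sup>2" for s :: real
    proof (rule tendsto_lowerbound)
      show "(\<lambda>n. 1 / real (Suc n) + 2 * s * (Re (cinner (v n) w) - Re (f w)) + s\<^sup>2 * (norm w)\<^sup>2)
          \<longlonglongrightarrow> 2 * s * a + s\<^sup>2 * (norm w)\<^sup>2"
        unfolding a_def
        using tendsto_add[OF tendsto_add[OF LIMSEQ_inverse_real_of_nat
          tendsto_mult_left[OF tendsto_diff[OF tendsto_Re[OF cinner.tendsto[OF t tendsto_const]]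
            tendsto_const]]] tendsto_const]
        by (simp add: inverse_eq_divide)
      show "\<forall>\<^sub>F n in sequentially.
        0 \<le> 1 / real (Suc n) + 2 * s * (Re (cinner (v n) w) - Re (f w)) + s\<^sup>2 * (norm w)\<^sup>2"
      proof (intro always_eventually allI)
        fix n
        have "m \<le> J (v n + s *\<^sub>R w)"
          using v(1) w by (intro m csubspaceD[OF V])
        also have "\<dots> = J (v n) + 2 * s * (Re (cinner (v n) w) - Re (f w)) + s\<^sup>2 * (norm w)\<^sup>2"
          unfolding J_def norm_add_square add[OF v(1) csubspaceD(5)[OF V w]] fR[OF w]
          by (simp add: cinner.scaleR_right power_mult_distrib algebra_simps)
        finally show "0 \<le> 1 / real (Suc n) + 2 * s * (Re (cinner (v n) w) - Re (f w)) + s\<^sup>2 * (norm w)\<^sup>2"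
          using v(2)[of n] by linarith
      qed
    qed simp
    have "a = 0" by (rule quadratic_nonneg_imp_zero[OF ineq]) simp
    then show ?thesis unfolding a_def using cinner_commute[of t w] by simp
  qed
  have eq: "f w = cinner w t" if w: "w \<in> V" for w
    using Re_eq[OF w] Re_eq[OF csubspaceD(4)[OF V w, of \<i>]] scale[OF w, of \<i>]
    by (simp add: complex_eq_iff cinner_simps)
  have "closed {w. cmod (cinner w t) \<le> K * norm w}"
    by (intro closed_Collect_le continuous_intros cinner.continuous_on)
  then have "closure V \<subseteq> {w. cmod (cinner w t) \<le> K * norm w}"
    using eq b by (intro closure_minimal) auto
  then have "norm t * norm t \<le> K * norm t"
    using tV by (auto simp: cinner_self norm_power power2_eq_square norm_mult)
  then have "norm t \<le> K"
    using K by (cases "t = 0") auto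
  with tV eq show thesis by (rule that)
qed

lemma csubspace_range: "csubspace (range f)" if "clinear f"
  unfolding complex_vector.subspace_def
proof (intro conjI ballI allI)
  have "f 0 = 0" using clinearD(2)[OF that, of 0 0] by simp
  then show "0 \<in> range f" by (metis rangeI)
qed (auto simp: clinearD[OF that, symmetric])

lemma csubspace_closure:
  assumes V: "csubspace V"
  shows "csubspace (closure V)"
  unfolding complex_vector.subspace_def
proof (intro conjI ballI allI)
  show "0 \<in> closure V" using csubspaceD(1)[OF V] closure_subset by blast
next
  fix x y assume "x \<in> closure V" "y \<in> closure V"
  then obtain X Y where "\<And>n. X n \<in> V" "X \<longlonglongrightarrow> x" "\<And>n. Y n \<in> V" "Y \<longlonglongrightarrow> y"
    unfolding closure_sequential by blast
  then show "x + y \<in> closure V" unfolding closure_sequential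
    by (intro exI[of _ "\<lambda>n. X n + Y n"]) (auto intro: tendsto_add csubspaceD[OF V])
next
  fix c x assume "x \<in> closure V"
  then obtain X where "\<And>n. X n \<in> V" "X \<longlonglongrightarrow> x" unfolding closure_sequential by blast
  then show "c *\<^sub>C x \<in> closure V" unfolding closure_sequential
    by (intro exI[of _ "\<lambda>n. c *\<^sub>C X n"]) (auto intro: scaleC.tendsto csubspaceD[OF V])
qed

lemma closed_csubspace_closure: "csubspace V \<Longrightarrow> closed_csubspace (closure V)"
  by (simp add: closed_csubspace_def csubspace_closure)

lemma closed_csubspaceD:
  assumes "closed_csubspace A"
  shows "csubspace A" "closed A" "closure A = A"
  using assms by (auto simp: closed_csubspace_def closure_closed)

lemma closed_csubspace_UNIV [simp]: "closed_csubspace UNIV"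
  by (simp add: closed_csubspace_def complex_vector.subspace_UNIV)

text \<open>
  A functional dominated by \<open>|R x|\<close> factors through \<open>R\<close>.
\<close>

lemma riesz_range:
  fixes R :: "'x::complex_normed_vector \<Rightarrow> 'b::chilbert" and g :: "'x \<Rightarrow> complex"
  assumes R: "clinear R"
    and add: "\<And>x y. g (x + y) = g x + g y" and scale: "\<And>c x. g (c *\<^sub>C x) = c * g x"
    and b: "\<And>x. cmod (g x) \<le> K * norm (R x)" and K: "0 \<le> K"
  obtains t where "t \<in> closure (range R)" "\<And>x. g x = cinner (R x) t" "norm t \<le> K"
proof -
  have wd: "g x = g y" if "R x = R y" for x y
  proof -
    have "R (x - y) = 0" using clinearD(1)[OF R, of "x - y" y] that by simp
    then have "g (x - y) = 0" using b[of "x - y"] by simp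
    then show ?thesis using add[of "x - y" y] by simp
  qed
  define f where "f v = g (SOME x. R x = v)" for v
  have f: "f (R x) = g x" for x
    unfolding f_def by (rule wd) (rule someI[of _ x], simp)
  obtain t where "t \<in> closure (range R)" "\<And>v. v \<in> range R \<Longrightarrow> f v = cinner v t" "norm t \<le> K"
    by (rule riesz_on_subspace[of "range R" f K])
      (auto simp: csubspace_range[OF R] K clinearD[OF R, symmetric] f add scale b)
  with f show thesis by (metis rangeI that)
qed

lemma Blinfun_cbl:
  fixes f :: "'a::complex_normed_vector \<Rightarrow> 'b::complex_normed_vector"
  assumes "\<And>x y. f (x + y) = f x + f y" "\<And>c x. f (c *\<^sub>C x) = c *\<^sub>C f x"
    and "\<And>x. norm (f x) \<le> K * norm x" "0 \<le> K"
  obtains T where "\<And>x. blinfun_apply T x = f x" "cbl T" "norm T \<le> K"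
proof -
  have "bounded_linear f"
    using assms by (intro bounded_linear_intro[where K = K])
      (auto simp: scaleC_of_real[symmetric] mult.commute)
  then have *: "blinfun_apply (Blinfun f) = f" by (rule bounded_linear_Blinfun_apply)
  show thesis
    by (rule that[of "Blinfun f"])
      (auto simp: * clinear_iff assms intro!: norm_blinfun_bound)
qed

definition sesquilinear :: "('a::complex_normed_vector \<Rightarrow> 'b::complex_normed_vector \<Rightarrow> complex) \<Rightarrow> bool" where
  "sesquilinear q \<longleftrightarrow> (\<forall>x x' y. q (x + x') y = q x y + q x' y) \<and> (\<forall>c x y. q (c *\<^sub>C x) y = c * q x y)
    \<and> (\<forall>x y y'. q x (y + y') = q x y + q x y') \<and> (\<forall>c x y. q x (c *\<^sub>C y) = cnj c * q x y)"

text \<open>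
  The bound makes the form depend on \<open>S x\<close> and \<open>R y\<close> alone. The Riesz theorem is applied twice: it
  represents \<open>x \<mapsto> q x y\<close> by a vector \<open>s y\<close>, and then, for an arbitrary vector \<open>u\<close>, it represents
  \<open>y \<mapsto> \<langle>s y, u\<rangle>\<close> by \<open>T u\<close>. In this order \<open>T\<close> arises on the whole space, and no operator
  has to be extended from the range of \<open>S\<close> to its closure. With defect operators for \<open>S\<close> and \<open>R\<close> the lemma
  produces factorizations \<open>R T S\<close>, with identities it produces operators from forms.
\<close>

lemma form_operator:
  fixes S :: "'a::chilbert \<Rightarrow>\<^sub>L 'a" and R :: "'b::chilbert \<Rightarrow>\<^sub>L 'b"
  assumes S: "cbl S" and R: "cbl R" and K: "0 \<le> K"
    and q: "sesquilinear q"
    and b: "\<And>x y. cmod (q x y) \<le> K * norm (S x) * norm (R y)"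
  obtains T where "T \<in> bop (closure (range S)) (closure (range R))" "norm T \<le> K"
    "\<And>x y. cinner (T (S x)) (R y) = q x y"
proof -
  have q1: "q (x + x') y = q x y + q x' y" "q (c *\<^sub>C x) y = c * q x y"
    and q2: "q x (y + y') = q x y + q x y'" "q x (c *\<^sub>C y) = cnj c * q x y" for x x' y y' c
    using q by (auto simp: sesquilinear_def)
  have "\<exists>t. t \<in> closure (range S) \<and> (\<forall>x. q x y = cinner (S x) t) \<and> norm t \<le> K * norm (R y)" for y
    by (rule riesz_range[of S "\<lambda>x. q x y" "K * norm (R y)"])
      (use K b in \<open>auto simp: S q1 mult_ac\<close>)
  then obtain s where s: "\<And>y. s y \<in> closure (range S)" "\<And>x y. q x y = cinner (S x) (s y)"
      "\<And>y. norm (s y) \<le> K * norm (R y)"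
    by metis
  have clS: "csubspace (closure (range S))" and clR: "csubspace (closure (range R))"
    using S R by (auto intro: csubspace_closure csubspace_range)
  have s_lin: "s (y + y') = s y + s y'" "s (c *\<^sub>C y) = c *\<^sub>C s y" for y y' c
  proof -
    have "s (y + y') - (s y + s y') = 0"
      by (rule closure_orthogonal_zero[of _ "range S"])
        (auto intro!: csubspaceD[OF clS] s(1) simp: cinner_simps s(2)[symmetric] q2)
    then show "s (y + y') = s y + s y'" by simp
    have "s (c *\<^sub>C y) - c *\<^sub>C s y = 0"
      by (rule closure_orthogonal_zero[of _ "range S"])
        (auto intro!: csubspaceD[OF clS] s(1) simp: cinner_simps s(2)[symmetric] q2)
    then show "s (c *\<^sub>C y) = c *\<^sub>C s y" by simp
  qed
  have "\<exists>t. t \<in> closure (range R) \<and> (\<forall>y. cinner (s y) u = cinner (R y) t) \<and> norm t \<le> K * norm u" for u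
  proof (rule riesz_range[of R "\<lambda>y. cinner (s y) u" "K * norm u"])
    fix y
    have "cmod (cinner (s y) u) \<le> norm (s y) * norm u" by (rule cinner_Cauchy_Schwarz)
    also have "\<dots> \<le> (K * norm (R y)) * norm u" by (rule mult_right_mono[OF s(3)]) simp
    finally show "cmod (cinner (s y) u) \<le> K * norm u * norm (R y)" by (simp add: mult_ac)
  qed (use K in \<open>auto simp: R s_lin cinner_simps\<close>)
  then obtain T where T: "\<And>u. T u \<in> closure (range R)" "\<And>y u. cinner (s y) u = cinner (R y) (T u)"
      "\<And>u. norm (T u) \<le> K * norm u"
    by metis
  have T_lin: "T (u + u') = T u + T u'" "T (c *\<^sub>C u) = c *\<^sub>C T u" for u u' c
  proof -
    have "T (u + u') - (T u + T u') = 0"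
      by (rule closure_orthogonal_zero[of _ "range R"])
        (auto intro!: csubspaceD[OF clR] T(1) simp: cinner_simps T(2)[symmetric])
    then show "T (u + u') = T u + T u'" by simp
    have "T (c *\<^sub>C u) - c *\<^sub>C T u = 0"
      by (rule closure_orthogonal_zero[of _ "range R"])
        (auto intro!: csubspaceD[OF clR] T(1) simp: cinner_simps T(2)[symmetric])
    then show "T (c *\<^sub>C u) = c *\<^sub>C T u" by simp
  qed
  obtain T' where T': "\<And>u. blinfun_apply T' u = T u" "cbl T'" "norm T' \<le> K"
    by (rule Blinfun_cbl[of T K]) (use T_lin T(3) K in auto)
  show thesis
  proof (rule that[of T'])
    show "T' \<in> bop (closure (range S)) (closure (range R))"
      unfolding bop_def
    proof (intro CollectI conjI allI impI)
      fix u assume u: "\<forall>a\<in>closure (range S). cinner u a = 0"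
      have "T u = 0"
        by (rule closure_orthogonal_zero[of _ "range R"])
          (use T(1) s(1) u in \<open>auto simp: T(2)[symmetric] cinner_sym_zero[of "s _"]\<close>)
      then show "T' u = 0" by (simp add: T')
    qed (use T' T(1) in auto)
    show "cinner (T' (S x)) (R y) = q x y" for x y
      using T(2)[of y "S x"] s(2)[of x y] cinner_commute[of "T (S x)" "R y"] cinner_commute[of "S x" "s y"]
      by (simp add: T')
  qed (rule T')
qed

section \<open>Projections, adjoints and the spaces of operators between closed subspaces\<close>

lemma proj_unique:
  assumes A: "closed_csubspace A"
    and "\<And>x. P x \<in> A \<and> (\<forall>a\<in>A. cinner (x - P x) a = 0)"
    and "\<And>x. P' x \<in> A \<and> (\<forall>a\<in>A. cinner (x - P' x) a = 0)"
  shows "P x = P' x"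
proof -
  have "P x - P' x \<in> A" using assms by (intro csubspaceD(3)[OF closed_csubspaceD(1)[OF A]]) auto
  then have "cinner (x - P' x) (P x - P' x) - cinner (x - P x) (P x - P' x) = 0"
    using assms by simp
  then show ?thesis by (simp add: cinner.diff_left[symmetric] cinner_self)
qed

lemma proj_props_exist:
  assumes A: "closed_csubspace A"
  shows "(\<forall>x. proj A x \<in> A \<and> (\<forall>a\<in>A. cinner (x - proj A x) a = 0)) \<and> cbl (proj A) \<and> norm (proj A) \<le> 1"
proof -
  note csA = csubspaceD[OF closed_csubspaceD(1)[OF A]]
  have "\<exists>t. t \<in> A \<and> (\<forall>a\<in>A. cinner a x = cinner a t) \<and> norm t \<le> norm x" for x
  proof (rule riesz_on_subspace[of A "\<lambda>a. cinner a x" "norm x"])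
    show "cmod (cinner a x) \<le> norm x * norm a" for a
      using cinner_Cauchy_Schwarz[of a x] by (simp add: mult.commute)
    show ?thesis if "t \<in> closure A" "\<And>v. v \<in> A \<Longrightarrow> cinner v x = cinner v t" "norm t \<le> norm x" for t
      using that closed_csubspaceD(3)[OF A] by auto
  qed (auto simp: closed_csubspaceD[OF A] cinner_simps)
  then obtain p where p: "\<And>x. p x \<in> A" "\<And>x a. a \<in> A \<Longrightarrow> cinner a x = cinner a (p x)"
      "\<And>x. norm (p x) \<le> norm x"
    by metis
  have p_eq: "p x = y" if "y \<in> A" "\<And>a. a \<in> A \<Longrightarrow> cinner a x = cinner a y" for x y
  proof -
    have "p x - y \<in> A" by (rule csA(3)[OF p(1) that(1)])
    then have "cinner (p x - y) (p x - y) = 0"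
      using p(2)[of "p x - y" x] that(2)[of "p x - y"] by (simp add: cinner.diff_right)
    then show ?thesis by (simp add: cinner_self)
  qed
  obtain P where P: "\<And>x. blinfun_apply P x = p x" "cbl P" "norm P \<le> 1"
  proof (rule Blinfun_cbl[of p 1])
    fix x y c
    show "p (x + y) = p x + p y"
      by (rule p_eq) (auto intro: csA p(1) simp: cinner_add_right p(2)[symmetric])
    show "p (c *\<^sub>C x) = c *\<^sub>C p x"
      by (rule p_eq) (auto intro: csA p(1) simp: cinner_scaleC_right p(2)[symmetric])
  qed (use p(3) in auto)
  have Pp: "\<forall>x. P x \<in> A \<and> (\<forall>a\<in>A. cinner (x - P x) a = 0)"
  proof (intro allI conjI ballI)
    fix x a assume "a \<in> A"
    then have "cinner a (x - P x) = 0" using p(2)[of a x] by (simp add: P cinner.diff_right)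
    then show "cinner (x - P x) a = 0" by (simp add: cinner_sym_zero)
  qed (simp add: P p(1))
  have "proj A = P"
    unfolding proj_def
  proof (rule the_equality)
    fix Q assume "\<forall>x. blinfun_apply Q x \<in> A \<and> (\<forall>a\<in>A. cinner (x - Q x) a = 0)"
    then show "Q = P" using Pp by (intro blinfun_eqI proj_unique[OF A]) auto
  qed (rule Pp)
  then show ?thesis using Pp P by auto
qed

lemma proj_eqI:
  assumes A: "closed_csubspace A" and "y \<in> A" "\<And>a. a \<in> A \<Longrightarrow> cinner (x - y) a = 0"
  shows "proj A x = y"
proof -
  note p = proj_props_exist[OF A]
  have "proj A x - y \<in> A"
    using p assms(2) by (intro csubspaceD(3)[OF closed_csubspaceD(1)[OF A]]) auto
  then have "cinner (x - y) (proj A x - y) - cinner (x - proj A x) (proj A x - y) = 0"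
    using p assms(3) by simp
  then show ?thesis by (simp add: cinner.diff_left[symmetric] cinner_self)
qed

lemma
  assumes A: "closed_csubspace A"
  shows proj_mem: "proj A x \<in> A"
    and proj_orthogonal: "a \<in> A \<Longrightarrow> cinner (x - proj A x) a = 0"
    and cbl_proj: "cbl (proj A)"
    and proj_ident: "x \<in> A \<Longrightarrow> proj A x = x"
    and norm_proj_le: "norm (proj A x) \<le> norm x"
    and proj_cinner: "cinner (proj A x) y = cinner x (proj A y)"
    and proj_eq_0: "(\<And>a. a \<in> A \<Longrightarrow> cinner x a = 0) \<Longrightarrow> proj A x = 0"
proof -
  note p = proj_props_exist[OF A]
  show mem: "proj A x \<in> A" for x using p by blast
  show orth: "a \<in> A \<Longrightarrow> cinner (x - proj A x) a = 0" for a x using p by blast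
  show "cbl (proj A)" using p by blast
  show "x \<in> A \<Longrightarrow> proj A x = x" by (rule proj_eqI[OF A]) auto
  show "norm (proj A x) \<le> norm x"
    using norm_blinfun[of "proj A" x] p mult_right_mono[of "norm (proj A)" 1 "norm x"] by fastforce
  have "cinner (proj A x) y = cinner (proj A x) (proj A y)"
    using orth[OF mem, of y x] by (simp add: cinner_sym_zero[of "_ - _"] cinner.diff_right)
  moreover have "cinner x (proj A y) = cinner (proj A x) (proj A y)"
    using orth[OF mem, of x y] by (simp add: cinner.diff_left)
  ultimately show "cinner (proj A x) y = cinner x (proj A y)" by simp
  show "proj A x = 0" if "\<And>a. a \<in> A \<Longrightarrow> cinner x a = 0"
    by (rule proj_eqI[OF A]) (use that csubspaceD(1)[OF closed_csubspaceD(1)[OF A]] in auto)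
qed

lemma proj_UNIV: "proj UNIV = (id_blinfun :: 'a::chilbert \<Rightarrow>\<^sub>L 'a)"
  by (rule blinfun_eqI) (simp add: proj_ident)

lemma proj_range [simp]: "closed_csubspace A \<Longrightarrow> range (proj A) = A"
  by (metis proj_ident proj_mem rangeI image_subset_iff subsetI subset_antisym)

lemma cbl_simps [simp]:
  "cbl (id_blinfun :: 'a::complex_normed_vector \<Rightarrow>\<^sub>L 'a)"
  "cbl (0 :: 'a \<Rightarrow>\<^sub>L 'b::complex_normed_vector)"
  by (auto simp: clinear_iff)

lemma cbl_compose [intro]: "cbl S \<Longrightarrow> cbl T \<Longrightarrow> cbl (S o\<^sub>L T)"
  by (auto simp: clinear_iff)

lemma cbl_add [intro]: "cbl S \<Longrightarrow> cbl T \<Longrightarrow> cbl (S + T)"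
  by (auto simp: clinear_iff blinfun.add_left scaleC_add_right)

lemma cbl_diff [intro]: "cbl S \<Longrightarrow> cbl T \<Longrightarrow> cbl (S - T)"
  by (auto simp: clinear_iff blinfun.diff_left scaleC.diff_right)

lemma cbl_scaleC [intro]: "cbl T \<Longrightarrow> cbl (c *\<^sub>C T)"
  by (auto simp: clinear_iff scaleC_blinfun.rep_eq scaleC_add_right scaleC_scaleC mult.commute)

lemma cbl_scaleR [intro]: "cbl T \<Longrightarrow> cbl (r *\<^sub>R T)"
  by (metis cbl_scaleC scaleC_of_real)

lemma adj_exists:
  fixes T :: "'a::chilbert \<Rightarrow>\<^sub>L 'b::chilbert"
  assumes T: "cbl T"
  shows "(\<forall>x y. cinner (T x) y = cinner x (adj T y)) \<and> cbl (adj T) \<and> norm (adj T) \<le> norm T"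
proof -
  obtain S where S: "S \<in> bop (closure (range (id_blinfun :: 'b \<Rightarrow>\<^sub>L 'b))) (closure (range (id_blinfun :: 'a \<Rightarrow>\<^sub>L 'a)))"
    "norm S \<le> norm T" "\<And>y x. cinner (S (id_blinfun y)) (id_blinfun x) = cinner y (T x)"
  proof (rule form_operator[of "id_blinfun :: 'b \<Rightarrow>\<^sub>L 'b" "id_blinfun :: 'a \<Rightarrow>\<^sub>L 'a" "norm T" "\<lambda>y x. cinner y (T x)"])
    fix x y
    have "cmod (cinner y (T x)) \<le> norm y * norm (T x)" by (rule cinner_Cauchy_Schwarz)
    also have "\<dots> \<le> norm y * (norm T * norm x)" by (rule mult_left_mono[OF norm_blinfun]) simp
    finally show "cmod (cinner y (T x)) \<le> norm T * norm (id_blinfun y :: 'b) * norm (id_blinfun x :: 'a)"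
      by (simp add: mult_ac)
  qed (auto simp: sesquilinear_def cinner_simps clinearD[OF T])
  have S': "\<forall>x y. cinner (T x) y = cinner x (S y)"
    using S(3) by (metis cinner_commute id_blinfun.rep_eq)
  have "adj T = S"
    unfolding adj_def
  proof (rule the_equality)
    fix R assume "\<forall>x y. cinner (blinfun_apply T x) y = cinner x (blinfun_apply R y)"
    then show "R = S" using S' by (intro blinfun_eqI cinner_extI_right) metis
  qed (rule S')
  then show ?thesis using S S' by (auto simp: bop_def)
qed

lemma
  assumes T: "cbl T"
  shows adj_cinner: "cinner (T x) y = cinner x (adj T y)"
    and adj_cinner': "cinner y (T x) = cinner (adj T y) x"
    and cbl_adj: "cbl (adj T)"
    and norm_adj_le: "norm (adj T) \<le> norm T"
  using adj_exists[OF T] by (blast, metis cinner_commute, blast, blast)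

lemma adj_eqI:
  assumes "cbl T" "\<And>x y. cinner (T x) y = cinner x (blinfun_apply S y)"
  shows "adj T = S"
  using assms by (intro blinfun_eqI cinner_extI_right) (metis adj_cinner)

lemma adj_adj: "cbl T \<Longrightarrow> adj (adj T) = T"
  by (rule adj_eqI) (auto simp: cbl_adj adj_cinner')

lemma bopD:
  assumes "T \<in> bop A B"
  shows "cbl T" "T x \<in> B" "(\<And>a. a \<in> A \<Longrightarrow> cinner x a = 0) \<Longrightarrow> T x = 0"
  using assms by (auto simp: bop_def)

lemma bop_proj:
  assumes A: "closed_csubspace A" and T: "T \<in> bop A B"
  shows "T (proj A x) = T x"
proof -
  have "T (x - proj A x) = 0" by (rule bopD(3)[OF T]) (rule proj_orthogonal[OF A])
  then show ?thesis by (simp add: blinfun.diff_right)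
qed

lemma bop_proj_compose:
  assumes A: "closed_csubspace A" and B: "closed_csubspace B" and T: "T \<in> bop A B"
  shows "T o\<^sub>L proj A = T" "proj B o\<^sub>L T = T"
  using bop_proj[OF A T] proj_ident[OF B bopD(2)[OF T]] by (auto intro!: blinfun_eqI)

lemma bopI:
  assumes A: "closed_csubspace A" and "cbl T" "\<And>x. T x \<in> B" "\<And>x. T (proj A x) = T x"
  shows "T \<in> bop A B"
  unfolding bop_def using assms(2-3) proj_eq_0[OF A] assms(4)
  by (auto simp: image_subset_iff) (metis blinfun.zero_right)

lemma proj_bop: "closed_csubspace A \<Longrightarrow> proj A \<in> bop A A"
  by (auto intro!: bopI simp: cbl_proj proj_mem proj_ident)

lemma adj_bop:
  assumes A: "closed_csubspace A" and B: "closed_csubspace B" and T: "T \<in> bop A B"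
  shows "adj T \<in> bop B A"
proof (rule bopI[OF B])
  note cT = bopD(1)[OF T]
  show "cbl (adj T)" by (rule cbl_adj[OF cT])
  show "adj T (proj B x) = adj T x" for x
    by (rule cinner_extI_right)
      (metis adj_cinner[OF cT] proj_cinner[OF B] proj_ident[OF B bopD(2)[OF T]])
  have "proj A (adj T x) = adj T x" for x
    by (rule cinner_extI_right)
      (metis adj_cinner[OF cT] proj_cinner[OF A] bop_proj[OF A T])
  then show "adj T x \<in> A" for x by (metis proj_mem[OF A])
qed

lemma bop_compose:
  assumes A: "closed_csubspace A" and T: "T \<in> bop A B" and S: "S \<in> bop B C"
  shows "S o\<^sub>L T \<in> bop A C"
  by (rule bopI[OF A]) (auto simp: bop_proj[OF A T] bopD(1)[OF S] bopD(1)[OF T] bopD(2)[OF S])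

lemma bop_add:
  assumes A: "closed_csubspace A" and B: "closed_csubspace B" and T: "T \<in> bop A B" and S: "S \<in> bop A B"
  shows "S + T \<in> bop A B" "S - T \<in> bop A B"
  using csubspaceD[OF closed_csubspaceD(1)[OF B]] bopD[OF T] bopD[OF S]
  by (auto intro!: bopI[OF A] simp: blinfun.add_left blinfun.diff_left bop_proj[OF A T] bop_proj[OF A S])

lemma bop_scaleC:
  assumes A: "closed_csubspace A" and B: "closed_csubspace B" and T: "T \<in> bop A B"
  shows "c *\<^sub>C T \<in> bop A B"
  using csubspaceD[OF closed_csubspaceD(1)[OF B]] bopD[OF T]
  by (auto intro!: bopI[OF A] simp: scaleC_blinfun.rep_eq bop_proj[OF A T])

lemma bop_norm_le:
  assumes V: "csubspace V" and W: "csubspace W" and T: "T \<in> bop (closure V) (closure W)" and K: "0 \<le> K"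
    and b: "\<And>v w. v \<in> V \<Longrightarrow> w \<in> W \<Longrightarrow> cmod (cinner (T v) w) \<le> K * norm v * norm w"
  shows "norm T \<le> K"
proof (rule norm_blinfun_bound[OF K])
  fix u
  have A: "closed_csubspace (closure V)" using V by (rule closed_csubspace_closure)
  have b1: "cmod (cinner (T v) w) \<le> K * norm v * norm w" if "v \<in> closure V" "w \<in> W" for v w
  proof -
    have "closed {v. cmod (cinner (T v) w) \<le> K * norm v * norm w}"
      by (intro closed_Collect_le continuous_intros cinner.continuous_on)
    then show ?thesis
      using closure_minimal[of V "{v. cmod (cinner (T v) w) \<le> K * norm v * norm w}"] b that by blast
  qed
  have b2: "cmod (cinner (T v) w) \<le> K * norm v * norm w" if "v \<in> closure V" "w \<in> closure W" for v w
  proof -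
    have "closed {w. cmod (cinner (T v) w) \<le> K * norm v * norm w}"
      by (intro closed_Collect_le continuous_intros cinner.continuous_on)
    then show ?thesis
      using closure_minimal[of W "{w. cmod (cinner (T v) w) \<le> K * norm v * norm w}"] b1 that by blast
  qed
  have "cmod (cinner (T u) (T u)) \<le> K * norm (proj (closure V) u) * norm (T u)"
    using b2[OF proj_mem[OF A, of u] bopD(2)[OF T, of u]] by (simp add: bop_proj[OF A T])
  then have "norm (T u) * norm (T u) \<le> (K * norm (proj (closure V) u)) * norm (T u)"
    by (simp add: cinner_self norm_power power2_eq_square norm_mult)
  then have "norm (T u) \<le> K * norm (proj (closure V) u) \<or> T u = 0"
    using norm_ge_zero mult_right_le_imp_le[of "norm (T u)" "norm (T u)"] by (metis norm_eq_zero zero_less_norm_iff)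
  moreover have "K * norm (proj (closure V) u) \<le> K * norm u"
    using K norm_proj_le[OF A] by (intro mult_left_mono)
  ultimately show "norm (T u) \<le> K * norm u" using K by (metis mult_nonneg_nonneg norm_ge_zero norm_zero order_trans)
qed

lemma bop_eqI:
  assumes V: "csubspace V" and W: "csubspace W"
    and T: "T \<in> bop (closure V) (closure W)" and S: "S \<in> bop (closure V) (closure W)"
    and b: "\<And>v w. v \<in> V \<Longrightarrow> w \<in> W \<Longrightarrow> cinner (T v) w = cinner (S v) w"
  shows "T = S"
proof -
  have "norm (T - S) \<le> 0"
    by (rule bop_norm_le[OF V W])
      (auto intro!: bop_add S T closed_csubspace_closure V W simp: blinfun.diff_left cinner_simps b)
  then show ?thesis by simp
qed

lemma blinfun_compose_assoc: "(S o\<^sub>L T) o\<^sub>L U = S o\<^sub>L (T o\<^sub>L U)"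
  by (rule blinfun_eqI) simp

lemma blinfun_eq_iff: "S = T \<longleftrightarrow> (\<forall>x. blinfun_apply S x = blinfun_apply T x)"
  by (auto intro: blinfun_eqI)

section \<open>Square roots of positive operators\<close>

lemma nonneg_op_cbl: "nonneg_op T \<Longrightarrow> cbl T"
  by (simp add: nonneg_op_def)

lemma nonneg_op_adj:
  assumes T: "nonneg_op T"
  shows "adj T = T"
proof (rule quadratic_form_determines)
  show c: "cbl T" "cbl (adj T)" using nonneg_op_cbl[OF T] cbl_adj by auto
  fix x
  have "cinner (adj T x) x = cnj (cinner (T x) x)"
    by (metis adj_cinner[OF c(1)] cinner_commute)
  also have "\<dots> = cinner (T x) x"
    using T by (auto simp: nonneg_op_def Reals_cnj_iff)
  finally show "cinner (adj T x) x = cinner (T x) x" .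
qed

lemma nonneg_op_selfadjoint: "nonneg_op T \<Longrightarrow> cinner (T x) y = cinner x (T y)"
  using adj_cinner[OF nonneg_op_cbl] nonneg_op_adj by metis

lemma nonneg_op_null:
  assumes T: "nonneg_op T" and "cinner (T x) x = 0"
  shows "T x = 0"
proof -
  have "(norm (T x))\<^sup>2 = 0"
  proof (rule quadratic_nonneg_imp_zero)
    let ?y = "T x"
    show "0 \<le> Re (cinner (T ?y) ?y)" using T by (simp add: nonneg_op_def)
    fix s :: real
    have "cinner (T (x + s *\<^sub>R ?y)) (x + s *\<^sub>R ?y)
        = complex_of_real (2 * s * (norm ?y)\<^sup>2) + s\<^sup>2 *\<^sub>R cinner (T ?y) ?y"
      using assms(2) nonneg_op_selfadjoint[OF T, of "T x" x]
      by (simp add: blinfun.add_right blinfun.scaleR_right cinner_simps cinner.scaleR_left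
          cinner.scaleR_right cinner_self scaleR_conv_of_real power2_eq_square algebra_simps)
    then have "Re (cinner (T (x + s *\<^sub>R ?y)) (x + s *\<^sub>R ?y))
        = 2 * s * (norm ?y)\<^sup>2 + s\<^sup>2 * Re (cinner (T ?y) ?y)"
      by simp
    then show "0 \<le> 2 * s * (norm ?y)\<^sup>2 + s\<^sup>2 * Re (cinner (T ?y) ?y)"
      using T unfolding nonneg_op_def by metis
  qed
  then show ?thesis by simp
qed

text \<open>
  The square root of \<open>S\<close> is \<open>I - Y\<close> where \<open>Y\<close> solves \<open>Y = (A + Y\<^sup>2) / 2\<close> with \<open>A = I - S\<close>. The iteration
  of this equation from 0 converges in norm, since it is dominated by the same iteration
  for the real number 1 in place of \<open>A\<close>.
\<close>

primrec sqrt_iter :: "('a::chilbert \<Rightarrow>\<^sub>L 'a) \<Rightarrow> nat \<Rightarrow> 'a \<Rightarrow>\<^sub>L 'a" where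
  "sqrt_iter A 0 = 0"
| "sqrt_iter A (Suc n) = (1/2) *\<^sub>R (A + (sqrt_iter A n o\<^sub>L sqrt_iter A n))"

primrec sqrt_iter_real :: "nat \<Rightarrow> real" where
  "sqrt_iter_real 0 = 0"
| "sqrt_iter_real (Suc n) = (1 + (sqrt_iter_real n)\<^sup>2) / 2"

text \<open>
  The pairs \<open>(p(A), p(1))\<close> for real polynomials \<open>p\<close> with nonnegative coefficients: if \<open>|A| \<le> 1\<close>, the second
  entry bounds the norm of the first.
\<close>

inductive poly_value :: "('a::chilbert \<Rightarrow>\<^sub>L 'a) \<Rightarrow> ('a \<Rightarrow>\<^sub>L 'a) \<Rightarrow> real \<Rightarrow> bool" for A where
  base: "poly_value A A 1"
| zero: "poly_value A 0 0"
| add: "poly_value A S s \<Longrightarrow> poly_value A T t \<Longrightarrow> poly_value A (S + T) (s + t)"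
| half: "poly_value A S s \<Longrightarrow> poly_value A ((1/2) *\<^sub>R S) (s / 2)"
| mult: "poly_value A S s \<Longrightarrow> poly_value A T t \<Longrightarrow> poly_value A (S o\<^sub>L T) (s * t)"

lemma poly_value_norm: "poly_value A S s \<Longrightarrow> norm A \<le> 1 \<Longrightarrow> norm S \<le> s \<and> 0 \<le> s"
proof (induction rule: poly_value.induct)
  case (add S s T t) then show ?case using norm_triangle_ineq[of S T] by auto
next
  case (mult S s T t)
  then have "norm S * norm T \<le> s * t" by (intro mult_mono) auto
  then show ?case using norm_blinfun_compose[of S T] mult by auto
qed auto

lemma poly_value_commute:
  assumes "poly_value A S s" "X o\<^sub>L A = A o\<^sub>L X"
  shows "X o\<^sub>L S = S o\<^sub>L X"
  using assms
proof (induction rule: poly_value.induct)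
  case (mult S s T t)
  then have "\<And>x. X (S x) = S (X x)" "\<And>x. X (T x) = T (X x)"
    by (metis blinfun_apply_blinfun_compose)+
  then show ?case by (auto intro!: blinfun_eqI)
qed (auto simp: blinfun_eq_iff blinfun.add_left blinfun.add_right blinfun.scaleR_left blinfun.scaleR_right)

lemma sqrt_iter_poly: "poly_value A (sqrt_iter A n) (sqrt_iter_real n)"
proof (induction n)
  case (Suc n)
  then show ?case
    by (auto simp: power2_eq_square intro!: poly_value.intros)
qed (auto intro: poly_value.intros)

text \<open>
  The iterates commute, so that \<open>Y\<^sub>n\<^sub>+\<^sub>2 - Y\<^sub>n\<^sub>+\<^sub>1 = (Y\<^sub>n\<^sub>+\<^sub>1 - Y\<^sub>n) (Y\<^sub>n\<^sub>+\<^sub>1 + Y\<^sub>n) / 2\<close> and the differences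
  inherit nonnegative coefficients.
\<close>

lemma sqrt_iter_diff_poly:
  "poly_value A (sqrt_iter A (Suc n) - sqrt_iter A n) (sqrt_iter_real (Suc n) - sqrt_iter_real n)"
proof (induction n)
  case 0
  then show ?case using poly_value.half[OF poly_value.base, of A] by simp
next
  case (Suc n)
  define P where "P = sqrt_iter A (Suc n)"
  define Q where "Q = sqrt_iter A n"
  define p where "p = sqrt_iter_real (Suc n)"
  define q where "q = sqrt_iter_real n"
  have PQ: "poly_value A P p" "poly_value A Q q" and d: "poly_value A (P - Q) (p - q)"
    unfolding P_def Q_def p_def q_def by (rule sqrt_iter_poly Suc)+
  have "P o\<^sub>L Q = Q o\<^sub>L P"
    by (intro poly_value_commute[OF PQ(2)] poly_value_commute[OF PQ(1), symmetric]) simp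
  then have c: "P (Q x) = Q (P x)" for x
    by (metis blinfun_apply_blinfun_compose)
  have "poly_value A ((1/2) *\<^sub>R ((P - Q) o\<^sub>L (P + Q))) (((p - q) * (p + q)) / 2)"
    by (intro poly_value.intros d PQ)
  also have "(1/2) *\<^sub>R ((P - Q) o\<^sub>L (P + Q)) = sqrt_iter A (Suc (Suc n)) - P"
  proof -
    have "(P - Q) o\<^sub>L (P + Q) = (P o\<^sub>L P) - (Q o\<^sub>L Q)"
      by (rule blinfun_eqI) (simp add: blinfun.add_left blinfun.add_right blinfun.diff_left blinfun.diff_right c)
    moreover have "P = (1/2) *\<^sub>R (A + (Q o\<^sub>L Q))" by (simp add: P_def Q_def)
    ultimately show ?thesis
      unfolding sqrt_iter.simps(2)[of A "Suc n"] P_def[symmetric]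
      by (metis add_diff_cancel_left scaleR_right_diff_distrib)
  qed
  also have "((p - q) * (p + q)) / 2 = sqrt_iter_real (Suc (Suc n)) - p"
  proof -
    have "p = (1 + q\<^sup>2) / 2" by (simp add: p_def q_def)
    then show ?thesis
      unfolding sqrt_iter_real.simps(2)[of "Suc n"] p_def[symmetric]
      by (simp add: power2_eq_square field_simps)
  qed
  finally show ?case by (simp add: P_def p_def)
qed

lemma sqrt_iter_diff_poly':
  assumes "n \<le> m"
  shows "poly_value A (sqrt_iter A m - sqrt_iter A n) (sqrt_iter_real m - sqrt_iter_real n)"
  using assms
proof (induction m rule: dec_induct)
  case (step m)
  then show ?case using poly_value.add[OF sqrt_iter_diff_poly[of A m] step.IH] by simp
qed (simp add: poly_value.zero)

lemma sqrt_iter_real_bounds: "0 \<le> sqrt_iter_real n \<and> sqrt_iter_real n \<le> 1"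
  by (induction n) (auto simp: power_le_one add_nonneg_nonneg)

lemma sqrt_iter_convergent:
  fixes A :: "'a::chilbert \<Rightarrow>\<^sub>L 'a"
  assumes A: "norm A \<le> 1"
  shows "convergent (sqrt_iter A)"
proof -
  have mono: "sqrt_iter_real n \<le> sqrt_iter_real m" if "n \<le> m" for n m
    using poly_value_norm[OF sqrt_iter_diff_poly'[OF that, of A] A] by simp
  have "convergent sqrt_iter_real"
    using mono sqrt_iter_real_bounds by (intro Bseq_mono_convergent BseqI'[of _ 1]) auto
  then have C: "Cauchy sqrt_iter_real" by (rule convergent_Cauchy)
  have "Cauchy (sqrt_iter A)"
  proof (rule metric_CauchyI)
    fix e :: real assume "e > 0"
    then obtain M where M: "\<And>i j. i \<ge> M \<Longrightarrow> j \<ge> M \<Longrightarrow> dist (sqrt_iter_real i) (sqrt_iter_real j) < e"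
      using C metric_CauchyD by blast
    have "dist (sqrt_iter A i) (sqrt_iter A j) < e" if ij: "i \<ge> M" "j \<ge> M" for i j
    proof -
      have *: "dist (sqrt_iter A i) (sqrt_iter A j) \<le> dist (sqrt_iter_real i) (sqrt_iter_real j)" if "j \<le> i" for i j
        using poly_value_norm[OF sqrt_iter_diff_poly'[OF that, of A] A] by (simp add: dist_norm)
      show ?thesis
        using *[of j i] *[of i j] M[OF ij] by (cases "j \<le> i") (auto simp: dist_commute)
    qed
    then show "\<exists>M. \<forall>i\<ge>M. \<forall>j\<ge>M. dist (sqrt_iter A i) (sqrt_iter A j) < e" by blast
  qed
  then show ?thesis by (rule Cauchy_convergent)
qed

definition sqrt_complement :: "('a::chilbert \<Rightarrow>\<^sub>L 'a) \<Rightarrow> 'a \<Rightarrow>\<^sub>L 'a" where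
  "sqrt_complement S = lim (sqrt_iter (id_blinfun - S))"

text \<open>
  For a self-adjoint operator the norm condition means \<open>0 \<le> S \<le> 2\<close>.
\<close>

definition selfadjoint_near_id :: "('a::chilbert \<Rightarrow>\<^sub>L 'a) \<Rightarrow> bool" where
  "selfadjoint_near_id S \<longleftrightarrow> cbl S \<and> (\<forall>x y. cinner (S x) y = cinner x (S y)) \<and> norm (id_blinfun - S) \<le> 1"

lemma sqrt_complement_LIMSEQ:
  "norm (id_blinfun - S) \<le> 1 \<Longrightarrow> sqrt_iter (id_blinfun - S) \<longlonglongrightarrow> sqrt_complement S"
  unfolding sqrt_complement_def by (rule convergent_LIMSEQ_iff[THEN iffD1, OF sqrt_iter_convergent])

lemma blinfun_compose_tendsto:
  "(f \<longlongrightarrow> S) F \<Longrightarrow> (g \<longlongrightarrow> T) F \<Longrightarrow> ((\<lambda>x. f x o\<^sub>L g x) \<longlongrightarrow> (S o\<^sub>L T)) F"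
  by (rule bounded_bilinear.tendsto[OF bounded_bilinear_blinfun_compose])

lemma sqrt_complement_intertwine:
  fixes S1 :: "'a::chilbert \<Rightarrow>\<^sub>L 'a" and S2 :: "'b::chilbert \<Rightarrow>\<^sub>L 'b"
  assumes "norm (id_blinfun - S1) \<le> 1" "norm (id_blinfun - S2) \<le> 1" "X o\<^sub>L S1 = S2 o\<^sub>L X"
  shows "X o\<^sub>L sqrt_complement S1 = sqrt_complement S2 o\<^sub>L X"
proof -
  have X: "X (S1 x) = S2 (X x)" for x
    using assms(3) by (metis blinfun_apply_blinfun_compose)
  have "X o\<^sub>L sqrt_iter (id_blinfun - S1) n = sqrt_iter (id_blinfun - S2) n o\<^sub>L X" for n
  proof (induction n)
    case (Suc n)
    then have "X (sqrt_iter (id_blinfun - S1) n x) = sqrt_iter (id_blinfun - S2) n (X x)" for x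
      by (metis blinfun_apply_blinfun_compose)
    then show ?case
      by (auto intro!: blinfun_eqI simp: blinfun.add_left blinfun.add_right blinfun.scaleR_left
          blinfun.scaleR_right blinfun.diff_left blinfun.diff_right X)
  qed (auto intro: blinfun_eqI)
  moreover have "(\<lambda>n. X o\<^sub>L sqrt_iter (id_blinfun - S1) n) \<longlonglongrightarrow> (X o\<^sub>L sqrt_complement S1)"
    by (intro blinfun_compose_tendsto tendsto_const sqrt_complement_LIMSEQ assms)
  moreover have "(\<lambda>n. sqrt_iter (id_blinfun - S2) n o\<^sub>L X) \<longlonglongrightarrow> (sqrt_complement S2 o\<^sub>L X)"
    by (intro blinfun_compose_tendsto tendsto_const sqrt_complement_LIMSEQ assms)
  ultimately show ?thesis using LIMSEQ_unique by simp
qed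

lemma sqrt_complement_props:
  assumes S: "selfadjoint_near_id S"
  shows "cbl (sqrt_complement S)" "norm (sqrt_complement S) \<le> 1"
    "\<And>x y. cinner (sqrt_complement S x) y = cinner x (sqrt_complement S y)"
    "(id_blinfun - sqrt_complement S) o\<^sub>L (id_blinfun - sqrt_complement S) = S"
proof -
  define A where "A = id_blinfun - S"
  have A: "cbl A" "norm A \<le> 1" "cinner (A x) y = cinner x (A y)" for x y
    using S by (auto simp: A_def selfadjoint_near_id_def cbl_diff blinfun.diff_left cinner.diff_left cinner.diff_right)
  define Y where "Y = sqrt_complement S"
  have lim: "sqrt_iter A \<longlonglongrightarrow> Y"
    unfolding A_def Y_def using S by (intro sqrt_complement_LIMSEQ) (simp add: selfadjoint_near_id_def)
  have limx: "(\<lambda>n. sqrt_iter A n x) \<longlonglongrightarrow> Y x" for x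
    by (rule blinfun.tendsto[OF lim tendsto_const])
  have cn: "cbl (sqrt_iter A n)" for n
  proof (induction n)
    case (Suc n)
    then show ?case unfolding sqrt_iter.simps using A(1) by (intro cbl_scaleR cbl_add cbl_compose)
  qed (simp only: sqrt_iter.simps cbl_simps)
  show "cbl (sqrt_complement S)"
    unfolding clinear_iff Y_def[symmetric]
    by (auto simp: blinfun.add_right intro!: LIMSEQ_unique[OF limx])
      (auto simp: clinearD[OF cn] intro!: scaleC.tendsto tendsto_const limx)
  have "norm (sqrt_iter A n) \<le> 1" for n
    using poly_value_norm[OF sqrt_iter_poly A(2)] sqrt_iter_real_bounds order_trans by blast
  then show "norm (sqrt_complement S) \<le> 1"
    unfolding Y_def[symmetric] using tendsto_norm[OF lim] by (auto intro: LIMSEQ_le_const2)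
  have sa: "cinner (sqrt_iter A n x) y = cinner x (sqrt_iter A n y)" for n x y
  proof (induction n arbitrary: x y)
    case (Suc n)
    show ?case
      by (simp add: blinfun.add_left blinfun.scaleR_left cinner.scaleR_left cinner.scaleR_right
          cinner_simps A(3) Suc)
  qed simp
  show "cinner (sqrt_complement S x) y = cinner x (sqrt_complement S y)" for x y
    unfolding Y_def[symmetric]
  proof (rule LIMSEQ_unique)
    show "(\<lambda>n. cinner (sqrt_iter A n x) y) \<longlonglongrightarrow> cinner (Y x) y"
      by (intro cinner.tendsto limx tendsto_const)
    show "(\<lambda>n. cinner (sqrt_iter A n x) y) \<longlonglongrightarrow> cinner x (Y y)"
      unfolding sa by (intro cinner.tendsto limx tendsto_const)
  qed
  have "(\<lambda>n. (1/2) *\<^sub>R (A + (sqrt_iter A n o\<^sub>L sqrt_iter A n))) \<longlonglongrightarrow> (1/2) *\<^sub>R (A + (Y o\<^sub>L Y))"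
    by (intro tendsto_intros blinfun_compose_tendsto lim)
  moreover have "(\<lambda>n. sqrt_iter A (Suc n)) \<longlonglongrightarrow> Y"
    using lim by (rule LIMSEQ_Suc)
  ultimately have half: "(1/2) *\<^sub>R (A + (Y o\<^sub>L Y)) = Y"
    using LIMSEQ_unique by simp
  have "2 *\<^sub>R Y = A + (Y o\<^sub>L Y)"
    using arg_cong[OF half, of "\<lambda>Z. 2 *\<^sub>R Z"] by simp
  then have "(2 *\<^sub>R Y) x = (A + (Y o\<^sub>L Y)) x" for x
    by simp
  then have "Y x + Y x = x - S x + Y (Y x)" for x
    by (simp add: blinfun.add_left blinfun.diff_left blinfun.scaleR_left A_def scaleR_2)
  then show "(id_blinfun - sqrt_complement S) o\<^sub>L (id_blinfun - sqrt_complement S) = S"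
    unfolding Y_def[symmetric]
    by (intro blinfun_eqI) (simp add: blinfun.diff_left blinfun.diff_right algebra_simps)
qed

lemma nonneg_op_one_minus:
  assumes "cbl Y" "norm Y \<le> 1" "\<And>x y. cinner (Y x) y = cinner x (Y y)"
  shows "nonneg_op (id_blinfun - Y)"
  unfolding nonneg_op_def
proof (intro conjI allI)
  show "cbl (id_blinfun - Y)" using assms by auto
  fix x
  have "cnj (cinner (Y x) x) = cinner (Y x) x"
    by (metis assms(3) cinner_commute)
  then have r: "cinner (Y x) x \<in> \<real>" by (simp add: Reals_cnj_iff)
  then show "cinner ((id_blinfun - Y) x) x \<in> \<real>"
    by (simp add: blinfun.diff_left cinner.diff_left cinner_self)
  have "Re (cinner (Y x) x) \<le> norm (Y x) * norm x"
    using cinner_Cauchy_Schwarz[of "Y x" x] complex_Re_le_cmod order_trans by blast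
  also have "\<dots> \<le> (1 * norm x) * norm x"
    using norm_blinfun[of Y x] mult_right_mono[OF assms(2), of "norm x"] by (intro mult_right_mono) auto
  finally show "0 \<le> Re (cinner ((id_blinfun - Y) x) x)"
    by (simp add: blinfun.diff_left cinner.diff_left cinner_self power2_eq_square)
qed

text \<open>
  Uniqueness: a nonnegative root \<open>Q\<close> commutes with \<open>S\<close>, hence with the limit \<open>R\<close> of polynomials in \<open>S\<close>.
  For \<open>y = (Q - R) x\<close> this gives \<open>(Q + R) y = 0\<close>, so that \<open>Q y = R y = 0\<close> by positivity, and
  \<open>\<langle>y, y\<rangle> = \<langle>x, (Q - R) y\<rangle> = 0\<close>.
\<close>

lemma op_sqrt_eq:
  assumes S: "selfadjoint_near_id S"
  shows "op_sqrt S = id_blinfun - sqrt_complement S"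
  unfolding op_sqrt_def
proof (rule the_equality)
  note p = sqrt_complement_props[OF S]
  let ?R = "id_blinfun - sqrt_complement S"
  show R: "nonneg_op ?R \<and> ?R o\<^sub>L ?R = S"
    using p by (auto intro: nonneg_op_one_minus)
  fix Q assume Q: "nonneg_op Q \<and> Q o\<^sub>L Q = S"
  then have QQ: "Q (Q x) = S x" for x by auto
  have RR: "?R (?R x) = S x" for x using R by (metis blinfun_apply_blinfun_compose)
  have "Q o\<^sub>L S = S o\<^sub>L Q" using QQ by (intro blinfun_eqI) (simp add: QQ[symmetric])
  then have "Q o\<^sub>L sqrt_complement S = sqrt_complement S o\<^sub>L Q"
    using S by (intro sqrt_complement_intertwine) (auto simp: selfadjoint_near_id_def)
  then have comm: "Q (?R x) = ?R (Q x)" for x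
    by (simp add: blinfun_eq_iff blinfun.diff_left blinfun.diff_right)
  show "Q = ?R"
  proof (rule blinfun_eqI)
    fix x
    define y where "y = Q x - ?R x"
    have yq: "Q y + ?R y = 0"
      unfolding y_def using QQ RR comm by (simp add: blinfun.diff_right)
    have "cinner (Q y) y + cinner (?R y) y = 0"
      using yq by (simp add: cinner_add_left[symmetric])
    moreover have "0 \<le> Re (cinner (Q y) y)" "0 \<le> Re (cinner (?R y) y)"
      "cinner (Q y) y \<in> \<real>" "cinner (?R y) y \<in> \<real>"
      using Q R by (auto simp: nonneg_op_def)
    ultimately have "cinner (Q y) y = 0"
      by (auto simp: complex_eq_iff complex_is_Real_iff)
    then have Qy: "Q y = 0" using Q nonneg_op_null by blast
    then have Ry: "?R y = 0" using yq by simp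
    have "cinner y y = cinner (Q x) y - cinner (?R x) y"
      by (simp add: y_def cinner.diff_left)
    also have "\<dots> = cinner x (Q y) - cinner x (?R y)"
      using nonneg_op_selfadjoint Q R by metis
    finally have "cinner y y = 0" using Qy Ry by simp
    then show "Q x = ?R x" by (simp add: cinner_self y_def)
  qed
qed

lemma op_sqrt_props:
  assumes S: "selfadjoint_near_id S"
  shows "nonneg_op (op_sqrt S)" "op_sqrt S o\<^sub>L op_sqrt S = S"
  unfolding op_sqrt_eq[OF S]
  using sqrt_complement_props[OF S] by (auto intro: nonneg_op_one_minus)

text \<open>
  Polynomials in \<open>S\<^sub>1\<close> and \<open>S\<^sub>2\<close> are intertwined, hence so are their limits. This is the source of the
  relation \<open>T D\<^sub>T = D\<^sub>T\<^sub>* T\<close>.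
\<close>

lemma op_sqrt_intertwine:
  assumes "selfadjoint_near_id S1" "selfadjoint_near_id S2" "X o\<^sub>L S1 = S2 o\<^sub>L X"
  shows "X o\<^sub>L op_sqrt S1 = op_sqrt S2 o\<^sub>L X"
proof -
  have "X o\<^sub>L sqrt_complement S1 = sqrt_complement S2 o\<^sub>L X"
    using assms by (intro sqrt_complement_intertwine) (auto simp: selfadjoint_near_id_def)
  then show ?thesis
    unfolding op_sqrt_eq[OF assms(1)] op_sqrt_eq[OF assms(2)]
    by (auto simp: blinfun_eq_iff blinfun.diff_left blinfun.diff_right)
qed

section \<open>Inverses of operators near the identity and of coercive operators\<close>

text \<open>
  The solution of \<open>x - S x = y\<close> is the fixed point of the contraction \<open>x \<mapsto> y + S x\<close>.
\<close>

lemma neumann_inverse: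
  fixes S :: "'a::chilbert \<Rightarrow>\<^sub>L 'a"
  assumes S: "cbl S" and n: "norm S < 1"
  obtains R where "cbl R" "\<And>x. R (x - S x) = x" "\<And>x. R x - S (R x) = x"
proof -
  have "\<exists>!x. y + S x = x" for y
  proof -
    have "\<exists>!x\<in>UNIV. y + S x = x"
      by (rule Banach_fix[where c = "norm S"])
        (use n norm_blinfun[of S] in \<open>auto simp: complete_UNIV dist_norm blinfun.diff_right[symmetric]\<close>)
    then show ?thesis by simp
  qed
  then obtain r where r: "\<And>y. y + S (r y) = r y" and u: "\<And>x y. y + S x = x \<Longrightarrow> r y = x"
    by metis
  obtain R where R: "\<And>x. blinfun_apply R x = r x" "cbl R" "norm R \<le> 1 / (1 - norm S)"
  proof (rule Blinfun_cbl[of r "1 / (1 - norm S)"])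
    show "r (x + y) = r x + r y" for x y
      by (rule u) (metis (no_types) r blinfun.add_right add.assoc add.left_commute)
    show "r (c *\<^sub>C x) = c *\<^sub>C r x" for c x
      by (rule u) (metis r clinearD(2)[OF S] scaleC_add_right)
    show "norm (r x) \<le> 1 / (1 - norm S) * norm x" for x
    proof -
      have "norm (r x) \<le> norm x + norm (S (r x))"
        using norm_triangle_ineq[of x "S (r x)"] by (simp add: r)
      also have "\<dots> \<le> norm x + norm S * norm (r x)" using norm_blinfun[of S "r x"] by simp
      finally show ?thesis using n by (simp add: field_simps)
    qed
  qed (use n in auto)
  show thesis
  proof (rule that[of R])
    show "R (x - S x) = x" for x by (simp add: R u)
    show "R x - S (R x) = x" for x using r[of x] by (simp add: R algebra_simps)
  qed (rule R)
qed

definition is_inverse_on :: "'a::chilbert set \<Rightarrow> ('a \<Rightarrow>\<^sub>L 'a) \<Rightarrow> ('a \<Rightarrow>\<^sub>L 'a) \<Rightarrow> bool" where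
  "is_inverse_on A T R \<longleftrightarrow> R \<in> bop A A \<and> R o\<^sub>L T = proj A \<and> T o\<^sub>L R = proj A"

lemma op_inv_eqI:
  assumes A: "closed_csubspace A" and R: "is_inverse_on A T R"
  shows "op_inv A T = R"
  unfolding op_inv_def
proof (rule the_equality)
  show "R \<in> bop A A \<and> R o\<^sub>L T = proj A \<and> T o\<^sub>L R = proj A" using R by (simp add: is_inverse_on_def)
  fix Q assume Q: "Q \<in> bop A A \<and> Q o\<^sub>L T = proj A \<and> T o\<^sub>L Q = proj A"
  have "Q = Q o\<^sub>L proj A" using bop_proj_compose[OF A A, of Q] Q by simp
  also have "\<dots> = (Q o\<^sub>L T) o\<^sub>L R" using R by (simp add: is_inverse_on_def blinfun_compose_assoc)
  also have "\<dots> = R" using Q R bop_proj_compose[OF A A, of R] by (simp add: is_inverse_on_def)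
  finally show "Q = R" .
qed

lemma neumann_inverse_on:
  assumes A: "closed_csubspace A" and S: "S \<in> bop A A" and n: "norm S < 1"
  obtains R where "is_inverse_on A (proj A - S) R"
proof -
  obtain R0 where R0: "cbl R0" "\<And>x. R0 (x - S x) = x" "\<And>x. R0 x - S (R0 x) = x"
    using neumann_inverse[OF bopD(1)[OF S] n] by blast
  have SP: "S (proj A x) = S x" "proj A (S x) = S x" for x
    using bop_proj[OF A S] proj_ident[OF A bopD(2)[OF S]] by auto
  note pp = proj_ident[OF A proj_mem[OF A]]
  show thesis
  proof (rule that[of "proj A o\<^sub>L R0 o\<^sub>L proj A"], unfold is_inverse_on_def, intro conjI)
    show "proj A o\<^sub>L R0 o\<^sub>L proj A \<in> bop A A"
      by (rule bopI[OF A]) (auto simp: R0 cbl_proj[OF A] proj_mem[OF A] pp intro!: cbl_compose)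
    show "(proj A o\<^sub>L R0 o\<^sub>L proj A) o\<^sub>L (proj A - S) = proj A"
    proof (rule blinfun_eqI)
      fix x
      have "proj A (R0 (proj A (proj A x - S x))) = proj A (R0 (proj A x - S (proj A x)))"
        by (simp add: blinfun.diff_right pp SP)
      then show "((proj A o\<^sub>L R0 o\<^sub>L proj A) o\<^sub>L (proj A - S)) x = proj A x"
        by (simp add: blinfun.diff_left R0(2) pp)
    qed
    show "(proj A - S) o\<^sub>L (proj A o\<^sub>L R0 o\<^sub>L proj A) = proj A"
    proof (rule blinfun_eqI)
      fix x
      have "proj A (R0 (proj A x)) - S (R0 (proj A x)) = proj A (R0 (proj A x) - S (R0 (proj A x)))"
        by (simp add: blinfun.diff_right SP)
      then show "((proj A - S) o\<^sub>L (proj A o\<^sub>L R0 o\<^sub>L proj A)) x = proj A x"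
        by (simp add: blinfun.diff_left R0(3) pp SP)
    qed
  qed
qed

lemma is_inverse_on_compose:
  assumes A: "closed_csubspace A" and T: "T \<in> bop A A"
    and R: "is_inverse_on A T R" and R': "is_inverse_on A T' R'"
  shows "is_inverse_on A (T o\<^sub>L T') (R' o\<^sub>L R)"
proof -
  note r = R[unfolded is_inverse_on_def] R'[unfolded is_inverse_on_def]
  have "(R' o\<^sub>L R) o\<^sub>L (T o\<^sub>L T') = R' o\<^sub>L (R o\<^sub>L T) o\<^sub>L T'"
    by (simp add: blinfun_compose_assoc)
  also have "\<dots> = proj A"
    using r bop_proj_compose[OF A A, of R'] by (simp add: blinfun_compose_assoc[symmetric])
  finally have 1: "(R' o\<^sub>L R) o\<^sub>L (T o\<^sub>L T') = proj A" .
  have "(T o\<^sub>L T') o\<^sub>L (R' o\<^sub>L R) = T o\<^sub>L ((T' o\<^sub>L R') o\<^sub>L R)"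
    by (simp add: blinfun_compose_assoc)
  also have "\<dots> = proj A"
    using r bop_proj_compose[OF A A, of R] by simp
  finally show ?thesis using 1 r bop_compose[OF A, of R A R' A] by (simp add: is_inverse_on_def)
qed

text \<open>
  For small \<open>t\<close> the operator \<open>I - t T\<close> is a strict contraction, so that \<open>t T\<close> is invertible.
\<close>

lemma coercive_inverse:
  fixes T :: "'a::chilbert \<Rightarrow>\<^sub>L 'a"
  assumes T: "cbl T" and co: "\<And>x. (norm x)\<^sup>2 \<le> Re (cinner (T x) x)"
  obtains R where "is_inverse_on UNIV T R" "norm R \<le> 1"
proof -
  define M where "M = max 1 (norm T)"
  \<comment> \<open>The value of \<open>t\<close> that minimizes the bound \<open>1 - 2 t + t\<^sup>2 M\<^sup>2\<close> of \<open>|I - t T|\<^sup>2\<close>.\<close>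
  define t where "t = 1 / M\<^sup>2"
  have M: "M \<ge> 1" "norm T \<le> M" by (auto simp: M_def)
  have t: "0 < t" "t \<le> 1" "t * M\<^sup>2 = 1" using M by (auto simp: t_def one_le_power)
  define S where "S = id_blinfun - t *\<^sub>R T"
  have cS: "cbl S" unfolding S_def by (intro cbl_diff cbl_scaleR T) simp
  have "norm S \<le> sqrt (1 - t)"
  proof (rule norm_blinfun_bound)
    fix x
    have Tx: "(norm (T x))\<^sup>2 \<le> (M * norm x)\<^sup>2"
      by (intro power_mono norm_ge_zero order_trans[OF norm_blinfun mult_right_mono[OF M(2)]])
    have "Re (cinner x (T x)) = Re (cinner (T x) x)" using cinner_commute[of x "T x"] by simp
    then have "(norm (S x))\<^sup>2 = (norm x)\<^sup>2 + t\<^sup>2 * (norm (T x))\<^sup>2 - 2 * t * Re (cinner (T x) x)"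
      by (simp add: S_def blinfun.diff_left blinfun.scaleR_left norm_diff_square cinner.scaleR_right
          power_mult_distrib)
    also have "\<dots> \<le> (norm x)\<^sup>2 + t\<^sup>2 * (M * norm x)\<^sup>2 - 2 * t * (norm x)\<^sup>2"
      using Tx co[of x] t by (intro diff_mono add_mono mult_left_mono) auto
    also have "t\<^sup>2 * (M * norm x)\<^sup>2 = (t * M\<^sup>2) * t * (norm x)\<^sup>2"
      by (simp add: power2_eq_square mult_ac)
    also have "(norm x)\<^sup>2 + (t * M\<^sup>2) * t * (norm x)\<^sup>2 - 2 * t * (norm x)\<^sup>2 = (sqrt (1 - t) * norm x)\<^sup>2"
      using t by (simp add: power_mult_distrib algebra_simps)
    finally show "norm (S x) \<le> sqrt (1 - t) * norm x"
      using t by (intro power2_le_imp_le[of "norm (S x)"]) auto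
  qed (use t in simp)
  also have "sqrt (1 - t) < 1" using t by simp
  finally obtain R0 where R0: "cbl R0" "\<And>x. R0 (x - S x) = x" "\<And>x. R0 x - S (R0 x) = x"
    using neumann_inverse[OF cS] by metis
  have S: "x - S x = t *\<^sub>R T x" for x by (simp add: S_def blinfun.diff_left blinfun.scaleR_left)
  define R where "R = t *\<^sub>R R0"
  have cR: "cbl R" unfolding R_def by (rule cbl_scaleR[OF R0(1)])
  have RT: "R (T x) = x" "T (R x) = x" for x
    using R0(2)[of x] R0(3)[of x]
    unfolding S by (simp_all add: R_def blinfun.scaleR_left blinfun.scaleR_right)
  show thesis
  proof (rule that[of R])
    show "is_inverse_on UNIV T R"
      unfolding is_inverse_on_def proj_UNIV
      using RT cR by (auto intro!: blinfun_eqI bopI simp: proj_UNIV)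
    show "norm R \<le> 1"
    proof (rule norm_blinfun_bound)
      fix x
      have "(norm (R x))\<^sup>2 \<le> Re (cinner x (R x))" using co[of "R x"] by (simp add: RT)
      also have "\<dots> \<le> norm x * norm (R x)"
        using cinner_Cauchy_Schwarz[of x "R x"] complex_Re_le_cmod order_trans by blast
      finally show "norm (R x) \<le> 1 * norm x"
        by (cases "R x = 0") (auto simp: power2_eq_square)
    qed simp
  qed
qed

section \<open>Defect operators and elementary rotations\<close>

definition contraction :: "'a::chilbert set \<Rightarrow> 'b::chilbert set \<Rightarrow> ('a \<Rightarrow>\<^sub>L 'b) \<Rightarrow> bool" where
  "contraction A B T \<longleftrightarrow> closed_csubspace A \<and> closed_csubspace B \<and> T \<in> bop A B \<and> norm T \<le> 1"

lemma contractionD: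
  assumes "contraction A B T"
  shows "closed_csubspace A" "closed_csubspace B" "T \<in> bop A B" "norm T \<le> 1" "cbl T"
    "T x \<in> B" "T (proj A x) = T x" "norm (T x) \<le> norm x"
proof -
  show *: "closed_csubspace A" "closed_csubspace B" "T \<in> bop A B" "norm T \<le> 1"
    using assms by (auto simp: contraction_def)
  show "cbl T" "T x \<in> B" "T (proj A x) = T x" using bopD[OF *(3)] bop_proj[OF *(1,3)] by auto
  show "norm (T x) \<le> norm x"
    using norm_blinfun[of T x] mult_right_mono[OF *(4), of "norm x"] by simp
qed

lemma contraction_adj:
  assumes T: "contraction A B T"
  shows "contraction B A (adj T)"
  using contractionD[OF T] adj_bop norm_adj_le order_trans unfolding contraction_def by blast

lemma contraction_near_id:
  assumes T: "contraction A B T"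
  shows "selfadjoint_near_id (proj A - (adj T o\<^sub>L T))"
  unfolding selfadjoint_near_id_def
proof (intro conjI allI)
  \<comment> \<open>Subtracted from the identity, this operator leaves \<open>T\<^sup>* T\<close> on \<open>A\<close> and the identity on the orthogonal complement of \<open>A\<close>.\<close>
  note t = contractionD[OF T] and s = contractionD[OF contraction_adj[OF T]]
  show "cbl (proj A - (adj T o\<^sub>L T))"
    by (intro cbl_diff cbl_compose cbl_proj t s)
  show "cinner ((proj A - (adj T o\<^sub>L T)) x) y = cinner x ((proj A - (adj T o\<^sub>L T)) y)" for x y
    by (simp add: blinfun.diff_left cinner_simps proj_cinner[OF t(1)] adj_cinner[OF t(5), symmetric]
        adj_cinner'[OF t(5), symmetric])
  show "norm (id_blinfun - (proj A - (adj T o\<^sub>L T))) \<le> 1"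
  proof (rule norm_blinfun_bound)
    fix x
    define p where "p = proj A x"
    have o: "cinner (x - p) (adj T (T x)) = 0" "cinner (x - p) p = 0"
      unfolding p_def using proj_orthogonal[OF t(1)] s(6) proj_mem[OF t(1)] by auto
    have "(norm ((id_blinfun - (proj A - (adj T o\<^sub>L T))) x))\<^sup>2 = (norm ((x - p) + adj T (T p)))\<^sup>2"
      by (simp add: blinfun.diff_left blinfun.add_left p_def t(7) algebra_simps)
    also have "\<dots> = (norm (x - p))\<^sup>2 + (norm (adj T (T p)))\<^sup>2"
      using o(1) by (simp add: norm_add_square p_def t(7))
    also have "(norm (adj T (T p)))\<^sup>2 \<le> (norm p)\<^sup>2"
      using t(8)[of p] s(8)[of "T p"] by (intro power_mono) auto
    also have "(norm (x - p))\<^sup>2 + (norm p)\<^sup>2 = (norm ((x - p) + p))\<^sup>2"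
      using o(2) unfolding norm_add_square by simp
    finally have "(norm ((id_blinfun - (proj A - (adj T o\<^sub>L T))) x))\<^sup>2 \<le> (norm x)\<^sup>2"
      by (simp only: diff_add_cancel)
    then show "norm ((id_blinfun - (proj A - (adj T o\<^sub>L T))) x) \<le> 1 * norm x"
      using power2_le_imp_le[OF _ norm_ge_zero] by simp
  qed simp
qed

lemma
  assumes T: "contraction A B T"
  shows defect_square: "defect A T (defect A T x) = proj A x - adj T (T x)"
    and defect_selfadjoint: "cinner (defect A T x) y = cinner x (defect A T y)"
    and cbl_defect: "cbl (defect A T)"
proof -
  note s = op_sqrt_props[OF contraction_near_id[OF T], folded defect_def]
  show "cbl (defect A T)" using s by (auto simp: nonneg_op_def)
  show "cinner (defect A T x) y = cinner x (defect A T y)"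
    by (rule nonneg_op_selfadjoint[OF s(1)])
  show "defect A T (defect A T x) = proj A x - adj T (T x)"
    using arg_cong[OF s(2), of "\<lambda>F. blinfun_apply F x"] by (simp add: blinfun.diff_left)
qed

lemma norm_defect:
  assumes T: "contraction A B T"
  shows "(norm (defect A T x))\<^sup>2 = (norm (proj A x))\<^sup>2 - (norm (T x))\<^sup>2"
proof -
  note t = contractionD[OF T]
  have "cinner (defect A T x) (defect A T x) = cinner (proj A x) (proj A x) - cinner (T x) (T x)"
    unfolding defect_selfadjoint[OF T] defect_square[OF T] cinner.diff_right
    by (simp add: proj_cinner[OF t(1)] proj_ident[OF t(1) proj_mem[OF t(1)]] adj_cinner[OF t(5), symmetric])
  then show ?thesis
    unfolding cinner_self of_real_diff[symmetric] of_real_eq_iff .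
qed

lemma defect_bop:
  assumes T: "contraction A B T"
  shows "defect A T \<in> bop A A"
proof (rule bopI)
  note t = contractionD[OF T]
  show "closed_csubspace A" by (rule t)
  show "cbl (defect A T)" by (rule cbl_defect[OF T])
  show p: "defect A T (proj A x) = defect A T x" for x
  proof -
    have "(norm (defect A T (x - proj A x)))\<^sup>2 = 0"
      unfolding norm_defect[OF T]
      by (simp add: blinfun.diff_right t(7) proj_ident[OF t(1) proj_mem[OF t(1)]])
    then show ?thesis by (simp add: blinfun.diff_right)
  qed
  have "proj A (defect A T x) = defect A T x" for x
    by (rule cinner_extI) (metis proj_cinner[OF t(1)] defect_selfadjoint[OF T] p)
  then show "defect A T x \<in> A" for x by (metis proj_mem[OF t(1)])
qed

lemma defect_intertwine:
  assumes T: "contraction A B T"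
  shows "T (defect A T x) = defect B (adj T) (T x)"
proof -
  note t = contractionD[OF T] and s = contractionD[OF contraction_adj[OF T]]
  have "T o\<^sub>L (proj A - (adj T o\<^sub>L T)) = (proj B - (adj (adj T) o\<^sub>L adj T)) o\<^sub>L T"
    by (rule blinfun_eqI)
      (simp add: blinfun.diff_left blinfun.diff_right t(7) adj_adj[OF t(5)] proj_ident[OF t(2) t(6)])
  from op_sqrt_intertwine[OF contraction_near_id[OF T] contraction_near_id[OF contraction_adj[OF T]] this]
  show ?thesis unfolding defect_def by (metis blinfun_apply_blinfun_compose)
qed

lemma defect_intertwine_adj:
  assumes T: "contraction A B T"
  shows "adj T (defect B (adj T) x) = defect A T (adj T x)"
  using defect_intertwine[OF contraction_adj[OF T]] adj_adj[OF contractionD(5)[OF T]] by simp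

lemma
  assumes T: "contraction A B T"
  shows defect_space_closed: "closed_csubspace (defect_space A T)"
    and defect_space_subset: "defect_space A T \<subseteq> A"
    and defect_mem: "defect A T x \<in> defect_space A T"
proof -
  note t = contractionD[OF T]
  show "closed_csubspace (defect_space A T)"
    unfolding defect_space_def by (intro closed_csubspace_closure csubspace_range cbl_defect[OF T])
  show "defect_space A T \<subseteq> A"
    unfolding defect_space_def using bopD(2)[OF defect_bop[OF T]] closed_csubspaceD(2)[OF t(1)]
    by (intro closure_minimal) auto
  show "defect A T x \<in> defect_space A T"
    unfolding defect_space_def by (rule subsetD[OF closure_subset]) simp
qed

lemma defect_eq_0:
  assumes T: "contraction A B T" and x: "x \<in> defect_space A T" "defect A T x = 0"
  shows "x = 0"
  using x(1)[unfolded defect_space_def]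
  by (rule closure_orthogonal_zero) (auto simp: defect_selfadjoint[OF T] x(2))

lemma maps_defect_space:
  assumes T: "contraction A B T" and x: "x \<in> defect_space A T"
  shows "T x \<in> defect_space B (adj T)"
proof -
  have "closed (blinfun_apply T -` defect_space B (adj T))"
    using closed_csubspaceD(2)[OF defect_space_closed[OF contraction_adj[OF T]]]
    by (intro closed_vimage continuous_intros) auto
  moreover have "range (defect A T) \<subseteq> blinfun_apply T -` defect_space B (adj T)"
    using defect_intertwine[OF T] defect_mem[OF contraction_adj[OF T]] by auto
  ultimately have "defect_space A T \<subseteq> blinfun_apply T -` defect_space B (adj T)"
    unfolding defect_space_def[of A] by (intro closure_minimal)
  then show ?thesis using x by auto
qed

text \<open>
  The adjoint of \<open>J\<^sub>T\<close> is \<open>J\<^sub>T\<^sub>*\<close>, and the products are computed from \<open>D\<^sub>T\<^sup>2 = I - T\<^sup>* T\<close> and the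
  intertwining relation.
\<close>

lemma elementary_rotation_inverse:
  assumes T: "contraction A B T" and p: "p \<in> A \<times> B"
  shows "elementary_rotation B A (adj T) (elementary_rotation A B T p) = p"
proof -
  note t = contractionD[OF T]
  show ?thesis using p
    by (auto simp: elementary_rotation_def adj_adj[OF t(5)] blinfun.add_right blinfun.diff_right
        defect_square[OF T] defect_square[OF contraction_adj[OF T]] defect_intertwine[OF T]
        defect_intertwine_adj[OF T] proj_ident[OF t(1)] proj_ident[OF t(2)])
qed

lemma elementary_rotation_mem:
  assumes T: "contraction A B T" and p: "p \<in> A \<times> defect_space B (adj T)"
  shows "elementary_rotation A B T p \<in> B \<times> defect_space A T"
proof -
  note t = contractionD[OF T] and s = contraction_adj[OF T]
  have "adj T y \<in> defect_space A T" if "y \<in> defect_space B (adj T)" for y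
    using maps_defect_space[OF s that] by (simp add: adj_adj[OF t(5)])
  then show ?thesis using p t(6) bopD(2)[OF defect_bop[OF s]] defect_mem[OF T]
    by (auto simp: elementary_rotation_def intro!: csubspaceD[OF closed_csubspaceD(1)[OF t(2)]]
        csubspaceD[OF closed_csubspaceD(1)[OF defect_space_closed[OF T]]])
qed

lemma elementary_rotation_linear:
  assumes T: "contraction A B T"
  shows "elementary_rotation A B T (p + q) = elementary_rotation A B T p + elementary_rotation A B T q"
    "elementary_rotation A B T (c *\<^sub>C p) = c *\<^sub>C elementary_rotation A B T p"
  by (auto simp: elementary_rotation_def split_beta scaleC_prod_def blinfun.add_right
      clinearD(2)[OF contractionD(5)[OF T]] clinearD(2)[OF cbl_defect[OF T]]
      clinearD(2)[OF contractionD(5)[OF contraction_adj[OF T]]]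
      clinearD(2)[OF cbl_defect[OF contraction_adj[OF T]]] scaleC_add_right scaleC.diff_right)

lemma elementary_rotation_adjoint:
  assumes T: "contraction A B T"
  shows "cinner (elementary_rotation A B T p) q = cinner p (elementary_rotation B A (adj T) q)"
proof -
  note t = contractionD[OF T]
  have "cinner (adj T y) v = cinner y (T v)" for y v
    by (rule adj_cinner'[OF t(5), symmetric])
  then show ?thesis
    by (simp add: elementary_rotation_def split_beta cinner_prod_def cinner_add_left cinner_add_right
        cinner.diff_left cinner.diff_right adj_adj[OF t(5)] adj_cinner[OF t(5)]
        defect_selfadjoint[OF T] defect_selfadjoint[OF contraction_adj[OF T]])
qed

lemma elementary_rotation_cinner:
  assumes T: "contraction A B T" and "q \<in> A \<times> B"
  shows "cinner (elementary_rotation A B T p) (elementary_rotation A B T q) = cinner p q"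
  unfolding elementary_rotation_adjoint[OF T] elementary_rotation_inverse[OF T assms(2)] ..

lemma norm_elementary_rotation:
  assumes T: "contraction A B T" and "p \<in> A \<times> B"
  shows "norm (elementary_rotation A B T p) = norm p"
  using elementary_rotation_cinner[OF T assms(2), of p]
  by (simp add: cinner_self del: of_real_power)

lemma unitary_elementary_rotation:
  assumes T: "contraction A B T"
  shows "unitary_between (A \<times> defect_space B (adj T)) (B \<times> defect_space A T) (elementary_rotation A B T)"
  unfolding unitary_between_def
proof (intro conjI ballI allI)
  note t = contractionD[OF T] and s = contraction_adj[OF T]
  let ?J = "elementary_rotation A B T" and ?J' = "elementary_rotation B A (adj T)"
  have sub: "A \<times> defect_space B (adj T) \<subseteq> A \<times> B" "B \<times> defect_space A T \<subseteq> B \<times> A"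
    using defect_space_subset[OF T] defect_space_subset[OF s] by auto
  show "cinner (?J x) (?J y) = cinner x y"
    if "x \<in> A \<times> defect_space B (adj T)" "y \<in> A \<times> defect_space B (adj T)" for x y
    by (rule elementary_rotation_cinner[OF T]) (use that sub in blast)+
  show "?J ` (A \<times> defect_space B (adj T)) = B \<times> defect_space A T"
  proof (intro subset_antisym subsetI)
    fix q assume q: "q \<in> B \<times> defect_space A T"
    have "?J (?J' q) = q"
      using elementary_rotation_inverse[OF s, of q] q sub adj_adj[OF t(5)] by auto
    moreover have "?J' q \<in> A \<times> defect_space B (adj T)"
      using elementary_rotation_mem[OF s, of q] q adj_adj[OF t(5)] by auto
    ultimately show "q \<in> ?J ` (A \<times> defect_space B (adj T))" by (metis imageI)
  qed (use elementary_rotation_mem[OF T] in blast)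
qed (rule elementary_rotation_linear[OF T])+

section \<open>Unitary maps between subspaces and their integer powers\<close>

lemma unitary_betweenD:
  assumes "unitary_between H K U"
  shows "x \<in> H \<Longrightarrow> y \<in> H \<Longrightarrow> U (x + y) = U x + U y" "x \<in> H \<Longrightarrow> U (c *\<^sub>C x) = c *\<^sub>C U x"
    "x \<in> H \<Longrightarrow> y \<in> H \<Longrightarrow> cinner (U x) (U y) = cinner x y" "x \<in> H \<Longrightarrow> U x \<in> K" "U ` H = K"
  using assms by (auto simp: unitary_between_def)

lemma unitary_between_norm:
  assumes "unitary_between H K U" "x \<in> H"
  shows "norm (U x) = norm x"
  using unitary_betweenD(3)[OF assms(1) assms(2) assms(2)]
  by (simp add: cinner_self del: of_real_power)

lemma unitary_between_inj:
  assumes U: "unitary_between H K U" and H: "csubspace H" and "x \<in> H" "y \<in> H" "U x = U y"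
  shows "x = y"
proof -
  note u = unitary_betweenD[OF U] and s = csubspaceD[OF H]
  have "U (x - y) = U x - U y"
    using u(1)[of "x - y" y] assms s(3) by simp
  then have "norm (x - y) = 0"
    using unitary_between_norm[OF U s(3)[OF assms(3,4)]] assms(5) by simp
  then show ?thesis by simp
qed

lemma unitary_between_compose:
  assumes "unitary_between H K U" "unitary_between K L V"
  shows "unitary_between H L (V \<circ> U)"
proof -
  have "(V \<circ> U) ` H = L"
    using unitary_betweenD(5)[OF assms(1)] unitary_betweenD(5)[OF assms(2)] by (metis image_comp)
  then show ?thesis
    unfolding unitary_between_def
    using unitary_betweenD(1-4)[OF assms(1)] unitary_betweenD(1-4)[OF assms(2)] by simp
qed

lemma unitary_between_inverse:
  assumes U: "unitary_between H K U" and H: "csubspace H"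
    and V: "\<And>k. k \<in> K \<Longrightarrow> V k \<in> H" "\<And>k. k \<in> K \<Longrightarrow> U (V k) = k"
  shows "unitary_between K H V"
proof -
  note u = unitary_betweenD[OF U] and s = csubspaceD[OF H]
  have VU: "V (U h) = h" if "h \<in> H" for h
    by (rule unitary_between_inj[OF U H]) (use that V u(4) in auto)
  have eq: "V k = h" if "h \<in> H" "U h = k" for h k
    using VU that by auto
  show ?thesis
    unfolding unitary_between_def
  proof (intro conjI ballI allI)
    fix x y c assume "x \<in> K" "y \<in> K"
    then show "V (x + y) = V x + V y" "cinner (V x) (V y) = cinner x y"
      using V s(2) u(1,3)[of "V x" "V y"] by (auto intro: eq)
    show "V (c *\<^sub>C x) = c *\<^sub>C V x"
      using V s(4) u(2)[of "V x" c] \<open>x \<in> K\<close> by (auto intro: eq)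
  next
    show "V ` K = H"
      using V(1) VU u(4) by (metis image_eqI image_subsetI subsetI subset_antisym)
  qed
qed

lemma unitary_between_cong:
  assumes "unitary_between H K U" "\<And>x. x \<in> H \<Longrightarrow> U' x = U x" "csubspace H"
  shows "unitary_between H K U'"
proof -
  have "U' ` H = U ` H" using assms(2) by (intro image_cong) auto
  then show ?thesis
    using assms csubspaceD(2,4)[OF assms(3)] unfolding unitary_between_def by simp
qed

lemma unitary_inv_into:
  assumes U: "unitary_between H H U" and H: "csubspace H"
  shows "unitary_between H H (inv_into H U)" "x \<in> H \<Longrightarrow> U (inv_into H U x) = x"
    "x \<in> H \<Longrightarrow> inv_into H U (U x) = x"
proof -
  note u = unitary_betweenD[OF U]
  show 1: "U (inv_into H U x) = x" if "x \<in> H" for x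
    using that u(5) by (intro f_inv_into_f) auto
  show "unitary_between H H (inv_into H U)"
    by (rule unitary_between_inverse[OF U H]) (use 1 u(5) in \<open>auto intro: inv_into_into\<close>)
  show "inv_into H U (U x) = x" if "x \<in> H"
    by (rule inv_into_f_f) (use that unitary_between_inj[OF U H] in \<open>auto simp: inj_on_def\<close>)
qed

lemma unitary_funpow:
  assumes U: "unitary_between H H U" and H: "csubspace H"
  shows "unitary_between H H (U ^^ n)"
proof (induction n)
  case 0 then show ?case by (simp add: unitary_between_def)
next
  case (Suc n)
  then show ?case using unitary_between_compose[OF Suc U] by (simp only: funpow.simps)
qed

lemma unitary_int_power:
  assumes U: "unitary_between H H U" and H: "csubspace H"
  shows "unitary_between H H (int_power H U n)"
  unfolding int_power_def using unitary_funpow[OF U H] unitary_funpow[OF unitary_inv_into(1)[OF U H] H]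
  by auto

lemma unitary_funpow_adjoint:
  assumes U: "unitary_between H H U" and H: "csubspace H" and xy: "x \<in> H" "y \<in> H"
  shows "cinner ((inv_into H U ^^ n) x) y = cinner x ((U ^^ n) y)"
  using xy
proof (induction n arbitrary: y)
  case (Suc n)
  note i = unitary_inv_into[OF U H]
  have m: "(inv_into H U ^^ n) x \<in> H"
    using unitary_betweenD(4)[OF unitary_funpow[OF i(1) H]] Suc.prems by blast
  have "cinner ((inv_into H U ^^ Suc n) x) y = cinner (U ((inv_into H U ^^ Suc n) x)) (U y)"
    using unitary_betweenD(3)[OF U] unitary_betweenD(4)[OF i(1)] m Suc.prems by simp
  also have "\<dots> = cinner ((inv_into H U ^^ n) x) (U y)" using i(2)[OF m] by simp
  also have "\<dots> = cinner x ((U ^^ n) (U y))"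
    using Suc.prems unitary_betweenD(4)[OF U] by (intro Suc.IH) auto
  finally show ?case by (simp add: funpow_swap1)
qed simp

lemma int_power_step:
  assumes U: "unitary_between H H U" and H: "csubspace H" and x: "x \<in> H"
  shows "U (int_power H U n x) = int_power H U (n + 1) x"
    "inv_into H U (int_power H U n x) = int_power H U (n - 1) x"
proof -
  note i = unitary_inv_into[OF U H]
  have m: "(U ^^ k) x \<in> H" "(inv_into H U ^^ k) x \<in> H" for k
    using unitary_betweenD(4)[OF unitary_funpow[OF U H]] x
      unitary_betweenD(4)[OF unitary_funpow[OF i(1) H]] by blast+
  show "U (int_power H U n x) = int_power H U (n + 1) x"
  proof (cases "0 \<le> n")
    case True
    then have "nat (n + 1) = Suc (nat n)" by simp
    then show ?thesis using True by (simp add: int_power_def)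
  next
    case False
    then have *: "nat (- n) = Suc (nat (- (n + 1)))" by simp
    show ?thesis
    proof (cases "n + 1 = 0")
      case True then show ?thesis using * i(2)[OF x] by (simp add: int_power_def)
    next
      case F: False
      then show ?thesis using False i(2)[OF m(2)] unfolding int_power_def * by simp
    qed
  qed
  show "inv_into H U (int_power H U n x) = int_power H U (n - 1) x"
  proof (cases "0 < n")
    case True
    then have "nat n = Suc (nat (n - 1))" by simp
    then show ?thesis using True i(3)[OF m(1)] by (simp add: int_power_def)
  next
    case False
    then have "nat (- (n - 1)) = Suc (nat (- n))" by simp
    then show ?thesis using False by (cases "n = 0") (auto simp: int_power_def)
  qed
qed

section \<open>Blockwise unitary maps on Hilbert sums\<close>

definition l2_sum :: "(nat \<Rightarrow> 'a::chilbert set) \<Rightarrow> 'a l2 set" where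
  "l2_sum H = {h. \<forall>n. l2_nth h n \<in> H n}"

lemma bounded_linear_l2_nth: "bounded_linear (\<lambda>f :: 'a::real_normed_vector l2. l2_nth f n)"
  by (rule bounded_linear_intro[where K = 1])
    (simp_all add: plus_l2.rep_eq scaleR_l2.rep_eq norm_l2_nth_le)

lemma closed_csubspace_l2_sum:
  assumes "\<And>n. closed_csubspace (H n)"
  shows "closed_csubspace (l2_sum H)"
  unfolding closed_csubspace_def
proof
  note h = csubspaceD[OF closed_csubspaceD(1)[OF assms]]
  show "csubspace (l2_sum H)"
    unfolding complex_vector.subspace_def
    by (auto simp: l2_sum_def zero_l2.rep_eq plus_l2.rep_eq scaleC_l2.rep_eq intro: h)
  have "l2_sum H = (\<Inter>n. (\<lambda>f. l2_nth f n) -` H n)" by (auto simp: l2_sum_def)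
  also have "closed \<dots>"
    using assms closed_csubspaceD(2)
    by (intro closed_INT ballI closed_vimage linear_continuous_on bounded_linear_l2_nth) auto
  finally show "closed (l2_sum H)" .
qed

lemma closed_csubspace_Times:
  assumes "closed_csubspace A" "closed_csubspace B"
  shows "closed_csubspace (A \<times> B)"
  using assms unfolding closed_csubspace_def complex_vector.subspace_def
  by (auto simp: scaleC_prod_def zero_prod_def intro: closed_Times)

lemma l2_nth_Abs: "summable (\<lambda>n. (norm (f n))\<^sup>2) \<Longrightarrow> l2_nth (Abs_l2 f) = f"
  by (simp add: Abs_l2_inverse)

lemma blockwise_unitary:
  assumes U: "\<And>n. unitary_between (H n) (K n) (U n)" and H: "\<And>n. closed_csubspace (H n)"
  shows "h \<in> l2_sum H \<Longrightarrow> l2_nth (Abs_l2 (\<lambda>n. U n (l2_nth h n))) n = U n (l2_nth h n)"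
    and "unitary_between (l2_sum H) (l2_sum K) (\<lambda>h. Abs_l2 (\<lambda>n. U n (l2_nth h n)))"
proof -
  note u = unitary_betweenD[OF U] and s = csubspaceD[OF closed_csubspaceD(1)[OF H]]
  note sl = csubspaceD[OF closed_csubspaceD(1)[OF closed_csubspace_l2_sum[of H, OF H]]]
  show nth: "l2_nth (Abs_l2 (\<lambda>n. U n (l2_nth h n))) n = U n (l2_nth h n)" if "h \<in> l2_sum H" for h n
  proof -
    have "norm (U n (l2_nth h n)) = norm (l2_nth h n)" for n
      using that by (intro unitary_between_norm[OF U]) (simp add: l2_sum_def)
    then show ?thesis by (simp add: l2_nth_Abs l2_summable)
  qed
  show "unitary_between (l2_sum H) (l2_sum K) (\<lambda>h. Abs_l2 (\<lambda>n. U n (l2_nth h n)))"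
    unfolding unitary_between_def
  proof (intro conjI ballI allI)
    fix x y c assume xy: "x \<in> l2_sum H" "y \<in> l2_sum H"
    then have n: "l2_nth x n \<in> H n" "l2_nth y n \<in> H n" for n by (auto simp: l2_sum_def)
    show "Abs_l2 (\<lambda>n. U n (l2_nth (x + y) n)) = Abs_l2 (\<lambda>n. U n (l2_nth x n)) + Abs_l2 (\<lambda>n. U n (l2_nth y n))"
      by (rule l2_eqI, unfold nth[OF sl(2)[OF xy]]) (simp add: nth xy plus_l2.rep_eq u(1) n)
    show "Abs_l2 (\<lambda>n. U n (l2_nth (c *\<^sub>C x) n)) = c *\<^sub>C Abs_l2 (\<lambda>n. U n (l2_nth x n))"
      by (rule l2_eqI, unfold nth[OF sl(4)[OF xy(1)]]) (simp add: nth xy scaleC_l2.rep_eq u(2) n)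
    show "cinner (Abs_l2 (\<lambda>n. U n (l2_nth x n))) (Abs_l2 (\<lambda>n. U n (l2_nth y n))) = cinner x y"
      using xy n by (simp add: cinner_l2_def nth u(3))
  next
    show "(\<lambda>h. Abs_l2 (\<lambda>n. U n (l2_nth h n))) ` l2_sum H = l2_sum K" (is "?F ` _ = _")
    proof (intro subset_antisym subsetI)
      fix g assume "g \<in> ?F ` l2_sum H"
      then show "g \<in> l2_sum K" using u(4) by (auto simp: l2_sum_def nth[unfolded l2_sum_def])
    next
      fix g assume g: "g \<in> l2_sum K"
      have "\<exists>x\<in>H n. U n x = l2_nth g n" for n
      proof -
        have "l2_nth g n \<in> U n ` H n" using g u(5)[of n] by (simp add: l2_sum_def)
        then show ?thesis by auto
      qed
      then obtain x where x: "\<And>n. x n \<in> H n" "\<And>n. U n (x n) = l2_nth g n" by metis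
      have "norm (x n) = norm (l2_nth g n)" for n
        using unitary_between_norm[OF U x(1)] by (simp add: x(2))
      then have nx: "l2_nth (Abs_l2 x) = x" by (simp add: l2_nth_Abs l2_summable)
      then have "Abs_l2 x \<in> l2_sum H" by (simp add: l2_sum_def x)
      moreover from this have "?F (Abs_l2 x) = g"
        by (intro l2_eqI) (simp add: nx x(2) l2_nth_inverse)
      ultimately show "g \<in> ?F ` l2_sum H" by blast
    qed
  qed
qed

section \<open>Regrouping the direct sums\<close>

text \<open>
  The same sequence \<open>x\<^sub>0, y\<^sub>0, x\<^sub>1, y\<^sub>1, \<dots>\<close>, once cut into pairs \<open>(x\<^sub>n, y\<^sub>n)\<close> and once into \<open>x\<^sub>0\<close> and the pairs
  \<open>(y\<^sub>n, x\<^sub>n\<^sub>+\<^sub>1)\<close>. Up to these two isometries \<open>cmv_L\<close> is block diagonal.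
\<close>

definition ungroup :: "('x::chilbert \<times> 'y::chilbert) l2 \<Rightarrow> 'x \<times> ('y \<times> 'x) l2" where
  "ungroup f = (fst (l2_nth f 0), Abs_l2 (\<lambda>n. (snd (l2_nth f n), fst (l2_nth f (Suc n)))))"

definition regroup :: "'x::chilbert \<times> ('y::chilbert \<times> 'x) l2 \<Rightarrow> ('x \<times> 'y) l2" where
  "regroup v = Abs_l2 (\<lambda>n. (case n of 0 \<Rightarrow> fst v | Suc k \<Rightarrow> snd (l2_nth (snd v) k), fst (l2_nth (snd v) n)))"

lemma norm_Pair_square: "(norm (x, y))\<^sup>2 = (norm x)\<^sup>2 + (norm y)\<^sup>2"
  by (simp add: norm_prod_def)

lemma norm_prod_square: "(norm p)\<^sup>2 = (norm (fst p))\<^sup>2 + (norm (snd p))\<^sup>2"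
  by (simp add: norm_prod_def)

lemma l2_summable_fst: "summable (\<lambda>n. (norm (fst (l2_nth f n)))\<^sup>2)"
  and l2_summable_snd: "summable (\<lambda>n. (norm (snd (l2_nth f n)))\<^sup>2)"
  by (rule summable_comparison_test'[OF l2_summable[of f], of 0]; simp add: norm_prod_square)+

lemma ungroup_nth:
  "l2_nth (snd (ungroup f)) n = (snd (l2_nth f n), fst (l2_nth f (Suc n)))"
proof -
  have "summable (\<lambda>n. (norm (snd (l2_nth f n), fst (l2_nth f (Suc n))))\<^sup>2)"
    unfolding norm_Pair_square
    using l2_summable_fst[of f] l2_summable_snd[of f]
    by (intro summable_add) (simp_all add: summable_Suc_iff[of "\<lambda>n. (norm (fst (l2_nth f n)))\<^sup>2"])
  then show ?thesis by (simp add: ungroup_def l2_nth_Abs)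
qed

lemma fst_ungroup [simp]: "fst (ungroup f) = fst (l2_nth f 0)"
  by (simp add: ungroup_def)

lemma regroup_nth:
  "l2_nth (regroup v) n = (case n of 0 \<Rightarrow> fst v | Suc k \<Rightarrow> snd (l2_nth (snd v) k), fst (l2_nth (snd v) n))"
proof -
  let ?f = "\<lambda>n. (case n of 0 \<Rightarrow> fst v | Suc k \<Rightarrow> snd (l2_nth (snd v) k), fst (l2_nth (snd v) n))"
  have "summable (\<lambda>n. (norm (?f (Suc n)))\<^sup>2)"
    unfolding norm_Pair_square
    using l2_summable_fst[of "snd v"] l2_summable_snd[of "snd v"]
    by (intro summable_add) (simp_all add: summable_Suc_iff[of "\<lambda>n. (norm (fst (l2_nth (snd v) n)))\<^sup>2"])
  then have "summable (\<lambda>n. (norm (?f n))\<^sup>2)"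
    by (subst (asm) summable_Suc_iff)
  then show ?thesis unfolding regroup_def by (subst l2_nth_Abs) auto
qed

lemma ungroup_regroup: "ungroup (regroup v) = v"
  by (rule prod_eqI) (auto intro!: l2_eqI simp: ungroup_nth regroup_nth)

lemma ungroup_cinner: "cinner (ungroup f) (ungroup g) = cinner f g"
proof -
  let ?a = "\<lambda>n. cinner (fst (l2_nth f n)) (fst (l2_nth g n))"
  let ?b = "\<lambda>n. cinner (snd (l2_nth f n)) (snd (l2_nth g n))"
  have cs: "norm (cinner x y) \<le> (norm x)\<^sup>2 + (norm y)\<^sup>2" for x y :: "'z::chilbert"
    using cinner_Cauchy_Schwarz[of x y] sum_squares_bound[of "norm x" "norm y"]
      mult_nonneg_nonneg[OF norm_ge_zero[of x] norm_ge_zero[of y]] by linarith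
  have a: "summable ?a"
    by (rule summable_comparison_test'[OF summable_add[OF l2_summable_fst l2_summable_fst]]) (rule cs)
  have b: "summable ?b"
    by (rule summable_comparison_test'[OF summable_add[OF l2_summable_snd l2_summable_snd]]) (rule cs)
  have "cinner (ungroup f) (ungroup g) = ?a 0 + (\<Sum>n. ?b n + ?a (Suc n))"
    by (simp add: cinner_prod_def cinner_l2_def ungroup_nth)
  also have "\<dots> = ?a 0 + ((\<Sum>n. ?b n) + (\<Sum>n. ?a (Suc n)))"
    using a b by (subst suminf_add) (auto simp: summable_Suc_iff[of ?a])
  also have "\<dots> = (\<Sum>n. ?a n) + (\<Sum>n. ?b n)"
    using suminf_split_head[OF a] by simp
  also have "\<dots> = cinner f g"
    using suminf_add[OF a b] by (simp add: cinner_l2_def cinner_prod_def)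
  finally show ?thesis .
qed

lemma ungroup_linear: "ungroup (f + g) = ungroup f + ungroup g" "ungroup (c *\<^sub>C f) = c *\<^sub>C ungroup f"
  by (rule prod_eqI; auto intro!: l2_eqI simp: ungroup_nth plus_l2.rep_eq scaleC_prod_def scaleC_l2.rep_eq)+

lemma unitary_ungroup:
  assumes "\<And>f. f \<in> H \<Longrightarrow> ungroup f \<in> K" "\<And>v. v \<in> K \<Longrightarrow> regroup v \<in> H"
  shows "unitary_between H K ungroup"
  unfolding unitary_between_def using assms
  by (auto simp: ungroup_linear ungroup_cinner) (metis image_eqI ungroup_regroup)

section \<open>Block operator CMV matrices are unitary\<close>

definition contractive_params :: "(nat \<Rightarrow> 'a::chilbert \<Rightarrow>\<^sub>L 'b::chilbert) \<Rightarrow> bool" where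
  "contractive_params G \<longleftrightarrow> (\<forall>n. contraction (param_dom G n) (param_cod G n) (G n))"

context
  fixes G :: "nat \<Rightarrow> 'a::chilbert \<Rightarrow>\<^sub>L 'b::chilbert"
  assumes G: "contractive_params G"
begin

lemma params_contraction: "contraction (param_dom G n) (param_cod G n) (G n)"
  using G by (simp add: contractive_params_def)

lemma param_closed: "closed_csubspace (param_dom G n)" "closed_csubspace (param_cod G n)"
  using contractionD(1,2)[OF params_contraction] by auto

lemma unitary_param_rotation:
  "unitary_between (param_dom G n \<times> param_cod G (Suc n)) (param_cod G n \<times> param_dom G (Suc n)) (param_rotation G n)"
  using unitary_elementary_rotation[OF params_contraction[of n]] by (simp add: param_rotation_def)

lemma param_rotation_linear:
  "param_rotation G n (c *\<^sub>C p) = c *\<^sub>C param_rotation G n p"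
  unfolding param_rotation_def by (rule elementary_rotation_linear[OF params_contraction])

lemma param_rotation_fst_zero:
  assumes "y \<in> param_cod G (Suc n)" "fst (param_rotation G n (0, y)) = 0"
  shows "y = 0"
  using assms defect_eq_0[OF contraction_adj[OF params_contraction[of n]], of y]
  by (simp add: param_rotation_def elementary_rotation_def)

lemma param_rotation_zero: "param_rotation G n (0, 0) = (0, 0)"
  by (simp add: param_rotation_def elementary_rotation_def)

lemma cmv_sum_eq: "cmv_sum G = l2_sum (\<lambda>n. param_dom G (2 * n + 1) \<times> param_cod G (Suc (2 * n + 1)))"
  "cmv_sum' G = l2_sum (\<lambda>n. param_cod G (2 * n + 1) \<times> param_dom G (Suc (2 * n + 1)))"
  by (simp_all add: cmv_sum_def cmv_sum'_def l2_sum_def del: param_dom.simps param_cod.simps)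

lemma closed_csubspace_cmv_sum: "closed_csubspace (cmv_sum G)" "closed_csubspace (cmv_sum' G)"
  unfolding cmv_sum_eq
  by (intro closed_csubspace_l2_sum closed_csubspace_Times param_closed)+

lemma unitary_cmv_V: "unitary_between (cmv_sum G) (cmv_sum' G) (cmv_V G)"
  and cmv_V_nth: "h \<in> cmv_sum G \<Longrightarrow> l2_nth (cmv_V G h) n = param_rotation G (2 * n + 1) (l2_nth h n)"
  unfolding cmv_sum_eq cmv_V_def
  by (rule blockwise_unitary, rule unitary_param_rotation,
      intro closed_csubspace_Times param_closed)+

lemma unitary_cmv_W:
  "unitary_between (UNIV \<times> cmv_sum G) (UNIV \<times> cmv_sum' G) (map_prod (id :: 'm::chilbert \<Rightarrow> 'm) (cmv_V G))"
proof -
  note v = unitary_betweenD[OF unitary_cmv_V]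
  have "map_prod id (cmv_V G) ` (UNIV \<times> cmv_sum G) = UNIV \<times> cmv_sum' G"
    using v(5) by (simp add: map_prod_surj_on)
  then show ?thesis
    unfolding unitary_between_def using v
    by (auto simp: scaleC_prod_def cinner_prod_def split_beta)
qed

lemma cmv_L_eq:
  assumes "v \<in> UNIV \<times> cmv_sum' G"
  shows "cmv_L G v = ungroup (Abs_l2 (\<lambda>n. param_rotation G (2 * n) (l2_nth (regroup v) n)))"
    and "regroup v \<in> l2_sum (\<lambda>n. param_dom G (2 * n) \<times> param_cod G (Suc (2 * n)))"
proof -
  let ?H = "\<lambda>n. param_dom G (2 * n) \<times> param_cod G (Suc (2 * n))"
  show mem: "regroup v \<in> l2_sum ?H"
  proof -
    have "snd v \<in> cmv_sum' G" using assms by auto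
    then have g: "fst (l2_nth (snd v) n) \<in> param_cod G (Suc (2 * n))"
      "snd (l2_nth (snd v) n) \<in> param_dom G (2 * Suc n)" for n
      by (simp_all add: cmv_sum'_def mem_Times_iff del: param_dom.simps param_cod.simps)
    have "l2_nth (regroup v) n \<in> ?H n" for n
      using g[of 0] g[of n] g[of "n - 1"]
      by (cases n) (simp_all add: regroup_nth del: param_dom.simps(2) param_cod.simps(2))
    then show ?thesis by (simp add: l2_sum_def)
  qed
  have "l2_nth (Abs_l2 (\<lambda>n. param_rotation G (2 * n) (l2_nth (regroup v) n))) n
      = cmv_L_block G v n" for n
    by (subst blockwise_unitary(1)[OF unitary_param_rotation _ mem])
      (auto intro!: closed_csubspace_Times param_closed simp: cmv_L_block_def regroup_nth
        simp del: param_dom.simps param_cod.simps)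
  then show "cmv_L G v = ungroup (Abs_l2 (\<lambda>n. param_rotation G (2 * n) (l2_nth (regroup v) n)))"
    by (simp add: ungroup_def cmv_L_def)
qed

lemma unitary_cmv_L: "unitary_between (UNIV \<times> cmv_sum' G) (UNIV \<times> cmv_sum G) (cmv_L G)"
proof -
  let ?H = "\<lambda>n. param_dom G (2 * n) \<times> param_cod G (Suc (2 * n))"
  let ?K = "\<lambda>n. param_cod G (2 * n) \<times> param_dom G (Suc (2 * n))"
  have sH: "csubspace (l2_sum ?H)"
    by (intro closed_csubspaceD(1) closed_csubspace_l2_sum closed_csubspace_Times param_closed)
  have "unitary_between (l2_sum ?H) (UNIV \<times> cmv_sum' G) ungroup"
  proof (rule unitary_ungroup)
    fix f assume "f \<in> l2_sum ?H"
    then have "l2_nth f n \<in> ?H n" for n by (simp add: l2_sum_def)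
    from this this[of "Suc _"] show "ungroup f \<in> UNIV \<times> cmv_sum' G"
      by (simp add: mem_Times_iff cmv_sum'_def ungroup_nth del: param_dom.simps param_cod.simps)
  qed (rule cmv_L_eq(2))
  then have 1: "unitary_between (UNIV \<times> cmv_sum' G) (l2_sum ?H) regroup"
    by (rule unitary_between_inverse[OF _ sH]) (rule cmv_L_eq(2), assumption, rule ungroup_regroup)
  have 2: "unitary_between (l2_sum ?H) (l2_sum ?K) (\<lambda>h. Abs_l2 (\<lambda>n. param_rotation G (2 * n) (l2_nth h n)))"
    by (rule blockwise_unitary, rule unitary_param_rotation, intro closed_csubspace_Times param_closed)
  have 3: "unitary_between (l2_sum ?K) (UNIV \<times> cmv_sum G) ungroup"
  proof (rule unitary_ungroup)
    fix f assume "f \<in> l2_sum ?K"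
    then have "l2_nth f n \<in> ?K n" for n by (simp add: l2_sum_def)
    from this this[of "Suc _"] show "ungroup f \<in> UNIV \<times> cmv_sum G"
      by (simp add: mem_Times_iff cmv_sum_def ungroup_nth del: param_dom.simps param_cod.simps)
  next
    fix v :: "'b \<times> ('a \<times> 'b) l2" assume "v \<in> UNIV \<times> cmv_sum G"
    then have "snd v \<in> cmv_sum G" by auto
    then have g: "fst (l2_nth (snd v) n) \<in> param_dom G (Suc (2 * n))"
      "snd (l2_nth (snd v) n) \<in> param_cod G (2 * Suc n)" for n
      by (simp_all add: cmv_sum_def mem_Times_iff del: param_dom.simps param_cod.simps)
    have "l2_nth (regroup v) n \<in> ?K n" for n
      using g[of 0] g[of n] g[of "n - 1"]
      by (cases n) (simp_all add: regroup_nth del: param_dom.simps(2) param_cod.simps(2))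
    then show "regroup v \<in> l2_sum ?K" by (simp add: l2_sum_def)
  qed
  have "csubspace (UNIV \<times> cmv_sum' G :: ('a \<times> ('b \<times> 'a) l2) set)"
    by (intro closed_csubspaceD(1) closed_csubspace_Times closed_csubspace_cmv_sum closed_csubspace_UNIV)
  then show ?thesis
    by (rule unitary_between_cong[OF unitary_between_compose[OF unitary_between_compose[OF 1 2] 3], rotated])
      (simp add: cmv_L_eq(1))
qed

end

section \<open>The CMV matrices of a sequence of operators in one space\<close>

context
  fixes G :: "nat \<Rightarrow> 'm::chilbert \<Rightarrow>\<^sub>L 'm"
  assumes G: "contractive_params G"
begin

abbreviation (input) "cmv_space \<equiv> (UNIV :: 'm set) \<times> cmv_sum G"
abbreviation (input) "cmv_space' \<equiv> (UNIV :: 'm set) \<times> cmv_sum' G"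

lemma closed_csubspace_cmv: "closed_csubspace cmv_space" "closed_csubspace cmv_space'"
  by (intro closed_csubspace_Times closed_csubspace_cmv_sum[OF G] closed_csubspace_UNIV)+

lemma unitary_cmv: "unitary_between cmv_space cmv_space (cmv G)"
  and unitary_cmv': "unitary_between cmv_space' cmv_space' (cmv' G)"
  unfolding cmv_def cmv'_def
  using unitary_between_compose[OF unitary_cmv_W[OF G] unitary_cmv_L[OF G]]
    unitary_between_compose[OF unitary_cmv_L[OF G] unitary_cmv_W[OF G]] .

text \<open>
  The vectors orthogonal to all \<open>U\<^sup>n M\<close> form a reducing subspace \<open>N\<close>. An entry that vanishes for
  all elements of \<open>N\<close> also vanishes for their images under \<open>U\<close>. If the input \<open>(0, y)\<close> of a rotation has an output
  with first entry 0, then \<open>y = 0\<close>, and the whole output is 0; this carries the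
  vanishing from the component in \<open>M\<close> along the chain of rotations to all coordinates.
\<close>

lemma cmv_minimal:
  assumes h: "h \<in> cmv_space"
    and orth: "\<And>n x. cinner h (int_power cmv_space (cmv G) n (x, 0)) = 0"
  shows "h = 0"
proof -
  let ?U = "cmv G" and ?H = cmv_space
  define N where "N = {h \<in> ?H. \<forall>n x. cinner h (int_power ?H ?U n (x, 0)) = 0}"
  note sH = closed_csubspaceD(1)[OF closed_csubspace_cmv(1)]
  note U = unitary_cmv and i = unitary_inv_into[OF unitary_cmv sH]
  have x0: "(x, 0) \<in> ?H" for x
    using csubspaceD(1)[OF closed_csubspaceD(1)[OF closed_csubspace_cmv_sum(1)[OF G]]] by auto
  have ip: "int_power ?H ?U n (x, 0) \<in> ?H" for n x
    by (rule unitary_betweenD(4)[OF unitary_int_power[OF U sH] x0])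
  have NU: "?U h \<in> N" if "h \<in> N" for h
  proof -
    have h: "h \<in> ?H" using that by (simp add: N_def)
    have "cinner (?U h) (int_power ?H ?U n (x, 0)) = cinner h (int_power ?H ?U (n - 1) (x, 0))" for n x
      using unitary_betweenD(3)[OF U h ip, of "n - 1" x] int_power_step(1)[OF U sH x0, of "n - 1" x]
      by simp
    then show ?thesis using that unitary_betweenD(4)[OF U h] by (simp add: N_def)
  qed
  have NV: "\<exists>k\<in>N. h = ?U k" if "h \<in> N" for h
  proof
    have h: "h \<in> ?H" using that by (simp add: N_def)
    have "cinner (inv_into ?H ?U h) (int_power ?H ?U n (x, 0)) = cinner h (int_power ?H ?U (n + 1) (x, 0))" for n x
      using unitary_betweenD(3)[OF i(1) h ip, of "n + 1" x] int_power_step(2)[OF U sH x0, of "n + 1" x]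
      by simp
    then show "inv_into ?H ?U h \<in> N"
      using that unitary_betweenD(4)[OF i(1) h] by (simp add: N_def)
    show "h = ?U (inv_into ?H ?U h)" using i(2)[OF h] by simp
  qed
  have fst0: "fst h = 0" if "h \<in> N" for h
  proof -
    have "cinner h (int_power ?H ?U 0 (fst h, 0)) = 0" using that by (simp add: N_def)
    then have "cinner (fst h) (fst h) = 0" by (simp add: int_power_def cinner_prod_def)
    then show ?thesis by (simp add: cinner_self)
  qed
  \<comment> \<open>For \<open>(m, h)\<close> in \<open>N\<close> the matrix \<open>L\<close> acts on \<open>(m, g)\<close>.\<close>
  define g where "g h = cmv_V G (snd h)" for h :: "'m \<times> ('m \<times> 'm) l2"
  have hN: "snd h \<in> cmv_sum G" if "h \<in> N" for h using that by (auto simp: N_def)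
  have gN: "g h \<in> cmv_sum' G" if "h \<in> N" for h
    unfolding g_def using unitary_betweenD(4)[OF unitary_cmv_V[OF G] hN[OF that]] .
  have g_nth: "l2_nth (g h) n = param_rotation G (2 * n + 1) (l2_nth (snd h) n)" if "h \<in> N" for h n
    unfolding g_def by (rule cmv_V_nth[OF G hN[OF that]])
  have U_eq: "?U h = ungroup (Abs_l2 (\<lambda>n. param_rotation G (2 * n) (l2_nth (regroup (fst h, g h)) n)))"
    and R_nth: "l2_nth (Abs_l2 (\<lambda>n. param_rotation G (2 * n) (l2_nth (regroup (fst h, g h)) n))) n
      = param_rotation G (2 * n) (l2_nth (regroup (fst h, g h)) n)" if "h \<in> N" for h n
  proof -
    have m: "(fst h, g h) \<in> cmv_space'" using gN[OF that] by auto
    have "?U h = cmv_L G (fst h, g h)" by (cases h) (simp add: cmv_def g_def)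
    then show "?U h = ungroup (Abs_l2 (\<lambda>n. param_rotation G (2 * n) (l2_nth (regroup (fst h, g h)) n)))"
      using cmv_L_eq(1)[OF G m] by simp
    show "l2_nth (Abs_l2 (\<lambda>n. param_rotation G (2 * n) (l2_nth (regroup (fst h, g h)) n))) n
      = param_rotation G (2 * n) (l2_nth (regroup (fst h, g h)) n)"
      by (rule blockwise_unitary(1)[OF unitary_param_rotation[OF G] _ cmv_L_eq(2)[OF G m]])
        (intro closed_csubspace_Times param_closed[OF G])
  qed
  have c_mem: "fst (l2_nth (g h) n) \<in> param_cod G (Suc (2 * n))" if "h \<in> N" for h n
    using gN[OF that] by (auto simp: cmv_sum'_def mem_Times_iff simp del: param_cod.simps)
  have b_mem: "snd (l2_nth (snd h) n) \<in> param_cod G (Suc (2 * n + 1))" if "h \<in> N" for h n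
    using hN[OF that] by (auto simp: cmv_sum_def mem_Times_iff simp del: param_cod.simps)
  have zero: "\<forall>h\<in>N. fst (l2_nth (snd h) n) = 0 \<and> fst (l2_nth (g h) n) = 0 \<and> l2_nth (snd h) n = 0 \<and> l2_nth (g h) n = 0" for n
  proof (induction n)
    have step: "\<forall>h\<in>N. l2_nth (snd h) n = 0 \<and> l2_nth (g h) n = 0"
      if "\<forall>h\<in>N. fst (l2_nth (snd h) n) = 0 \<and> fst (l2_nth (g h) n) = 0" for n
    proof
      fix h assume h: "h \<in> N"
      define b where "b = snd (l2_nth (snd h) n)"
      have hb: "l2_nth (snd h) n = (0, b)" using that h by (simp add: b_def prod_eq_iff)
      have "fst (l2_nth (g h) n) = 0" using that h by blast
      then have "fst (param_rotation G (2 * n + 1) (0, b)) = 0"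
        unfolding g_nth[OF h] hb .
      then have "b = 0"
        using param_rotation_fst_zero[OF G, of b "2 * n + 1"] b_mem[OF h, of n, folded b_def] by blast
      then show "l2_nth (snd h) n = 0 \<and> l2_nth (g h) n = 0"
        using hb g_nth[OF h, of n] param_rotation_zero[OF G] by (simp add: zero_prod_def)
    qed
    {
      case 0
      have c0: "fst (l2_nth (g h) 0) = 0" if h: "h \<in> N" for h
      proof -
        have "fst (param_rotation G 0 (0, fst (l2_nth (g h) 0))) = fst (?U h)"
          using U_eq[OF h] R_nth[OF h, of 0] fst0[OF h] by (simp add: regroup_nth)
        also have "\<dots> = 0" by (rule fst0[OF NU[OF h]])
        finally show ?thesis
          using param_rotation_fst_zero[OF G, of _ 0] c_mem[OF h, of 0] by simp
      qed
      have "fst (l2_nth (snd h) 0) = 0" if "h \<in> N" for h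
      proof -
        obtain k where k: "k \<in> N" "h = ?U k" using NV[OF \<open>h \<in> N\<close>] by blast
        have "fst (l2_nth (snd h) 0) = snd (param_rotation G 0 (0, fst (l2_nth (g k) 0)))"
          using U_eq[OF k(1)] R_nth[OF k(1), of 0] fst0[OF k(1)] by (simp add: regroup_nth ungroup_nth k(2))
        then show ?thesis using c0[OF k(1)] param_rotation_zero[OF G, of 0] by simp
      qed
      then show ?case using c0 step[of 0] by blast
    next
      case (Suc n)
      have IH: "l2_nth (snd h) n = 0" "l2_nth (g h) n = 0" if "h \<in> N" for h
        using Suc that by auto
      have Uk: "l2_nth (snd (?U k)) n = (snd (l2_nth (Abs_l2 (\<lambda>n. param_rotation G (2 * n) (l2_nth (regroup (fst k, g k)) n))) n),
          fst (param_rotation G (2 * Suc n) (0, fst (l2_nth (g k) (Suc n)))))"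
        and Uk': "fst (l2_nth (snd (?U k)) (Suc n)) = snd (param_rotation G (2 * Suc n) (0, fst (l2_nth (g k) (Suc n))))"
        if "k \<in> N" for k
        using U_eq[OF that] R_nth[OF that, of "Suc n"] IH[OF that]
        by (simp_all add: regroup_nth ungroup_nth)
      have c0: "fst (l2_nth (g h) (Suc n)) = 0" if h: "h \<in> N" for h
      proof -
        have "fst (param_rotation G (2 * Suc n) (0, fst (l2_nth (g h) (Suc n)))) = 0"
          using Uk[OF h] IH(1)[OF NU[OF h]] by (simp add: zero_prod_def)
        then show ?thesis
          using param_rotation_fst_zero[OF G, of _ "2 * Suc n"] c_mem[OF h, of "Suc n"] by blast
      qed
      have "fst (l2_nth (snd h) (Suc n)) = 0" if "h \<in> N" for h
      proof -
        obtain k where k: "k \<in> N" "h = ?U k" using NV[OF \<open>h \<in> N\<close>] by blast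
        show ?thesis using Uk'[OF k(1)] c0[OF k(1)] param_rotation_zero[OF G, of "2 * Suc n"] k(2) by simp
      qed
      then show ?case using c0 step[of "Suc n"] by blast
    }
  qed
  have "h \<in> N" using h orth by (simp add: N_def)
  then have "snd h = 0" using zero by (intro l2_eqI) (simp add: zero_l2.rep_eq)
  then show ?thesis using fst0[OF \<open>h \<in> N\<close>] by (simp add: prod_eq_iff)
qed

text \<open>
  The block \<open>n\<close> of \<open>v\<close> is \<open>z\<^sup>n\<^sup>+\<^sup>1 (X\<^sub>2\<^sub>n\<^sub>+\<^sub>1, z Y\<^sub>2\<^sub>n\<^sub>+\<^sub>2)\<close>. By the recursion \<open>V\<close> maps it to \<open>z\<^sup>n\<^sup>+\<^sup>1 (Y\<^sub>2\<^sub>n\<^sub>+\<^sub>1, X\<^sub>2\<^sub>n\<^sub>+\<^sub>2)\<close>,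
  and \<open>L\<close> maps the regrouped pair \<open>z\<^sup>n (X\<^sub>2\<^sub>n, z Y\<^sub>2\<^sub>n\<^sub>+\<^sub>1)\<close> to \<open>z\<^sup>n (Y\<^sub>2\<^sub>n, X\<^sub>2\<^sub>n\<^sub>+\<^sub>1)\<close>; a further factor \<open>z\<close> reproduces \<open>v\<close> up to
  the first component. Conservation of norms gives
  \<open>|X\<^sub>n\<^sub>+\<^sub>1|\<^sup>2 - |z|\<^sup>2 |Y\<^sub>n\<^sub>+\<^sub>1|\<^sup>2 = |X\<^sub>n|\<^sup>2 - |Y\<^sub>n|\<^sup>2\<close>, so that \<open>|X\<^sub>n|\<^sup>2\<close> grows at most like \<open>(4/3)\<^sup>n\<close>, while the weights decay like
  \<open>|z|\<^sup>2\<^sup>n \<le> 4\<^sup>-\<^sup>n\<close>. The squared norm of the block \<open>n\<close> is therefore of order \<open>(4/9)\<^sup>n\<close>.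
\<close>

lemma cmv_resolvent_vector:
  fixes X Y :: "nat \<Rightarrow> 'm" and z :: complex
  assumes z: "cmod z \<le> 1 / 2"
    and X: "\<And>n. X n \<in> param_dom G n" and Y: "\<And>n. Y n \<in> param_cod G n"
    and rec: "\<And>n. param_rotation G n (X n, z *\<^sub>C Y (Suc n)) = (Y n, X (Suc n))"
    and YX: "\<And>n. norm (Y n) \<le> norm (X n)"
  obtains v where "v \<in> cmv_space" "fst v = X 0" "v = (X 0 - z *\<^sub>C Y 0, 0) + z *\<^sub>C cmv G v"
proof -
  define h where "h = Abs_l2 (\<lambda>n. (z ^ (n + 1) *\<^sub>C X (2 * n + 1), z ^ (n + 2) *\<^sub>C Y (2 * n + 2)))"
  have z2: "(cmod z)\<^sup>2 \<le> 1 / 4"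
    using power_mono[OF z norm_ge_zero, of 2] by (simp add: power2_eq_square)
  have growth: "(norm (X (Suc n)))\<^sup>2 \<le> 4 / 3 * (norm (X n))\<^sup>2" for n
  proof -
    have "norm (param_rotation G n (X n, z *\<^sub>C Y (Suc n))) = norm (X n, z *\<^sub>C Y (Suc n))"
      by (rule unitary_between_norm[OF unitary_param_rotation[OF G]])
        (use X Y csubspaceD(4)[OF closed_csubspaceD(1)[OF param_closed(2)[OF G]]]
          in \<open>auto simp del: param_cod.simps\<close>)
    then have "(norm (Y n))\<^sup>2 + (norm (X (Suc n)))\<^sup>2 = (norm (X n))\<^sup>2 + (cmod z)\<^sup>2 * (norm (Y (Suc n)))\<^sup>2"
      unfolding rec by (metis norm_Pair_square norm_scaleC power_mult_distrib)
    moreover have "(cmod z)\<^sup>2 * (norm (Y (Suc n)))\<^sup>2 \<le> 1 / 4 * (norm (X (Suc n)))\<^sup>2"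
      by (intro mult_mono z2 power_mono YX) auto
    ultimately show ?thesis using zero_le_power2[of "norm (Y n)"] by argo
  qed
  have Xn: "(norm (X n))\<^sup>2 \<le> (4 / 3) ^ n * (norm (X 0))\<^sup>2" for n
  proof (induction n)
    case (Suc n)
    then show ?case using growth[of n] by simp
  qed simp
  have sm: "summable (\<lambda>n. (norm (z ^ (n + 1) *\<^sub>C X (2 * n + 1), z ^ (n + 2) *\<^sub>C Y (2 * n + 2)))\<^sup>2)"
  proof (rule summable_comparison_test')
    show "summable (\<lambda>n. (4 / 9) ^ n * (4 * (norm (X 0))\<^sup>2) :: real)"
      by (intro summable_mult2 summable_geometric) simp
    fix n :: nat
    have zp: "(cmod z ^ (n + 1))\<^sup>2 \<le> (1 / 4) ^ n" "(cmod z ^ (n + 2))\<^sup>2 \<le> (1 / 4) ^ n"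
    proof -
      have *: "(cmod z ^ k)\<^sup>2 \<le> (1 / 4) ^ n" if "n \<le> k" for k
      proof -
        have "(cmod z ^ k)\<^sup>2 = ((cmod z)\<^sup>2) ^ k" by (simp add: power_mult[symmetric] mult.commute)
        also have "\<dots> \<le> (1 / 4) ^ k" by (rule power_mono[OF z2]) simp
        also have "\<dots> \<le> (1 / 4) ^ n" by (rule power_decreasing[OF that]) auto
        finally show ?thesis .
      qed
      show "(cmod z ^ (n + 1))\<^sup>2 \<le> (1 / 4) ^ n" "(cmod z ^ (n + 2))\<^sup>2 \<le> (1 / 4) ^ n" by (rule *, simp)+
    qed
    define Q where "Q = (16 / 9) ^ n * (norm (X 0))\<^sup>2"
    have Q: "0 \<le> Q" by (simp add: Q_def)
    have e: "(4 / 3 :: real) ^ (2 * n) = (16 / 9) ^ n" by (simp add: power_mult power2_eq_square)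
    then have eQ: "(4 / 3) ^ (2 * n + 1) * (norm (X 0))\<^sup>2 = 4 / 3 * Q"
      "(4 / 3) ^ (2 * n + 2) * (norm (X 0))\<^sup>2 = 16 / 9 * Q"
      by (simp_all add: Q_def)
    have X1: "(norm (X (2 * n + 1)))\<^sup>2 \<le> 2 * Q"
      using Xn[of "2 * n + 1"] Q unfolding eQ by linarith
    have "(norm (Y (2 * n + 2)))\<^sup>2 \<le> (norm (X (2 * n + 2)))\<^sup>2"
      by (intro power_mono YX) simp
    then have Y1: "(norm (Y (2 * n + 2)))\<^sup>2 \<le> 2 * Q"
      using Xn[of "2 * n + 2"] Q unfolding eQ by linarith
    have "(cmod z ^ (n + 1))\<^sup>2 * (norm (X (2 * n + 1)))\<^sup>2 + (cmod z ^ (n + 2))\<^sup>2 * (norm (Y (2 * n + 2)))\<^sup>2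
        \<le> (1 / 4) ^ n * (2 * Q) + (1 / 4) ^ n * (2 * Q)"
      by (intro add_mono mult_mono zp X1 Y1) auto
    also have "\<dots> = ((1 / 4) ^ n * (16 / 9) ^ n) * (4 * (norm (X 0))\<^sup>2)" by (simp add: Q_def)
    also have "((1 / 4) ^ n * (16 / 9) ^ n :: real) = (4 / 9) ^ n"
      by (simp add: power_mult_distrib[symmetric])
    finally show "norm ((norm (z ^ (n + 1) *\<^sub>C X (2 * n + 1), z ^ (n + 2) *\<^sub>C Y (2 * n + 2)))\<^sup>2)
        \<le> (4 / 9) ^ n * (4 * (norm (X 0))\<^sup>2)"
      by (simp add: norm_Pair_square norm_scaleC norm_power power_mult_distrib norm_mult)
  qed
  have h_nth: "l2_nth h n = z ^ (n + 1) *\<^sub>C (X (2 * n + 1), z *\<^sub>C Y (2 * n + 2))" for n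
    unfolding h_def l2_nth_Abs[OF sm] by (simp add: scaleC_prod_def scaleC_scaleC mult.commute)
  have hm: "h \<in> cmv_sum G"
    unfolding cmv_sum_def
  proof (intro CollectI allI)
    fix n
    have "X (2 * n + 1) \<in> param_dom G (Suc (2 * n))" "Y (2 * n + 2) \<in> param_cod G (Suc (2 * n + 1))"
      using X[of "2 * n + 1"] Y[of "2 * n + 2"] by simp_all
    then show "l2_nth h n \<in> param_dom G (Suc (2 * n)) \<times> param_cod G (Suc (2 * n + 1))"
      unfolding h_nth
      using csubspaceD(4)[OF closed_csubspaceD(1)[OF param_closed(1)[OF G]]]
        csubspaceD(4)[OF closed_csubspaceD(1)[OF param_closed(2)[OF G]]]
      by (simp add: scaleC_prod_def del: param_dom.simps param_cod.simps)
  qed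
  define g where "g = cmv_V G h"
  have g_nth: "l2_nth g n = z ^ (n + 1) *\<^sub>C (Y (2 * n + 1), X (2 * n + 2))" for n
    unfolding g_def cmv_V_nth[OF G hm] h_nth param_rotation_linear[OF G]
    using rec[of "2 * n + 1"] by (simp add: numeral_2_eq_2)
  have gm: "(X 0, g) \<in> cmv_space'"
    unfolding g_def using unitary_betweenD(4)[OF unitary_cmv_V[OF G] hm] by simp
  have blk: "l2_nth (Abs_l2 (\<lambda>n. param_rotation G (2 * n) (l2_nth (regroup (X 0, g)) n))) n
      = z ^ n *\<^sub>C (Y (2 * n), X (2 * n + 1))" for n
  proof -
    have "l2_nth (Abs_l2 (\<lambda>n. param_rotation G (2 * n) (l2_nth (regroup (X 0, g)) n))) n
        = param_rotation G (2 * n) (l2_nth (regroup (X 0, g)) n)"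
      by (rule blockwise_unitary(1)[OF unitary_param_rotation[OF G] _ cmv_L_eq(2)[OF G gm]])
        (intro closed_csubspace_Times param_closed[OF G])
    also have "l2_nth (regroup (X 0, g)) n = z ^ n *\<^sub>C (X (2 * n), z *\<^sub>C Y (2 * n + 1))"
      by (cases n) (simp_all add: regroup_nth g_nth scaleC_prod_def scaleC_scaleC mult.commute numeral_2_eq_2)
    also have "param_rotation G (2 * n) \<dots> = z ^ n *\<^sub>C (Y (2 * n), X (2 * n + 1))"
      unfolding param_rotation_linear[OF G] using rec[of "2 * n"] by simp
    finally show ?thesis .
  qed
  have "cmv G (X 0, h) = cmv_L G (X 0, g)" by (simp add: cmv_def g_def)
  also have "\<dots> = ungroup (Abs_l2 (\<lambda>n. param_rotation G (2 * n) (l2_nth (regroup (X 0, g)) n)))"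
    by (rule cmv_L_eq(1)[OF G gm])
  finally have U: "fst (cmv G (X 0, h)) = Y 0"
    "\<And>n. l2_nth (snd (cmv G (X 0, h))) n = (z ^ n *\<^sub>C X (2 * n + 1), z ^ (n + 1) *\<^sub>C Y (2 * n + 2))"
    by (simp_all add: ungroup_nth blk scaleC_prod_def)
  have "h = z *\<^sub>C snd (cmv G (X 0, h))"
    by (rule l2_eqI) (simp add: scaleC_l2.rep_eq U h_nth scaleC_prod_def scaleC_scaleC mult.commute)
  then have "(X 0, h) = (X 0 - z *\<^sub>C Y 0, 0) + z *\<^sub>C cmv G (X 0, h)"
    using U(1) by (simp add: prod_eq_iff scaleC_prod_def)
  then show thesis using hm by (intro that[of "(X 0, h)"]) auto
qed

text \<open>Such a vector is the resolvent applied to \<open>(X\<^sub>0 - z Y\<^sub>0, 0)\<close>, hence given by a geometric series.\<close>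

lemma cmv_resolvent_series:
  assumes z: "cmod z \<le> 1 / 2" and v: "v \<in> cmv_space" "v = (m, 0) + z *\<^sub>C cmv G v"
  shows "(\<lambda>k. z ^ k * cinner ((cmv G ^^ k) (m, 0)) (y, 0)) sums cinner (fst v) y"
proof -
  let ?U = "cmv G" and ?H = cmv_space
  note sH = csubspaceD[OF closed_csubspaceD(1)[OF closed_csubspace_cmv(1)]]
  have m: "(m, 0) \<in> ?H" using csubspaceD(1)[OF closed_csubspaceD(1)[OF closed_csubspace_cmv_sum(1)[OF G]]] by auto
  note P = unitary_funpow[OF unitary_cmv closed_csubspaceD(1)[OF closed_csubspace_cmv(1)]]
  have step: "(?U ^^ k) v = (?U ^^ k) (m, 0) + z *\<^sub>C (?U ^^ Suc k) v" for k
  proof -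
    have Uv: "?U v \<in> ?H" by (rule unitary_betweenD(4)[OF unitary_cmv v(1)])
    have "(?U ^^ k) v = (?U ^^ k) ((m, 0) + z *\<^sub>C ?U v)" using v(2) by simp
    also have "\<dots> = (?U ^^ k) (m, 0) + z *\<^sub>C (?U ^^ k) (?U v)"
      using unitary_betweenD(1)[OF P m sH(4)[OF Uv]] unitary_betweenD(2)[OF P Uv] by simp
    also have "(?U ^^ k) (?U v) = (?U ^^ Suc k) v" by (simp add: funpow_swap1)
    finally show ?thesis .
  qed
  have part: "cinner v w = (\<Sum>k<n. z ^ k * cinner ((?U ^^ k) (m, 0)) w) + z ^ n * cinner ((?U ^^ n) v) w" for n w
  proof (induction n)
    case (Suc n)
    then show ?case unfolding step[of n] by (simp add: cinner_simps algebra_simps del: funpow.simps)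
  qed simp
  have "(\<lambda>n. z ^ n * cinner ((?U ^^ n) v) (y, 0)) \<longlonglongrightarrow> 0"
  proof (rule Lim_null_comparison)
    show "(\<lambda>n. cmod z ^ n * (norm v * norm (y, 0 :: ('m \<times> 'm) l2))) \<longlonglongrightarrow> 0"
      using z by (intro tendsto_mult_left_zero LIMSEQ_power_zero) simp
    show "\<forall>\<^sub>F n in sequentially. norm (z ^ n * cinner ((?U ^^ n) v) (y, 0)) \<le> cmod z ^ n * (norm v * norm (y, 0 :: ('m \<times> 'm) l2))"
      using cinner_Cauchy_Schwarz[of "(?U ^^ _) v" "(y, 0)"] unitary_between_norm[OF P v(1)]
      by (intro always_eventually allI) (simp add: norm_mult norm_power mult_left_mono)
  qed
  then have "(\<lambda>n. cinner v (y, 0) - z ^ n * cinner ((?U ^^ n) v) (y, 0)) \<longlonglongrightarrow> cinner v (y, 0) - 0"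
    by (intro tendsto_diff tendsto_const)
  moreover have "cinner v (y, 0) - z ^ n * cinner ((?U ^^ n) v) (y, 0)
      = (\<Sum>k<n. z ^ k * cinner ((?U ^^ k) (m, 0)) (y, 0))" for n
    using part[of "(y, 0)" n] by simp
  moreover have "cinner v (y, 0) = cinner (fst v) y" by (simp add: cinner_prod_def)
  ultimately show ?thesis by (simp add: sums_def)
qed

end

section \<open>Holomorphic operator functions\<close>

lemma holomorphic_op_iff:
  fixes f :: "complex \<Rightarrow> 'a::complex_normed_vector"
  assumes S: "open S"
  shows "holomorphic_op f S \<longleftrightarrow>
    (\<forall>z\<in>S. \<exists>D. ((\<lambda>w. inverse (w - z) *\<^sub>C (f w - f z)) \<longlongrightarrow> D) (at z))"
proof -
  have "(f has_derivative (\<lambda>h. h *\<^sub>C D)) (at z within S)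
      \<longleftrightarrow> ((\<lambda>w. inverse (w - z) *\<^sub>C (f w - f z)) \<longlongrightarrow> D) (at z)" if z: "z \<in> S" for z D
  proof -
    have "(f has_derivative (\<lambda>h. h *\<^sub>C D)) (at z within S)
        \<longleftrightarrow> ((\<lambda>w. norm ((f w - f z) - (w - z) *\<^sub>C D) / norm (w - z)) \<longlongrightarrow> 0) (at z)"
      unfolding at_within_open[OF z S] has_derivative_iff_norm
      using scaleC.bounded_linear_left by blast
    also have "\<dots> \<longleftrightarrow> ((\<lambda>w. norm (inverse (w - z) *\<^sub>C (f w - f z) - D)) \<longlongrightarrow> 0) (at z)"
    proof (rule tendsto_cong, rule eventually_at_filter[THEN iffD2], rule always_eventually, intro allI impI)
      fix w assume w: "w \<noteq> z"
      have "inverse (w - z) *\<^sub>C (f w - f z) - D = inverse (w - z) *\<^sub>C ((f w - f z) - (w - z) *\<^sub>C D)"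
        using w by (simp add: scaleC.diff_right scaleC_scaleC)
      then show "norm ((f w - f z) - (w - z) *\<^sub>C D) / norm (w - z) = norm (inverse (w - z) *\<^sub>C (f w - f z) - D)"
        by (simp only: norm_scaleC norm_inverse divide_inverse mult.commute)
    qed
    also have "\<dots> \<longleftrightarrow> ((\<lambda>w. inverse (w - z) *\<^sub>C (f w - f z)) \<longlongrightarrow> D) (at z)"
      unfolding tendsto_norm_zero_iff by (rule LIM_zero_iff)
    finally show ?thesis .
  qed
  then show ?thesis unfolding holomorphic_op_def by blast
qed

lemma difference_quotient_imp_continuous:
  assumes "((\<lambda>w. inverse (w - z) *\<^sub>C (f w - f z)) \<longlongrightarrow> D) (at (z::complex))"
  shows "(f \<longlongrightarrow> f z) (at z)"
proof -
  have "((\<lambda>w. (w - z) *\<^sub>C inverse (w - z) *\<^sub>C (f w - f z)) \<longlongrightarrow> (z - z) *\<^sub>C D) (at z)"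
    by (intro scaleC.tendsto assms tendsto_intros)
  also have "?this \<longleftrightarrow> ((\<lambda>w. f w - f z) \<longlongrightarrow> 0) (at z)"
    by (simp, rule tendsto_cong) (auto simp: eventually_at_filter scaleC_scaleC)
  finally show ?thesis by (simp add: LIM_zero_iff)
qed

lemma holomorphic_op_continuous:
  assumes "open S" "holomorphic_op f S" "z \<in> S"
  shows "(f \<longlongrightarrow> f z) (at z)"
  using assms difference_quotient_imp_continuous unfolding holomorphic_op_iff[OF assms(1)] by blast

lemma holomorphic_op_cong:
  assumes "open S" "holomorphic_op f S" "\<And>z. z \<in> S \<Longrightarrow> g z = f z"
  shows "holomorphic_op g S"
  unfolding holomorphic_op_def
proof
  fix z assume z: "z \<in> S"
  then obtain D where "(f has_derivative (\<lambda>h. h *\<^sub>C D)) (at z within S)"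
    using assms(2) unfolding holomorphic_op_def by blast
  then have "(g has_derivative (\<lambda>h. h *\<^sub>C D)) (at z within S)"
    by (rule has_derivative_transform[OF z, rotated]) (use assms(3) in auto)
  then show "\<exists>D. (g has_derivative (\<lambda>h. h *\<^sub>C D)) (at z within S)" by blast
qed

lemma holomorphic_op_const: "open S \<Longrightarrow> holomorphic_op (\<lambda>z. T) S"
  unfolding holomorphic_op_iff by (auto intro!: exI[of _ 0])

lemma holomorphic_op_diff:
  assumes "open S" "holomorphic_op f S" "holomorphic_op g S"
  shows "holomorphic_op (\<lambda>z. f z - g z) S"
  unfolding holomorphic_op_iff[OF assms(1)]
proof
  fix z assume "z \<in> S"
  then obtain D E where "((\<lambda>w. inverse (w - z) *\<^sub>C (f w - f z)) \<longlongrightarrow> D) (at z)"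
      "((\<lambda>w. inverse (w - z) *\<^sub>C (g w - g z)) \<longlongrightarrow> E) (at z)"
    using assms(2,3) unfolding holomorphic_op_iff[OF assms(1)] by blast
  from tendsto_diff[OF this]
  have "((\<lambda>w. inverse (w - z) *\<^sub>C ((f w - g w) - (f z - g z))) \<longlongrightarrow> D - E) (at z)"
    by (rule tendsto_cong[THEN iffD1, rotated]) (auto simp: scaleC.diff_right)
  then show "\<exists>D. ((\<lambda>w. inverse (w - z) *\<^sub>C ((f w - g w) - (f z - g z))) \<longlongrightarrow> D) (at z)" by blast
qed

lemma holomorphic_op_compose:
  assumes S: "open S" and f: "holomorphic_op f S" and g: "holomorphic_op g S"
    and c: "\<And>z. z \<in> S \<Longrightarrow> cbl (f z)"
  shows "holomorphic_op (\<lambda>z. f z o\<^sub>L g z) S"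
  unfolding holomorphic_op_iff[OF S]
proof
  fix z assume z: "z \<in> S"
  then obtain D E where D: "((\<lambda>w. inverse (w - z) *\<^sub>C (f w - f z)) \<longlongrightarrow> D) (at z)"
      and E: "((\<lambda>w. inverse (w - z) *\<^sub>C (g w - g z)) \<longlongrightarrow> E) (at z)"
    using f g unfolding holomorphic_op_iff[OF S] by blast
  have "((\<lambda>w. ((inverse (w - z) *\<^sub>C (f w - f z)) o\<^sub>L g w) + (f z o\<^sub>L (inverse (w - z) *\<^sub>C (g w - g z))))
      \<longlongrightarrow> (D o\<^sub>L g z) + (f z o\<^sub>L E)) (at z)"
    by (intro tendsto_add blinfun_compose_tendsto tendsto_const D E holomorphic_op_continuous[OF S g z])
  also have "(\<lambda>w. ((inverse (w - z) *\<^sub>C (f w - f z)) o\<^sub>L g w) + (f z o\<^sub>L (inverse (w - z) *\<^sub>C (g w - g z))))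
      = (\<lambda>w. inverse (w - z) *\<^sub>C ((f w o\<^sub>L g w) - (f z o\<^sub>L g z)))"
    using c[OF z] by (auto intro!: blinfun_eqI simp: fun_eq_iff scaleC_blinfun.rep_eq blinfun.diff_left
        blinfun.add_left clinearD blinfun.diff_right scaleC.diff_right)
  finally show "\<exists>D. ((\<lambda>w. inverse (w - z) *\<^sub>C ((f w o\<^sub>L g w) - (f z o\<^sub>L g z))) \<longlongrightarrow> D) (at z)" by blast
qed

lemma norm_compose3_le:
  "norm (R o\<^sub>L S o\<^sub>L T) \<le> norm R * norm S * norm T"
  by (meson norm_blinfun_compose norm_ge_zero mult_right_mono order_trans)

text \<open>Inversion preserves holomorphy, by \<open>R\<^sub>w - R\<^sub>z = - R\<^sub>w (S\<^sub>w - S\<^sub>z) R\<^sub>z\<close>.\<close>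

lemma holomorphic_op_inverse:
  assumes U: "open U" and A: "closed_csubspace A"
    and S: "holomorphic_op S U" and SA: "\<And>z. z \<in> U \<Longrightarrow> S z \<in> bop A A"
    and R: "\<And>z. z \<in> U \<Longrightarrow> is_inverse_on A (S z) (R z)" and K: "\<And>z. z \<in> U \<Longrightarrow> norm (R z) \<le> K"
  shows "holomorphic_op R U"
  unfolding holomorphic_op_iff[OF U]
proof
  fix z assume z: "z \<in> U"
  obtain D where D: "((\<lambda>w. inverse (w - z) *\<^sub>C (S w - S z)) \<longlongrightarrow> D) (at z)"
    using S z unfolding holomorphic_op_iff[OF U] by blast
  have ev: "\<forall>\<^sub>F w in at z. w \<in> U"
    using eventually_at_in_open'[OF U z] .
  have diff: "R w - R z = - (R w o\<^sub>L (S w - S z) o\<^sub>L R z)" if w: "w \<in> U" for w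
  proof -
    note rw = R[OF w, unfolded is_inverse_on_def] and rz = R[OF z, unfolded is_inverse_on_def]
    have 1: "R w o\<^sub>L S w o\<^sub>L R z = R z" using rw rz bop_proj_compose[OF A A, of "R z"] by simp
    have 2: "R w o\<^sub>L S z o\<^sub>L R z = R w"
      using rw rz bop_proj_compose[OF A A, of "R w"] by (simp add: blinfun_compose_assoc)
    have "R w o\<^sub>L (S w - S z) o\<^sub>L R z = (R w o\<^sub>L S w o\<^sub>L R z) - (R w o\<^sub>L S z o\<^sub>L R z)"
      by (auto intro!: blinfun_eqI simp: blinfun.diff_left blinfun.diff_right)
    then show ?thesis unfolding 1 2 by simp
  qed
  have cont: "(R \<longlongrightarrow> R z) (at z)"
  proof (rule LIM_zero_cancel, rule Lim_null_comparison)
    show "\<forall>\<^sub>F w in at z. norm (R w - R z) \<le> K * norm (S w - S z) * K"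
      using ev
    proof eventually_elim
      case (elim w)
      have "norm (R w - R z) \<le> norm (R w) * norm (S w - S z) * norm (R z)"
        unfolding diff[OF elim] using norm_compose3_le[of "R w" "S w - S z" "R z"] by simp
      also have "\<dots> \<le> K * norm (S w - S z) * K"
        using order_trans[OF norm_ge_zero K[OF z]] by (intro mult_mono K elim z mult_nonneg_nonneg) auto
      finally show ?case .
    qed
    have "((\<lambda>w. norm (S w - S z)) \<longlongrightarrow> 0) (at z)"
      using holomorphic_op_continuous[OF U S z] by (simp add: tendsto_norm_zero_iff LIM_zero_iff)
    then show "((\<lambda>w. K * norm (S w - S z) * K) \<longlongrightarrow> 0) (at z)"
      by (intro tendsto_mult_left_zero tendsto_mult_right_zero)
  qed
  have "((\<lambda>w. - (R w o\<^sub>L (inverse (w - z) *\<^sub>C (S w - S z)) o\<^sub>L R z)) \<longlongrightarrow> - (R z o\<^sub>L D o\<^sub>L R z)) (at z)"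
    by (intro tendsto_minus blinfun_compose_tendsto cont D tendsto_const)
  moreover have "\<forall>\<^sub>F w in at z. inverse (w - z) *\<^sub>C (R w - R z)
      = - (R w o\<^sub>L (inverse (w - z) *\<^sub>C (S w - S z)) o\<^sub>L R z)"
    using ev
  proof eventually_elim
    case (elim w)
    have "cbl (R w)" using R[OF elim] bopD(1) by (auto simp: is_inverse_on_def)
    then show ?case unfolding diff[OF elim] scaleC.minus_right
      by (auto intro!: blinfun_eqI simp: scaleC_blinfun.rep_eq clinearD blinfun.minus_left)
  qed
  ultimately have "((\<lambda>w. inverse (w - z) *\<^sub>C (R w - R z)) \<longlongrightarrow> - (R z o\<^sub>L D o\<^sub>L R z)) (at z)"
    by (simp cong: tendsto_cong)
  then show "\<exists>D. ((\<lambda>w. inverse (w - z) *\<^sub>C (R w - R z)) \<longlongrightarrow> D) (at z)" by blast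
qed

lemma holomorphic_op_weak:
  assumes U: "open U" and T: "holomorphic_op T U"
  shows "(\<lambda>z. cinner (blinfun_apply (T z) x) y) holomorphic_on U"
  unfolding holomorphic_on_def field_differentiable_def
proof
  fix z assume z: "z \<in> U"
  obtain D where D: "((\<lambda>w. inverse (w - z) *\<^sub>C (T w - T z)) \<longlongrightarrow> D) (at z)"
    using T z unfolding holomorphic_op_iff[OF U] by blast
  have "((\<lambda>w. cinner ((inverse (w - z) *\<^sub>C (T w - T z)) x) y) \<longlongrightarrow> cinner (D x) y) (at z)"
    by (intro cinner.tendsto blinfun.tendsto D tendsto_const)
  also have "(\<lambda>w. cinner ((inverse (w - z) *\<^sub>C (T w - T z)) x) y)
      = (\<lambda>w. (cinner (T w x) y - cinner (T z x) y) / (w - z))"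
    by (simp add: fun_eq_iff scaleC_blinfun.rep_eq blinfun.diff_left cinner_simps divide_inverse mult.commute)
  finally have "((\<lambda>z. cinner (T z x) y) has_field_derivative cinner (D x) y) (at z)"
    by (simp add: has_field_derivative_iff)
  then show "\<exists>f'. ((\<lambda>z. cinner (T z x) y) has_field_derivative f') (at z within U)"
    using has_field_derivative_at_within by blast
qed

text \<open>A holomorphic function is approximated by its tangent with an error that is quadratic and
  controlled by a bound of the function alone; hence this holds uniformly over families of functions.\<close>

lemma holomorphic_tangent_bound:
  assumes f: "f holomorphic_on ball z0 r" "\<And>z. z \<in> ball z0 r \<Longrightarrow> cmod (f z) \<le> B"
    and r: "0 < \<rho>" "\<rho> < r"
  shows "cmod (deriv f z0) \<le> B / \<rho>"
    "cmod (z - z0) < \<rho> / 2 \<Longrightarrow> cmod (f z - f z0 - (z - z0) * deriv f z0) \<le> 8 * B / \<rho>\<^sup>2 * (cmod (z - z0))\<^sup>2"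
proof -
  have C: "cmod ((deriv ^^ n) f u) \<le> fact n * B / s ^ n" if s: "0 < s" "cball u s \<subseteq> ball z0 r" for n u s
  proof (rule Cauchy_inequality)
    show "f holomorphic_on ball u s" "continuous_on (cball u s) f"
      using s(2) ball_subset_cball[of u s]
      by (meson holomorphic_on_subset[OF f(1)] holomorphic_on_imp_continuous_on subset_trans)+
    show "cmod (f x) \<le> B" if "cmod (u - x) = s" for x
      using s(2) that by (intro f(2)) (auto simp: dist_norm)
  qed (rule s)
  show "cmod (deriv f z0) \<le> B / \<rho>"
    using C[of \<rho> z0 1] r by (auto simp: subset_iff)
  assume z: "cmod (z - z0) < \<rho> / 2"
  have sub: "ball z0 (\<rho> / 2) \<subseteq> ball z0 r" using r by (intro subset_ball) auto
  have "cmod ((deriv ^^ 0) f z - (\<Sum>i\<le>1. (deriv ^^ i) f z0 * (z - z0) ^ i / fact i))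
      \<le> (8 * B / \<rho>\<^sup>2) * cmod (z - z0) ^ Suc 1 / fact 1"
  proof (rule complex_Taylor[where S = "ball z0 (\<rho> / 2)"])
    fix i x assume x: "x \<in> ball z0 (\<rho> / 2)"
    have "((deriv ^^ i) f has_field_derivative (deriv ^^ Suc i) f x) (at x)"
      using has_field_derivative_higher_deriv[OF f(1) open_ball] x sub by blast
    then show "((deriv ^^ i) f has_field_derivative (deriv ^^ Suc i) f x) (at x within ball z0 (\<rho> / 2))"
      by (rule has_field_derivative_at_within)
  next
    fix x assume x: "x \<in> ball z0 (\<rho> / 2)"
    have "cball x (\<rho> / 2) \<subseteq> ball z0 r"
    proof
      fix y assume "y \<in> cball x (\<rho> / 2)"
      then show "y \<in> ball z0 r" using x r dist_triangle[of z0 y x] by simp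
    qed
    then have "cmod ((deriv ^^ Suc 1) f x) \<le> fact (Suc 1) * B / (\<rho> / 2) ^ Suc 1"
      using r by (intro C) auto
    then show "cmod ((deriv ^^ Suc 1) f x) \<le> 8 * B / \<rho>\<^sup>2"
      by (simp add: power2_eq_square field_simps)
  qed (use z r in \<open>auto simp: dist_norm norm_minus_commute\<close>)
  then show "cmod (f z - f z0 - (z - z0) * deriv f z0) \<le> 8 * B / \<rho>\<^sup>2 * (cmod (z - z0))\<^sup>2"
    by (simp add: algebra_simps power2_eq_square)
qed

lemma sesquilinear_cinner: "cbl T \<Longrightarrow> sesquilinear (\<lambda>x y. cinner (T x) y)"
  by (simp add: sesquilinear_def clinearD cinner_simps)

lemma form_norm_le:
  fixes S :: "'a::chilbert \<Rightarrow>\<^sub>L 'a" and R :: "'b::chilbert \<Rightarrow>\<^sub>L 'b"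
  assumes "cbl S" "cbl R" "T \<in> bop (closure (range S)) (closure (range R))" "0 \<le> K"
    "\<And>x y. cmod (cinner (T (S x)) (R y)) \<le> K * norm (S x) * norm (R y)"
  shows "norm T \<le> K"
  by (rule bop_norm_le[OF csubspace_range csubspace_range])
    (use assms in auto)

text \<open>
  Weak holomorphy implies norm holomorphy: the derivatives of the scalar functions form again a
  dominated sesquilinear form, whose operator is the derivative because the tangent error
  is quadratic uniformly in \<open>x\<close> and \<open>y\<close>.
\<close>

lemma form_family_holomorphic:
  fixes S :: "'a::chilbert \<Rightarrow>\<^sub>L 'a" and R :: "'b::chilbert \<Rightarrow>\<^sub>L 'b"
  assumes S: "cbl S" and R: "cbl R"
    and q: "\<And>z. z \<in> ball 0 1 \<Longrightarrow> sesquilinear (q z)"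
    and hol: "\<And>x y. (\<lambda>z. q z x y) holomorphic_on ball 0 1"
    and M: "\<And>r. 0 < r \<Longrightarrow> r < 1 \<Longrightarrow> 0 \<le> M r"
    and b: "\<And>r z x y. 0 < r \<Longrightarrow> r < 1 \<Longrightarrow> z \<in> ball 0 r \<Longrightarrow> cmod (q z x y) \<le> M r * norm (S x) * norm (R y)"
  obtains T where "holomorphic_op T (ball 0 1)"
    "\<And>z. z \<in> ball 0 1 \<Longrightarrow> T z \<in> bop (closure (range S)) (closure (range R))"
    "\<And>z x y. z \<in> ball 0 1 \<Longrightarrow> cinner (blinfun_apply (T z) (S x)) (R y) = q z x y"
proof -
  have "\<exists>T. T \<in> bop (closure (range S)) (closure (range R)) \<and> (\<forall>x y. cinner (blinfun_apply T (S x)) (R y) = q z x y)"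
    if z: "z \<in> ball 0 1" for z
  proof -
    obtain r where r: "cmod z < r" "r < 1" using z dense[of "cmod z" 1] by auto
    then have "0 < r" using norm_ge_zero[of z] by linarith
    then obtain T where "T \<in> bop (closure (range S)) (closure (range R))" "\<And>x y. cinner (blinfun_apply T (S x)) (R y) = q z x y"
      using form_operator[OF S R M q[OF z], of r] b[of r z] r by (metis mem_ball_0)
    then show ?thesis by blast
  qed
  then obtain T where T: "\<And>z. z \<in> ball 0 1 \<Longrightarrow> T z \<in> bop (closure (range S)) (closure (range R))"
      "\<And>z x y. z \<in> ball 0 1 \<Longrightarrow> cinner (blinfun_apply (T z) (S x)) (R y) = q z x y"
    by metis
  have clS: "closed_csubspace (closure (range S))" and clR: "closed_csubspace (closure (range R))"
    using S R by (auto intro: closed_csubspace_closure csubspace_range)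
  have "holomorphic_op T (ball 0 1)"
    unfolding holomorphic_op_def
  proof
    fix z0 :: complex assume z0: "z0 \<in> ball 0 1"
    \<comment> \<open>The disk of radius \<open>d\<close> about \<open>z\<^sub>0\<close> lies in a smaller concentric disk, where a single bound holds.\<close>
    define d where "d = (1 - cmod z0) / 2"
    have d: "0 < d" "cmod z0 + d < 1" "0 < cmod z0 + d" using z0 norm_ge_zero[of z0] by (auto simp: d_def field_simps simp del: norm_ge_zero)
    define m where "m = M (cmod z0 + d)"
    have m: "0 \<le> m" unfolding m_def by (rule M[OF d(3,2)])
    have sub: "ball z0 d \<subseteq> ball 0 (cmod z0 + d)" "ball z0 d \<subseteq> ball 0 1"
    proof -
      show "ball z0 d \<subseteq> ball 0 (cmod z0 + d)"
        using norm_triangle_ineq2[of _ z0] by (auto simp: dist_norm norm_minus_commute) (smt (verit))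
      then show "ball z0 d \<subseteq> ball 0 1" using d by (auto simp: subset_iff) 
    qed
    define \<rho> where "\<rho> = d / 2"
    have \<rho>: "0 < \<rho>" "\<rho> < d" using d by (auto simp: \<rho>_def)
    have bb: "cmod (q z x y) \<le> m * norm (S x) * norm (R y)" if "z \<in> ball z0 d" for z x y
      unfolding m_def using that sub by (intro b d) auto
    have hb: "(\<lambda>z. q z x y) holomorphic_on ball z0 d" for x y
      by (rule holomorphic_on_subset[OF hol sub(2)])
    note tb = holomorphic_tangent_bound[OF hb bb \<rho>]
    have df: "(\<lambda>z. q z x y) field_differentiable at z0" for x y
      using hol holomorphic_on_imp_differentiable_at z0 by blast
    define q' where "q' x y = deriv (\<lambda>z. q z x y) z0" for x y
    have q'I: "q' x y = c" if "((\<lambda>z. q z x y) has_field_derivative c) (at z0)" for x y c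
      unfolding q'_def by (rule DERIV_imp_deriv[OF that])
    have q'D: "((\<lambda>z. q z x y) has_field_derivative q' x y) (at z0)" for x y
      unfolding q'_def using df field_differentiable_derivI by blast
    have ev: "\<forall>\<^sub>F z in nhds z0. z \<in> ball 0 1"
      using z0 eventually_nhds_in_open[OF open_ball] by blast
    have tr: "((\<lambda>z. q z x y) has_field_derivative c) (at z0)"
      if "((\<lambda>z. g z) has_field_derivative c) (at z0)" "\<And>z. z \<in> ball 0 1 \<Longrightarrow> q z x y = g z" for x y g c
      using that(1) by (rule DERIV_cong_ev[THEN iffD2, rotated -1])
        (use ev that(2) in \<open>auto elim: eventually_mono\<close>)
    have "sesquilinear q'"
      unfolding sesquilinear_def
    proof (intro conjI allI)
      fix x x' y y' c
      show "q' (x + x') y = q' x y + q' x' y"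
        by (rule q'I, rule tr[OF DERIV_add[OF q'D q'D]]) (use q in \<open>auto simp: sesquilinear_def\<close>)
      show "q' x (y + y') = q' x y + q' x y'"
        by (rule q'I, rule tr[OF DERIV_add[OF q'D q'D]]) (use q in \<open>auto simp: sesquilinear_def\<close>)
      show "q' (c *\<^sub>C x) y = c * q' x y"
        by (rule q'I, rule tr[OF DERIV_cmult[OF q'D]]) (use q in \<open>auto simp: sesquilinear_def\<close>)
      show "q' x (c *\<^sub>C y) = cnj c * q' x y"
        by (rule q'I, rule tr[OF DERIV_cmult[OF q'D]]) (use q in \<open>auto simp: sesquilinear_def\<close>)
    qed
    then obtain D where D: "D \<in> bop (closure (range S)) (closure (range R))"
        "\<And>x y. cinner (D (S x)) (R y) = q' x y"
      using form_operator[OF S R, of "m / \<rho>" q'] tb(1) m \<rho>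
      by (metis (no_types, lifting) q'_def divide_nonneg_pos times_divide_eq_left)
    have "(T has_derivative (\<lambda>h. h *\<^sub>C D)) (at z0 within ball 0 1)"
    proof (rule has_derivativeI_sandwich[where e = "\<rho> / 2" and H = "\<lambda>z. 8 * m / \<rho>\<^sup>2 * norm (z - z0)"])
      fix z assume z: "z \<in> ball 0 1" "z \<noteq> z0" "dist z z0 < \<rho> / 2"
      have "norm (T z - T z0 - (z - z0) *\<^sub>C D) \<le> 8 * m / \<rho>\<^sup>2 * (cmod (z - z0))\<^sup>2"
      proof (rule form_norm_le[OF S R])
        show "T z - T z0 - (z - z0) *\<^sub>C D \<in> bop (closure (range S)) (closure (range R))"
          by (intro bop_add bop_scaleC clS clR T D z z0)
        fix x y
        have "cinner ((T z - T z0 - (z - z0) *\<^sub>C D) (S x)) (R y) = q z x y - q z0 x y - (z - z0) * q' x y"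
          by (simp add: blinfun.diff_left scaleC_blinfun.rep_eq cinner_simps T(2)[OF z(1)]
              T(2)[OF z0] D(2))
        then show "cmod (cinner ((T z - T z0 - (z - z0) *\<^sub>C D) (S x)) (R y))
            \<le> 8 * m / \<rho>\<^sup>2 * (cmod (z - z0))\<^sup>2 * norm (S x) * norm (R y)"
          using tb(2)[of z x y] z(3) by (simp add: q'_def dist_norm mult_ac)
      qed (use m in simp)
      then show "norm (T z - T z0 - (z - z0) *\<^sub>C D) / norm (z - z0) \<le> 8 * m / \<rho>\<^sup>2 * norm (z - z0)"
        using z(2) by (simp add: divide_le_eq power2_eq_square mult.assoc)
    next
      show "((\<lambda>z. 8 * m / \<rho>\<^sup>2 * norm (z - z0)) \<longlongrightarrow> 0) (at z0 within ball 0 1)"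
        by (rule tendsto_eq_intros refl | simp)+
    qed (use \<rho> scaleC.bounded_linear_left in auto)
    then show "\<exists>D. (T has_derivative (\<lambda>h. h *\<^sub>C D)) (at z0 within ball 0 1)" by blast
  qed
  then show thesis by (rule that[OF _ T])
qed

section \<open>The Schwarz lemma\<close>

lemma schur_classD:
  assumes "\<Theta> \<in> schur_class A B" "z \<in> ball 0 1"
  shows "\<Theta> z \<in> bop A B" "norm (\<Theta> z) \<le> 1" "cmod (cinner (\<Theta> z x) y) \<le> norm x * norm y"
proof -
  show *: "\<Theta> z \<in> bop A B" "norm (\<Theta> z) \<le> 1" using assms by (auto simp: schur_class_def)
  have "cmod (cinner (\<Theta> z x) y) \<le> norm (\<Theta> z x) * norm y" by (rule cinner_Cauchy_Schwarz)
  also have "\<dots> \<le> (1 * norm x) * norm y"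
    using order_trans[OF norm_blinfun mult_right_mono[OF *(2) norm_ge_zero]] by (intro mult_right_mono) auto
  finally show "cmod (cinner (\<Theta> z x) y) \<le> norm x * norm y" by simp
qed

lemma schur_class_weak:
  "\<Theta> \<in> schur_class A B \<Longrightarrow> (\<lambda>z. cinner (\<Theta> z x) y) holomorphic_on ball 0 1"
  by (rule holomorphic_op_weak) (auto simp: schur_class_def)

text \<open>
  The strict inequality required by the Schwarz lemma is obtained by enlarging \<open>K\<close>.
\<close>

lemma schwarz_bound:
  assumes f: "f holomorphic_on ball 0 1" "f 0 = 0" and K: "\<And>z. z \<in> ball 0 1 \<Longrightarrow> cmod (f z) \<le> K"
    and z: "z \<in> ball 0 1"
  shows "cmod (f z) \<le> K * cmod z" "cmod (deriv f 0) \<le> K"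
proof -
  have K0: "0 \<le> K" using K[of 0] by (auto intro: order_trans[OF norm_ge_zero])
  have *: "cmod (f z) \<le> (K + e) * cmod z \<and> cmod (deriv f 0) \<le> K + e" if e: "e > 0" for e
  proof -
    let ?g = "\<lambda>z. f z / complex_of_real (K + e)"
    have Ke: "K + e > 0" using K0 e by simp
    have n: "cmod (complex_of_real (K + e)) = K + e" using Ke by (simp only: norm_of_real) 
    have h: "?g holomorphic_on ball 0 1" using f(1) Ke by (intro holomorphic_intros) auto
    have "cmod (?g z) < 1" if "cmod z < 1" for z
      using K[of z] that Ke e unfolding norm_divide n by (simp add: divide_less_eq)
    from Schwarz_Lemma(1,2)[OF h _ this, of z] z f(2)
    have "cmod (?g z) \<le> cmod z" "cmod (deriv ?g 0) \<le> 1" by auto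
    then have "cmod (f z) \<le> (K + e) * cmod z" "cmod (deriv ?g 0) \<le> 1"
      using Ke unfolding norm_divide n by (auto simp: divide_le_eq mult.commute)
    moreover have "deriv ?g 0 = deriv f 0 / complex_of_real (K + e)"
      using f(1) holomorphic_on_imp_differentiable_at[OF f(1), of 0] by (intro deriv_cdivide_right) auto
    ultimately show ?thesis using Ke by (simp only: norm_divide n) (simp add: divide_le_eq)
  qed
  have "cmod (f z) \<le> K * cmod z + e" if "e > 0" for e
  proof -
    have "e * cmod z \<le> e * 1" using z that by (intro mult_left_mono) auto
    then show ?thesis using *[OF that] by (simp add: distrib_right)
  qed
  then show "cmod (f z) \<le> K * cmod z" by (rule field_le_epsilon)
  show "cmod (deriv f 0) \<le> K" by (rule field_le_epsilon) (use * in blast)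
qed

text \<open>
  The scalar Schwarz lemma bounds the quotients \<open>\<langle>Z(z) x, y\<rangle> / z\<close>, completed by the derivative at 0, by
  \<open>|x| |y|\<close>; the operators of these forms make up \<open>\<Psi>\<close>.
\<close>

lemma schur_schwarz:
  assumes A: "closed_csubspace A" and B: "closed_csubspace B"
    and Z: "Z \<in> schur_class A B" "Z 0 = 0"
  obtains \<Psi> where "\<Psi> \<in> schur_class A B" "\<And>z. z \<in> ball 0 1 \<Longrightarrow> Z z = z *\<^sub>C \<Psi> z"
proof -
  define \<phi> where "\<phi> x y z = cinner (Z z x) y" for x y z
  define q where "q z x y = (if z = 0 then deriv (\<phi> x y) 0 else \<phi> x y z / z)" for z x y
  have hol: "\<phi> x y holomorphic_on ball 0 1" for x y
    unfolding \<phi>_def[abs_def] by (rule schur_class_weak[OF Z(1)])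
  have \<phi>0: "\<phi> x y 0 = 0" for x y by (simp add: \<phi>_def Z(2))
  \<comment> \<open>Projecting the arguments makes the forms those of operators from \<open>A\<close> to \<open>B\<close>.\<close>
  have \<phi>P: "\<phi> x y z = \<phi> (proj A x) (proj B y) z" if "z \<in> ball 0 1" for x y z
    unfolding \<phi>_def using schur_classD(1)[OF Z(1) that] bop_proj[OF A] proj_cinner[OF B]
      proj_ident[OF B bopD(2)] by metis
  have sb: "cmod (\<phi> x y z) \<le> norm (proj A x) * norm (proj B y)" if "z \<in> ball 0 1" for x y z
    using schur_classD(3)[OF Z(1) that] \<phi>P[OF that, of x y] by (simp add: \<phi>_def)
  have qb: "cmod (q z x y) \<le> 1 * norm (proj A x) * norm (proj B y)" if z: "z \<in> ball 0 1" for z x y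
    using schwarz_bound[OF hol \<phi>0 sb z, of x y] by (auto simp: q_def norm_divide divide_le_eq)
  have dI: "deriv (\<phi> x y) 0 = c" if "(\<phi> x y has_field_derivative c) (at 0)" for x y c
    by (rule DERIV_imp_deriv[OF that])
  have dD: "(\<phi> x y has_field_derivative deriv (\<phi> x y) 0) (at 0)" for x y
    using holomorphic_derivI[OF hol open_ball] by simp
  have tr: "(\<phi> x y has_field_derivative c) (at 0)"
    if "((\<lambda>z. g z) has_field_derivative c) (at 0)" "\<And>z. z \<in> ball 0 1 \<Longrightarrow> \<phi> x y z = g z" for x y g c
    using that(1) by (rule DERIV_cong_ev[THEN iffD2, rotated -1])
      (use eventually_nhds_in_open[OF open_ball, of 0 0 1] that(2) in \<open>auto elim: eventually_mono\<close>)
  have cZ: "cbl (Z z)" if "z \<in> ball 0 1" for z using schur_classD(1)[OF Z(1) that] bopD(1) by blast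
  have \<phi>l: "\<phi> (x + x') y z = \<phi> x y z + \<phi> x' y z" "\<phi> x (y + y') z = \<phi> x y z + \<phi> x y' z"
    "\<phi> (c *\<^sub>C x) y z = c * \<phi> x y z" "\<phi> x (c *\<^sub>C y) z = cnj c * \<phi> x y z" if "z \<in> ball 0 1" for x x' y y' c z
    using clinearD[OF cZ[OF that]] by (simp_all add: \<phi>_def cinner_simps)
  have d_lin: "deriv (\<phi> (x + x') y) 0 = deriv (\<phi> x y) 0 + deriv (\<phi> x' y) 0"
    "deriv (\<phi> x (y + y')) 0 = deriv (\<phi> x y) 0 + deriv (\<phi> x y') 0"
    "deriv (\<phi> (c *\<^sub>C x) y) 0 = c * deriv (\<phi> x y) 0"
    "deriv (\<phi> x (c *\<^sub>C y)) 0 = cnj c * deriv (\<phi> x y) 0" for x x' y y' c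
    by (rule dI, rule tr[OF DERIV_add[OF dD dD]], erule \<phi>l, rule dI, rule tr[OF DERIV_add[OF dD dD]], erule \<phi>l,
        rule dI, rule tr[OF DERIV_cmult[OF dD]], erule \<phi>l, rule dI, rule tr[OF DERIV_cmult[OF dD]], erule \<phi>l)
  obtain \<Psi> where \<Psi>: "holomorphic_op \<Psi> (ball 0 1)"
    "\<And>z. z \<in> ball 0 1 \<Longrightarrow> \<Psi> z \<in> bop (closure (range (proj A))) (closure (range (proj B)))"
    "\<And>z x y. z \<in> ball 0 1 \<Longrightarrow> cinner (blinfun_apply (\<Psi> z) (proj A x)) (proj B y) = q z x y"
  proof (rule form_family_holomorphic[OF cbl_proj[OF A] cbl_proj[OF B], of q "\<lambda>_. 1"])
    show "sesquilinear (q z)" if z: "z \<in> ball 0 1" for z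
      using \<phi>l[OF z] d_lin by (simp add: sesquilinear_def q_def add_divide_distrib)
    show "(\<lambda>z. q z x y) holomorphic_on ball 0 1" for x y
      by (rule pole_theorem_open_0[OF hol[of x y] open_ball, of 0]) (auto simp: q_def \<phi>0)
    show "cmod (q z x y) \<le> 1 * norm (proj A x) * norm (proj B y)" if "z \<in> ball 0 r" "r < 1" for r z x y
      using that by (intro qb) auto
  qed (auto intro: that)
  have cl: "closure (range (proj A)) = A" "closure (range (proj B)) = B"
    using proj_range closed_csubspaceD(3) A B by auto
  have n: "norm (\<Psi> z) \<le> 1" if z: "z \<in> ball 0 1" for z
    by (rule form_norm_le[OF cbl_proj[OF A] cbl_proj[OF B] \<Psi>(2)[OF z]])
      (use \<Psi>(3)[OF z] qb[OF z] in auto)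
  show thesis
  proof (rule that)
    show "\<Psi> \<in> schur_class A B"
      using \<Psi>(1,2) n unfolding cl by (auto simp: schur_class_def)
    show "Z z = z *\<^sub>C \<Psi> z" if z: "z \<in> ball 0 1" for z
    proof (rule blinfun_eqI, rule cinner_extI)
      fix x y
      note pz = \<Psi>(2)[OF z, unfolded cl]
      have "cinner (\<Psi> z x) y = cinner (\<Psi> z (proj A x)) (proj B y)"
        using bop_proj[OF A pz] proj_cinner[OF B] proj_ident[OF B bopD(2)[OF pz]] by metis
      then have "cinner ((z *\<^sub>C \<Psi> z) x) y = z * q z x y"
        using \<Psi>(3)[OF z] by (simp add: scaleC_blinfun.rep_eq cinner_simps)
      also have "\<dots> = \<phi> x y z" by (simp add: q_def \<phi>0)
      finally show "cinner (Z z x) y = cinner ((z *\<^sub>C \<Psi> z) x) y" by (simp add: \<phi>_def)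
    qed
  qed
qed

section \<open>Taylor coefficients of Schur functions\<close>

definition taylor_coeff :: "nat \<Rightarrow> (complex \<Rightarrow> complex) \<Rightarrow> complex" where
  "taylor_coeff n f = (deriv ^^ n) f 0 / fact n"

lemma taylor_coeff_circle_mean:
  assumes f: "f holomorphic_on ball 0 1" and r: "0 < r" "r < 1"
  shows "((\<lambda>t. f (circlepath 0 r t) / (circlepath 0 r t) ^ n) has_integral taylor_coeff n f) {0..1}"
proof -
  have vd: "vector_derivative (circlepath 0 r) (at t) = 2 * pi * \<i> * circlepath 0 r t" for t
    unfolding vector_derivative_circlepath by (simp add: circlepath)
  have "((\<lambda>u. f u / (u - 0) ^ Suc n) has_contour_integral (2 * pi * \<i> / fact n * (deriv ^^ n) f 0)) (circlepath 0 r)"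
  proof (rule Cauchy_has_contour_integral_higher_derivative_circlepath)
    show "continuous_on (cball 0 r) f"
      by (rule holomorphic_on_imp_continuous_on[OF holomorphic_on_subset[OF f]]) (use r in auto)
    show "f holomorphic_on ball 0 r"
      by (rule holomorphic_on_subset[OF f]) (use r in auto)
  qed (use r in auto)
  then have "((\<lambda>t. f (circlepath 0 r t) / (circlepath 0 r t) ^ Suc n * (2 * pi * \<i> * circlepath 0 r t))
      has_integral (2 * pi * \<i> * taylor_coeff n f)) {0..1}"
    unfolding has_contour_integral vd by (simp add: taylor_coeff_def)
  then have "((\<lambda>t. (1 / (2 * pi * \<i>)) * (f (circlepath 0 r t) / (circlepath 0 r t) ^ Suc n * (2 * pi * \<i> * circlepath 0 r t)))
      has_integral ((1 / (2 * pi * \<i>)) * (2 * pi * \<i> * taylor_coeff n f))) {0..1}"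
    by (rule has_integral_mult_right)
  moreover have "circlepath 0 r t \<noteq> 0" for t using r by (simp add: circlepath)
  ultimately show ?thesis by simp
qed

lemma taylor_coeff_cmult:
  assumes f: "f holomorphic_on ball 0 1"
  shows "taylor_coeff n (\<lambda>z. c * f z) = c * taylor_coeff n f"
proof -
  have "((\<lambda>t. c * (f (circlepath 0 (1/2) t) / (circlepath 0 (1/2) t) ^ n)) has_integral c * taylor_coeff n f) {0..1}"
    by (rule has_integral_mult_right[OF taylor_coeff_circle_mean[OF f]]) auto
  moreover have "((\<lambda>t. c * f (circlepath 0 (1/2) t) / (circlepath 0 (1/2) t) ^ n) has_integral taylor_coeff n (\<lambda>z. c * f z)) {0..1}"
    by (rule taylor_coeff_circle_mean) (use f in \<open>auto intro!: holomorphic_intros\<close>)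
  ultimately show ?thesis using has_integral_unique by (metis (no_types, lifting) times_divide_eq_right has_integral_cong)
qed

lemma circle_mean_bound:
  assumes p: "p holomorphic_on ball 0 1" and s: "s holomorphic_on ball 0 1" and r: "0 < r" "r < 1"
    and le: "\<And>\<zeta>. cmod \<zeta> = r \<Longrightarrow> Re (p \<zeta> + of_real c * (s \<zeta> / \<zeta> ^ n)) \<le> C"
  shows "Re (p 0 + of_real c * taylor_coeff n s) \<le> C"
proof -
  have i: "((\<lambda>t. p (circlepath 0 r t) + of_real c * (s (circlepath 0 r t) / (circlepath 0 r t) ^ n))
      has_integral (p 0 + of_real c * taylor_coeff n s)) {0..1}"
    using taylor_coeff_circle_mean[OF p r, of 0]
    by (intro has_integral_add has_integral_mult_right taylor_coeff_circle_mean s r)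
      (simp add: taylor_coeff_def)
  have "((\<lambda>t. Re (p (circlepath 0 r t) + of_real c * (s (circlepath 0 r t) / (circlepath 0 r t) ^ n)))
      has_integral Re (p 0 + of_real c * taylor_coeff n s)) {0..1}"
    using has_integral_linear[OF i bounded_linear_Re] by (simp add: o_def)
  moreover have "((\<lambda>t::real. C) has_integral C) {0..1}" using has_integral_const_real[of C 0 1] by simp
  ultimately show ?thesis
  proof (rule has_integral_le)
    fix t :: real
    have "cmod (circlepath 0 r t) = r" using r by (simp add: circlepath norm_mult)
    then show "Re (p (circlepath 0 r t) + of_real c * (s (circlepath 0 r t) / (circlepath 0 r t) ^ n)) \<le> C"
      by (rule le)
  qed
qed

lemma schur_class_contraction:
  "closed_csubspace A \<Longrightarrow> closed_csubspace B \<Longrightarrow> \<Theta> \<in> schur_class A B \<Longrightarrow> z \<in> ball 0 1 \<Longrightarrow> contraction A B (\<Theta> z)"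
  by (simp add: contraction_def schur_class_def)

text \<open>
  With \<open>\<Gamma> = \<Theta>(0)\<close>, average \<open>2 Re \<langle>\<Theta> f, h\<rangle> \<le> |f|\<^sup>2 + |h|\<^sup>2\<close> for \<open>f = x + \<zeta>\<^sup>n \<Gamma>\<^sup>* y\<close> and \<open>h = \<Gamma> x + \<zeta>\<^sup>n y\<close> over the
  circles \<open>|\<zeta>| = r\<close> and let \<open>r\<close> tend to 1. On the left there remains twice the sum of \<open>|\<Gamma> x|\<^sup>2\<close>,
  \<open>|\<Gamma>\<^sup>* y|\<^sup>2\<close> and the real part of the coefficient of order \<open>n\<close>.
  This is the contractivity of the compression of the Toeplitz operator of \<open>\<Theta>\<close> to the powers 0 and \<open>n\<close>, tested
  on suitable vectors.
\<close>

lemma taylor_coeff_Re_le: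
  assumes A: "closed_csubspace A" and B: "closed_csubspace B" and \<Theta>: "\<Theta> \<in> schur_class A B" and n: "n \<ge> 1"
  shows "2 * Re (taylor_coeff n (\<lambda>z. cinner (\<Theta> z x) y))
    \<le> (norm x)\<^sup>2 - (norm (\<Theta> 0 x))\<^sup>2 + ((norm y)\<^sup>2 - (norm (adj (\<Theta> 0) y))\<^sup>2)" (is "2 * Re ?a \<le> ?b")
proof -
  note z0 = schur_class_contraction[OF A B \<Theta>, of 0, simplified]
  note c0 = contractionD(5)[OF z0]
  define g where "g = \<Theta> 0 x"
  define u where "u = adj (\<Theta> 0) y"
  let ?s = "\<lambda>z. cinner (\<Theta> z x) y"
  have *: "2 * ((norm g)\<^sup>2 + r ^ (2 * n) * (norm u)\<^sup>2 + r ^ (2 * n) * Re ?a)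
      \<le> (norm x)\<^sup>2 + (norm g)\<^sup>2 + r ^ (2 * n) * ((norm u)\<^sup>2 + (norm y)\<^sup>2)" if r: "0 < r" "r < 1" for r
  proof -
    define p where "p \<zeta> = cinner (\<Theta> \<zeta> x) g + \<zeta> ^ n * cinner (\<Theta> \<zeta> u) g
      + of_real (r ^ (2 * n)) * cinner (\<Theta> \<zeta> u) y - \<zeta> ^ n * cinner u x - \<zeta> ^ n * cinner y g" for \<zeta>
    define C where "C = ((norm x)\<^sup>2 + (norm g)\<^sup>2 + r ^ (2 * n) * ((norm u)\<^sup>2 + (norm y)\<^sup>2)) / 2"
    have "Re (p 0 + of_real (r ^ (2 * n)) * taylor_coeff n ?s) \<le> C"
    proof (rule circle_mean_bound[OF _ schur_class_weak[OF \<Theta>] r])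
      show "p holomorphic_on ball 0 1"
        unfolding p_def[abs_def] by (intro holomorphic_intros schur_class_weak[OF \<Theta>])
      fix \<zeta> :: complex assume \<zeta>: "cmod \<zeta> = r"
      define w where "w = \<zeta> ^ n"
      \<comment> \<open>On the circle conjugates of powers are multiples of negative powers, so that all terms are holomorphic or have a pole at 0 only.\<close>
      have cw: "cnj w = of_real (r ^ (2 * n)) / w" "w * cnj w = of_real (r ^ (2 * n))" "(cmod w)\<^sup>2 = r ^ (2 * n)"
      proof -
        show 1: "(cmod w)\<^sup>2 = r ^ (2 * n)" by (simp add: w_def norm_power \<zeta> power_mult[symmetric] mult.commute)
        show 2: "w * cnj w = of_real (r ^ (2 * n))"
          unfolding complex_norm_square[symmetric] 1 ..
        have "w \<noteq> 0" using \<zeta> r by (auto simp: w_def)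
        then show "cnj w = of_real (r ^ (2 * n)) / w" using 2 by (simp add: field_simps)
      qed
      have \<zeta>b: "\<zeta> \<in> ball 0 1" using \<zeta> r by simp
      have c: "cbl (\<Theta> \<zeta>)" using schur_classD(1)[OF \<Theta> \<zeta>b] bopD(1) by blast
      define f where "f = x + w *\<^sub>C u"
      define h where "h = g + w *\<^sub>C y"
      have "Re (cinner (\<Theta> \<zeta> f) h) \<le> norm f * norm h"
        using schur_classD(3)[OF \<Theta> \<zeta>b, of f h] complex_Re_le_cmod order_trans by blast
      also have "\<dots> \<le> ((norm f)\<^sup>2 + (norm h)\<^sup>2) / 2"
        using sum_squares_bound[of "norm f" "norm h"] by simp
      finally have 1: "Re (cinner (\<Theta> \<zeta> f) h) \<le> ((norm f)\<^sup>2 + (norm h)\<^sup>2) / 2" .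
      have sw: "Re (cinner x (w *\<^sub>C u)) = Re (w * cinner u x)" for x u :: "'z::chilbert"
        using arg_cong[OF cinner_commute[of x "w *\<^sub>C u"], of Re] by (simp add: cinner_simps)
      have 2: "(norm f)\<^sup>2 = (norm x)\<^sup>2 + r ^ (2 * n) * (norm u)\<^sup>2 + 2 * Re (w * cinner u x)"
        "(norm h)\<^sup>2 = (norm g)\<^sup>2 + r ^ (2 * n) * (norm y)\<^sup>2 + 2 * Re (w * cinner y g)"
        unfolding f_def h_def norm_add_square sw by (simp_all add: norm_scaleC power_mult_distrib cw)
      have "cinner (\<Theta> \<zeta> f) h = cinner (\<Theta> \<zeta> x) g + w * cinner (\<Theta> \<zeta> u) g
          + cnj w * cinner (\<Theta> \<zeta> x) y + w * cnj w * cinner (\<Theta> \<zeta> u) y"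
        by (simp add: f_def h_def cinner_simps clinearD[OF c] algebra_simps)
      then have 3: "cinner (\<Theta> \<zeta> f) h = cinner (\<Theta> \<zeta> x) g + w * cinner (\<Theta> \<zeta> u) g
          + of_real (r ^ (2 * n)) * (?s \<zeta> / w) + of_real (r ^ (2 * n)) * cinner (\<Theta> \<zeta> u) y"
        unfolding cw(2) unfolding cw(1) by simp
      have "p \<zeta> + of_real (r ^ (2 * n)) * (?s \<zeta> / \<zeta> ^ n)
          = cinner (\<Theta> \<zeta> f) h - w * cinner u x - w * cinner y g"
        unfolding 3 p_def w_def[symmetric] by simp
      then have "Re (p \<zeta> + of_real (r ^ (2 * n)) * (?s \<zeta> / \<zeta> ^ n))
          = Re (cinner (\<Theta> \<zeta> f) h) - Re (w * cinner u x) - Re (w * cinner y g)" by simp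
      also have "\<dots> \<le> C" using 1 unfolding 2 C_def by (simp add: field_simps)
      finally show "Re (p \<zeta> + of_real (r ^ (2 * n)) * (?s \<zeta> / \<zeta> ^ n)) \<le> C" .
    qed
    moreover have "p 0 = of_real ((norm g)\<^sup>2) + of_real (r ^ (2 * n)) * of_real ((norm u)\<^sup>2)"
      using n unfolding p_def adj_cinner[OF c0] u_def[symmetric]
      by (simp add: g_def[symmetric] cinner_self power_0_left adj_cinner[OF c0, symmetric] del: of_real_power)
    ultimately show ?thesis unfolding C_def by (simp add: algebra_simps)
  qed
  have "2 * ((norm g)\<^sup>2 + 1 ^ (2 * n) * (norm u)\<^sup>2 + 1 ^ (2 * n) * Re ?a)
      \<le> (norm x)\<^sup>2 + (norm g)\<^sup>2 + 1 ^ (2 * n) * ((norm u)\<^sup>2 + (norm y)\<^sup>2)"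
  proof (rule tendsto_le[OF trivial_limit_at_left_real])
    show "((\<lambda>r. 2 * ((norm g)\<^sup>2 + r ^ (2 * n) * (norm u)\<^sup>2 + r ^ (2 * n) * Re ?a)) \<longlongrightarrow>
        2 * ((norm g)\<^sup>2 + 1 ^ (2 * n) * (norm u)\<^sup>2 + 1 ^ (2 * n) * Re ?a)) (at_left 1)"
      by (intro tendsto_intros)
    show "((\<lambda>r. (norm x)\<^sup>2 + (norm g)\<^sup>2 + r ^ (2 * n) * ((norm u)\<^sup>2 + (norm y)\<^sup>2)) \<longlongrightarrow>
        (norm x)\<^sup>2 + (norm g)\<^sup>2 + 1 ^ (2 * n) * ((norm u)\<^sup>2 + (norm y)\<^sup>2)) (at_left 1)"
      by (intro tendsto_intros)
    show "\<forall>\<^sub>F r in at_left 1. 2 * ((norm g)\<^sup>2 + r ^ (2 * n) * (norm u)\<^sup>2 + r ^ (2 * n) * Re ?a)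
        \<le> (norm x)\<^sup>2 + (norm g)\<^sup>2 + r ^ (2 * n) * ((norm u)\<^sup>2 + (norm y)\<^sup>2)"
      using eventually_at_left_real[OF zero_less_one]
    proof eventually_elim
      case (elim r)
      then show ?case by (intro *) auto
    qed
  qed
  then show ?thesis by (simp add: g_def u_def)
qed

text \<open>
  The choice \<open>t\<^sup>2 = b / a\<close> would do for positive \<open>a, b\<close>; adding \<open>e\<close> to both covers zero as well.
\<close>

lemma scaled_squares_bound:
  fixes a b c :: real
  assumes "\<And>t. t > 0 \<Longrightarrow> 2 * c \<le> t\<^sup>2 * a\<^sup>2 + b\<^sup>2 / t\<^sup>2" "0 \<le> a" "0 \<le> b"
  shows "c \<le> a * b"
proof (rule tendsto_lowerbound)
  show "((\<lambda>e. (a + e) * (b + e)) \<longlongrightarrow> a * b) (at_right 0)"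
    by (rule tendsto_eq_intros refl | simp)+
  show "\<forall>\<^sub>F e in at_right 0. c \<le> (a + e) * (b + e)"
    using eventually_at_right_less[of 0]
  proof eventually_elim
    case (elim e)
    define t where "t = sqrt ((b + e) / (a + e))"
    have p: "a + e > 0" "b + e > 0" using assms elim by auto
    then have t: "t > 0" "t\<^sup>2 = (b + e) / (a + e)" by (auto simp: t_def)
    have "2 * c \<le> (b + e) / (a + e) * a\<^sup>2 + b\<^sup>2 / ((b + e) / (a + e))"
      using assms(1)[OF t(1)] unfolding t(2) .
    also have "\<dots> \<le> (b + e) / (a + e) * (a + e)\<^sup>2 + (b + e)\<^sup>2 / ((b + e) / (a + e))"
      using p assms elim by (intro add_mono mult_left_mono divide_right_mono power_mono) auto
    also have "\<dots> = 2 * ((a + e) * (b + e))"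
      using p by (simp add: power2_eq_square)
    finally show ?case by simp
  qed
qed simp

text \<open>
  In \<open>taylor_coeff_Re_le\<close> the right-hand side is \<open>|D\<^sub>\<Gamma> x|\<^sup>2 + |D\<^sub>\<Gamma>\<^sub>* y|\<^sup>2\<close> for \<open>x\<close> in \<open>A\<close> and \<open>y\<close> in \<open>B\<close>. A phase makes
  the coefficient real, and rescaling \<open>x\<close> by \<open>t\<close> and \<open>y\<close> by \<open>1/t\<close> turns the sum into a product.
\<close>

lemma taylor_coeff_defect_bound:
  assumes A: "closed_csubspace A" and B: "closed_csubspace B" and \<Theta>: "\<Theta> \<in> schur_class A B" and n: "n \<ge> 1"
  shows "cmod (taylor_coeff n (\<lambda>z. cinner (\<Theta> z x) y)) \<le> norm (defect A (\<Theta> 0) x) * norm (defect B (adj (\<Theta> 0)) y)"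
    (is "cmod ?a \<le> norm (?D x) * norm (?E y)")
proof (rule scaled_squares_bound)
  note z0 = schur_class_contraction[OF A B \<Theta>, of 0, simplified]
  note t = contractionD[OF z0] and s = contractionD[OF contraction_adj[OF z0]]
  fix t :: real assume t0: "t > 0"
  obtain c where c: "cmod c = 1" "c * ?a = of_real (cmod ?a)"
  proof (cases "?a = 0")
    case False
    then show ?thesis
      by (intro that[of "cnj ?a / of_real (cmod ?a)"])
        (simp_all add: norm_divide complex_norm_square[symmetric] power2_eq_square mult.commute)
  qed (use that[of 1] in simp)
  define k where "k = c * complex_of_real t"
  define x' where "x' = k *\<^sub>C proj A x"
  define y' where "y' = (1 / t) *\<^sub>R proj B y"
  have hol: "(\<lambda>z. cinner (\<Theta> z x) y) holomorphic_on ball 0 1" by (rule schur_class_weak[OF \<Theta>])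
  have eq: "cinner (\<Theta> z x') y' = c * cinner (\<Theta> z x) y" if z: "z \<in> ball 0 1" for z
  proof -
    note tz = schur_class_contraction[OF A B \<Theta> z]
    have "cinner (\<Theta> z x') y' = k * (cinner (\<Theta> z x) (proj B y) / t)"
      using contractionD(7)[OF tz] clinearD[OF contractionD(5)[OF tz]]
      by (simp add: x'_def y'_def cinner_simps cinner.scaleR_right scaleR_conv_of_real)
    also have "cinner (\<Theta> z x) (proj B y) = cinner (\<Theta> z x) y"
      using proj_cinner[OF B] proj_ident[OF B contractionD(6)[OF tz]] by metis
    finally show ?thesis using t0 by (simp add: k_def)
  qed
  have "taylor_coeff n (\<lambda>z. cinner (\<Theta> z x') y') = taylor_coeff n (\<lambda>z. c * cinner (\<Theta> z x) y)"
    unfolding taylor_coeff_def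
    by (rule arg_cong[where f = "\<lambda>w. w / fact n"], rule higher_deriv_cong_ev)
      (use eventually_nhds_in_open[OF open_ball, of 0 0 1] eq in \<open>auto elim!: eventually_mono\<close>)
  also have "\<dots> = of_real (cmod ?a)" unfolding taylor_coeff_cmult[OF hol] by (rule c)
  finally have "2 * cmod ?a \<le> (norm x')\<^sup>2 - (norm (\<Theta> 0 x'))\<^sup>2 + ((norm y')\<^sup>2 - (norm (adj (\<Theta> 0) y'))\<^sup>2)"
    using taylor_coeff_Re_le[OF A B \<Theta> n, of x' y'] by simp
  also have "\<dots> = t\<^sup>2 * (norm (?D x))\<^sup>2 + (norm (?E y))\<^sup>2 / t\<^sup>2"
  proof -
    have "cmod k = t" using c(1) t0 by (simp add: k_def norm_mult)
    then have "(norm x')\<^sup>2 - (norm (\<Theta> 0 x'))\<^sup>2 = t\<^sup>2 * (norm (?D x))\<^sup>2"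
      unfolding norm_defect[OF z0] x'_def
      by (simp add: clinearD[OF t(5)] norm_scaleC t(7) power_mult_distrib right_diff_distrib)
    moreover have "(norm y')\<^sup>2 - (norm (adj (\<Theta> 0) y'))\<^sup>2 = (norm (?E y))\<^sup>2 / t\<^sup>2"
      unfolding norm_defect[OF contraction_adj[OF z0]] y'_def
      using t0 by (simp add: blinfun.scaleR_right s(7) power_divide diff_divide_distrib)
    ultimately show ?thesis by simp
  qed
  finally show "2 * cmod ?a \<le> t\<^sup>2 * (norm (?D x))\<^sup>2 + (norm (?E y))\<^sup>2 / t\<^sup>2" .
qed auto

lemma schur_increment_bound:
  assumes A: "closed_csubspace A" and B: "closed_csubspace B" and \<Theta>: "\<Theta> \<in> schur_class A B" and z: "z \<in> ball 0 1"
  shows "cmod (cinner ((\<Theta> z - \<Theta> 0) x) y)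
    \<le> 1 / (1 - cmod z) * norm (defect A (\<Theta> 0) x) * norm (defect B (adj (\<Theta> 0)) y)"
proof -
  let ?\<phi> = "\<lambda>z. cinner (\<Theta> z x) y" and ?k = "norm (defect A (\<Theta> 0) x) * norm (defect B (adj (\<Theta> 0)) y)"
  have z1: "cmod z < 1" using z by simp
  have "(\<lambda>n. taylor_coeff n ?\<phi> * z ^ n) sums ?\<phi> z"
    using holomorphic_power_series[OF schur_class_weak[OF \<Theta>] z] by (simp add: taylor_coeff_def)
  then have "(\<lambda>n. taylor_coeff (Suc n) ?\<phi> * z ^ Suc n) sums (?\<phi> z - ?\<phi> 0)"
    by (intro sums_Suc_iff[of "\<lambda>n. taylor_coeff n ?\<phi> * z ^ n", THEN iffD2]) (simp add: taylor_coeff_def)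
  then have eq: "cinner ((\<Theta> z - \<Theta> 0) x) y = (\<Sum>n. taylor_coeff (Suc n) ?\<phi> * z ^ Suc n)"
    by (simp add: sums_iff blinfun.diff_left cinner.diff_left)
  have g: "summable (\<lambda>n. ?k * cmod z ^ n)" using z1 by (intro summable_mult summable_geometric) simp
  have le: "norm (taylor_coeff (Suc n) ?\<phi> * z ^ Suc n) \<le> ?k * cmod z ^ n" for n
  proof -
    have "norm (taylor_coeff (Suc n) ?\<phi> * z ^ Suc n) = cmod (taylor_coeff (Suc n) ?\<phi>) * cmod z ^ Suc n"
      by (simp add: norm_mult norm_power)
    also have "\<dots> \<le> ?k * cmod z ^ n"
      using z1 by (intro mult_mono taylor_coeff_defect_bound[OF A B \<Theta>] power_decreasing) auto
    finally show ?thesis .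
  qed
  have "cmod (cinner ((\<Theta> z - \<Theta> 0) x) y) \<le> (\<Sum>n. ?k * cmod z ^ n)"
    unfolding eq by (rule norm_suminf_le[OF le g])
  also have "\<dots> = ?k * (1 / (1 - cmod z))"
    using z1 by (subst suminf_mult) (auto simp: suminf_geometric intro: summable_geometric)
  finally show ?thesis by (simp add: mult_ac)
qed

section \<open>The Schur algorithm\<close>

lemma is_inverse_on_sym:
  "T \<in> bop A A \<Longrightarrow> is_inverse_on A T R \<Longrightarrow> is_inverse_on A R T"
  by (simp add: is_inverse_on_def)

text \<open>
  The increment bound gives \<open>W\<close> with \<open>\<Theta> - \<Gamma> = D\<^sub>\<Gamma>\<^sub>* W D\<^sub>\<Gamma>\<close>. The equation for \<open>\<Psi>\<close> becomes \<open>W = Z (I + \<Gamma>\<^sup>* Z)\<^sup>-\<^sup>1\<close>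
  for \<open>Z = z \<Psi>(z)\<close>, that is, \<open>Z = W (I - \<Gamma>\<^sup>* W)\<^sup>-\<^sup>1\<close>, and \<open>I - \<Gamma>\<^sup>* W\<close> and \<open>I + \<Gamma>\<^sup>* Z\<close> are inverse to each other.
  The rotation of \<open>\<Gamma>\<close> maps \<open>(x, W D\<^sub>\<Gamma> x)\<close> to \<open>(\<Theta> x, (I - \<Gamma>\<^sup>* W) D\<^sub>\<Gamma> x)\<close>, and \<open>|\<Theta> x| \<le> |x|\<close>; thus
  \<open>|W D\<^sub>\<Gamma> x| \<le> |(I - \<Gamma>\<^sup>* W) D\<^sub>\<Gamma> x|\<close>, which says that \<open>Z\<close> is a contraction wherever it exists.
\<close>

lemma schur_step_exists:
  assumes A: "closed_csubspace A" and B: "closed_csubspace B" and \<Theta>: "\<Theta> \<in> schur_class A B"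
  defines "\<Gamma> \<equiv> \<Theta> 0" and "A' \<equiv> defect_space A (\<Theta> 0)" and "B' \<equiv> defect_space B (adj (\<Theta> 0))"
  obtains W \<Psi> where "\<Psi> \<in> schur_class A' B'"
    "\<And>z. z \<in> ball 0 1 \<Longrightarrow> W z \<in> bop A' B'"
    "\<And>z. z \<in> ball 0 1 \<Longrightarrow> \<Theta> z - \<Gamma> = defect B (adj \<Gamma>) o\<^sub>L W z o\<^sub>L defect A \<Gamma>"
    "\<And>z. z \<in> ball 0 1 \<Longrightarrow> is_inverse_on A' (proj A' + z *\<^sub>C (adj \<Gamma> o\<^sub>L \<Psi> z)) (proj A' - (adj \<Gamma> o\<^sub>L W z))"
    "\<And>z. z \<in> ball 0 1 \<Longrightarrow> (z *\<^sub>C \<Psi> z) o\<^sub>L (proj A' - (adj \<Gamma> o\<^sub>L W z)) = W z"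
proof -
  have c\<Gamma>: "contraction A B \<Gamma>"
    unfolding \<Gamma>_def using schur_class_contraction[OF A B \<Theta>, of 0] by simp
  note c\<Gamma>' = contraction_adj[OF c\<Gamma>] and t = contractionD[OF c\<Gamma>]
  define D where "D = defect A \<Gamma>"
  define E where "E = defect B (adj \<Gamma>)"
  have cD: "cbl D" "cbl E" unfolding D_def E_def using cbl_defect c\<Gamma> c\<Gamma>' by auto
  have A': "closed_csubspace A'" "A' = closure (range D)"
    unfolding A'_def D_def \<Gamma>_def[symmetric] by (rule defect_space_closed[OF c\<Gamma>], simp add: defect_space_def)
  have B': "closed_csubspace B'" "B' = closure (range E)"
    unfolding B'_def E_def \<Gamma>_def[symmetric] by (rule defect_space_closed[OF c\<Gamma>'], simp add: defect_space_def)
  have BB': "B' \<subseteq> B" unfolding B'_def \<Gamma>_def[symmetric] by (rule defect_space_subset[OF c\<Gamma>'])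
  have DA': "D x \<in> A'" for x unfolding A'(2) by (rule subsetD[OF closure_subset]) simp
  have gmap: "adj \<Gamma> y \<in> A'" if "y \<in> B'" for y
    using maps_defect_space[OF c\<Gamma>', unfolded adj_adj[OF t(5)], of y] that by (simp add: A'_def B'_def \<Gamma>_def)
  have cT: "cbl (\<Theta> z)" if "z \<in> ball 0 1" for z using schur_classD(1)[OF \<Theta> that] bopD(1) by blast
  obtain W where W: "holomorphic_op W (ball 0 1)" "\<And>z. z \<in> ball 0 1 \<Longrightarrow> W z \<in> bop A' B'"
    "\<And>z x y. z \<in> ball 0 1 \<Longrightarrow> cinner (blinfun_apply (W z) (D x)) (E y) = cinner ((\<Theta> z - \<Gamma>) x) y"
    unfolding A'(2) B'(2)
  proof (rule form_family_holomorphic[OF cD, of "\<lambda>z x y. cinner ((\<Theta> z - \<Gamma>) x) y" "\<lambda>r. 1 / (1 - r)"])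
    show "sesquilinear (\<lambda>x y. cinner ((\<Theta> z - \<Gamma>) x) y)" if "z \<in> ball 0 1" for z
      by (intro sesquilinear_cinner cbl_diff cT that t)
    show "(\<lambda>z. cinner ((\<Theta> z - \<Gamma>) x) y) holomorphic_on ball 0 1" for x y
      by (auto simp: blinfun.diff_left cinner.diff_left intro!: holomorphic_intros schur_class_weak[OF \<Theta>])
    fix r :: real and z :: complex and x y assume r: "0 < r" "r < 1" "z \<in> ball 0 r"
    have "cmod (cinner ((\<Theta> z - \<Gamma>) x) y) \<le> 1 / (1 - cmod z) * (norm (D x) * norm (E y))"
      using schur_increment_bound[OF A B \<Theta>, of z x y] r by (simp add: D_def E_def \<Gamma>_def mult_ac)
    also have "\<dots> \<le> 1 / (1 - r) * (norm (D x) * norm (E y))"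
      using r by (intro mult_right_mono divide_left_mono mult_pos_pos) auto
    finally show "cmod (cinner ((\<Theta> z - \<Gamma>) x) y) \<le> 1 / (1 - r) * norm (D x) * norm (E y)"
      by (simp add: mult_ac)
  qed auto
  have factor: "\<Theta> z - \<Gamma> = E o\<^sub>L W z o\<^sub>L D" if z: "z \<in> ball 0 1" for z
    by (intro blinfun_eqI cinner_extI)
      (simp add: W(3)[OF z, symmetric] E_def defect_selfadjoint[OF c\<Gamma>'])
  have W0: "W 0 = 0"
  proof -
    have "norm (W 0) \<le> 0"
      by (rule form_norm_le[OF cD]) (use W(2)[of 0] W(3)[of 0] A'(2) B'(2) in \<open>auto simp: \<Gamma>_def\<close>)
    then show ?thesis by simp
  qed
  define S where "S z = proj A' - (adj \<Gamma> o\<^sub>L W z)" for z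
  have GW: "adj \<Gamma> o\<^sub>L T \<in> bop A' A'" if "T \<in> bop A' B'" for T
    by (rule bopI[OF A'(1)])
      (auto simp: bop_proj[OF A'(1) that] intro!: gmap bopD(2)[OF that] cbl_compose bopD(1)[OF that] cbl_adj t)
  have S: "S z \<in> bop A' A'" if "z \<in> ball 0 1" for z
    unfolding S_def by (intro bop_add A' proj_bop GW W that)
  have nG: "norm (adj \<Gamma>) \<le> 1" by (rule contractionD(4)[OF c\<Gamma>'])
  have nGW: "norm (adj \<Gamma> o\<^sub>L T) \<le> norm T" for T :: "'a \<Rightarrow>\<^sub>L 'b"
    using order_trans[OF norm_blinfun_compose mult_right_mono[OF nG norm_ge_zero]] by simp
  have inv_bounds: "norm (W z o\<^sub>L R) \<le> 1 \<and> R = proj A' + (adj \<Gamma> o\<^sub>L (W z o\<^sub>L R)) \<and> norm R \<le> 2"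
    if z: "z \<in> ball 0 1" and R: "is_inverse_on A' (S z) R" for z R
  proof -
    have RA: "R \<in> bop A' A'" "S z o\<^sub>L R = proj A'" using R by (auto simp: is_inverse_on_def)
    have le: "norm (W z v) \<le> norm (S z v)" if vD: "v \<in> range D" for v
    proof -
      obtain x where v: "v = D x" using vD by auto
      have "norm (elementary_rotation A B \<Gamma> (proj A x, W z v)) = norm (proj A x, W z v)"
        by (rule norm_elementary_rotation[OF c\<Gamma>])
          (use proj_mem[OF A] bopD(2)[OF W(2)[OF z]] BB' in auto)
      moreover have "elementary_rotation A B \<Gamma> (proj A x, W z v) = (\<Theta> z x, S z v)"
      proof -
        have "\<Theta> z x = \<Gamma> x + E (W z v)"
          using arg_cong[OF factor[OF z], of "\<lambda>F. blinfun_apply F x"] v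
          by (simp add: blinfun.diff_left algebra_simps)
        moreover have "S z v = D x - adj \<Gamma> (W z v)"
          unfolding S_def using proj_ident[OF A'(1) DA'] v by (simp add: blinfun.diff_left)
        ultimately show ?thesis
          using bop_proj[OF A defect_bop[OF c\<Gamma>]]
          by (simp add: elementary_rotation_def t(7) D_def E_def)
      qed
      ultimately have "(norm (\<Theta> z x))\<^sup>2 + (norm (S z v))\<^sup>2 = (norm (proj A x))\<^sup>2 + (norm (W z v))\<^sup>2"
        by (metis norm_Pair_square)
      moreover have "(norm (\<Theta> z x))\<^sup>2 \<le> (norm (proj A x))\<^sup>2"
        using contractionD(7,8)[OF schur_class_contraction[OF A B \<Theta> z]] by (metis norm_ge_zero power_mono)
      ultimately have "(norm (W z v))\<^sup>2 \<le> (norm (S z v))\<^sup>2" by linarith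
      then show ?thesis using power2_le_imp_le[OF _ norm_ge_zero] by blast
    qed
    have "closed {v. norm (W z v) \<le> norm (S z v)}"
      by (intro closed_Collect_le continuous_intros)
    then have "A' \<subseteq> {v. norm (W z v) \<le> norm (S z v)}"
      unfolding A'(2) using le by (intro closure_minimal) auto
    then have le': "norm (W z (R u)) \<le> norm (S z (R u))" for u
      using bopD(2)[OF RA(1)] by blast
    have SR: "S z (R u) = proj A' u" for u using RA(2) by (metis blinfun_apply_blinfun_compose)
    have 1: "norm (W z o\<^sub>L R) \<le> 1"
      using order_trans[OF le' norm_proj_le[OF A'(1), folded SR]] by (intro norm_blinfun_bound) auto
    have "S z (R u) = R u - adj \<Gamma> (W z (R u))" for u
      unfolding S_def by (simp add: blinfun.diff_left proj_ident[OF A'(1) bopD(2)[OF RA(1)]])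
    then have 2: "R = proj A' + (adj \<Gamma> o\<^sub>L (W z o\<^sub>L R))"
      by (intro blinfun_eqI) (simp add: blinfun.add_left SR)
    have "norm (proj A') \<le> 1"
      using norm_proj_le[OF A'(1)] by (intro norm_blinfun_bound) auto
    then have "norm R \<le> 2"
      by (subst 2) (use nGW[of "W z o\<^sub>L R"] 1 norm_triangle_ineq in \<open>smt (verit)\<close>)
    with 1 2 show ?thesis by blast
  qed
  have contW: "continuous_on (ball 0 1) W"
    using W(1) unfolding holomorphic_op_def
    by (metis (no_types, lifting) continuous_on_eq_continuous_within has_derivative_continuous)
  have inv_ex: "\<exists>R. is_inverse_on A' (S z) R" if z: "z \<in> ball 0 1" for z
  proof (rule connected_induction_simple[of "ball 0 (1::real)" 0 z "\<lambda>z. \<exists>R. is_inverse_on A' (S z) R"])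
    show "\<exists>R. is_inverse_on A' (S 0) R"
      using proj_bop[OF A'(1)] bop_proj_compose[OF A'(1) A'(1)]
      by (intro exI[of _ "proj A'"]) (auto simp: is_inverse_on_def S_def W0)
    fix a :: complex assume a: "a \<in> ball 0 1"
    \<comment> \<open>In this neighbourhood \<open>W\<close> varies by less than 1/4, which an inverse of norm at most 2 tolerates.\<close>
    let ?T = "ball 0 1 \<inter> W -` ball (W a) (1/8)"
    have "\<exists>R'. is_inverse_on A' (S y) R'" if x: "x \<in> ?T" and y: "y \<in> ?T" and R: "is_inverse_on A' (S x) R" for x y R
    proof -
      have xy: "x \<in> ball 0 1" "y \<in> ball 0 1" using x y by auto
      define Q where "Q = R o\<^sub>L (S x - S y)"
      have RA: "R \<in> bop A' A'" "S x o\<^sub>L R = proj A'" using R by (auto simp: is_inverse_on_def)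
      have SS: "S x - S y = adj \<Gamma> o\<^sub>L (W y - W x)"
        by (rule blinfun_eqI) (simp add: S_def blinfun.diff_left blinfun.diff_right)
      have dS: "S x - S y \<in> bop A' A'" by (intro bop_add A' S xy)
      have Q: "Q \<in> bop A' A'" unfolding Q_def by (rule bop_compose[OF A'(1) dS RA(1)])
      have "norm (W y - W x) < 1 / 4"
        using x y dist_triangle_half_r[of "W a" "W y" "1/4" "W x"] by (auto simp: dist_norm)
      then have "norm (S x - S y) < 1 / 4" unfolding SS using nGW[of "W y - W x"] by linarith
      moreover have "norm Q \<le> norm R * norm (S x - S y)" unfolding Q_def by (rule norm_blinfun_compose)
      moreover have "norm R * norm (S x - S y) \<le> 2 * norm (S x - S y)"
        using inv_bounds[OF xy(1) R] by (intro mult_right_mono) auto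
      ultimately have "norm Q < 1" by linarith
      then obtain R' where R': "is_inverse_on A' (proj A' - Q) R'"
        using neumann_inverse_on[OF A'(1) Q] by blast
      have "S x o\<^sub>L (proj A' - Q) = S y"
      proof (rule blinfun_eqI)
        fix u
        have "S x (Q u) = proj A' ((S x - S y) u)"
          unfolding Q_def using RA(2) by (metis blinfun_apply_blinfun_compose)
        also have "\<dots> = S x u - S y u"
          using proj_ident[OF A'(1) bopD(2)[OF dS]] by (simp add: blinfun.diff_left)
        finally show "(S x o\<^sub>L (proj A' - Q)) u = S y u"
          by (simp add: blinfun.diff_left blinfun.diff_right bop_proj[OF A'(1) S[OF xy(1)]])
      qed
      then show ?thesis using is_inverse_on_compose[OF A'(1) S[OF xy(1)] R R'] by auto
    qed
    moreover have "openin (top_of_set (ball 0 1)) ?T"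
      by (rule continuous_openin_preimage_gen[OF contW open_ball])
    ultimately show "\<exists>T. openin (top_of_set (ball 0 1)) T \<and> a \<in> T \<and>
      (\<forall>x\<in>T. \<forall>y\<in>T. (\<exists>R. is_inverse_on A' (S x) R) \<longrightarrow> (\<exists>R. is_inverse_on A' (S y) R))"
      using a by (intro exI[of _ ?T]) auto
  qed (use z in auto)
  then obtain R where R: "\<And>z. z \<in> ball 0 1 \<Longrightarrow> is_inverse_on A' (S z) (R z)" by metis
  define Z where "Z z = W z o\<^sub>L R z" for z
  note ib = inv_bounds[OF _ R, folded Z_def]
  have RA: "R z \<in> bop A' A'" if "z \<in> ball 0 1" for z using R[OF that] by (simp add: is_inverse_on_def)
  have holS: "holomorphic_op S (ball 0 1)"
    unfolding S_def[abs_def]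
    by (intro holomorphic_op_diff holomorphic_op_const holomorphic_op_compose W open_ball cbl_adj t)
  have holZ: "holomorphic_op Z (ball 0 1)"
    unfolding Z_def[abs_def]
  proof (intro holomorphic_op_compose W open_ball holomorphic_op_inverse[OF open_ball A'(1) holS S R, of 2])
    fix z :: complex assume z: "z \<in> ball 0 1"
    show "norm (R z) \<le> 2" using ib[OF z z] by blast
    show "cbl (W z)" by (rule bopD(1)[OF W(2)[OF z]])
  qed
  have "Z \<in> schur_class A' B'"
    using holZ ib bop_compose[OF A'(1) RA W(2)] by (auto simp: schur_class_def Z_def)
  moreover have "Z 0 = 0" by (simp add: Z_def W0)
  ultimately obtain \<Psi> where \<Psi>: "\<Psi> \<in> schur_class A' B'" "\<And>z. z \<in> ball 0 1 \<Longrightarrow> Z z = z *\<^sub>C \<Psi> z"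
    using schur_schwarz[OF A'(1) B'(1)] by blast
  show thesis
  proof (rule that[of \<Psi> W])
    fix z :: complex assume z: "z \<in> ball 0 1"
    show "W z \<in> bop A' B'" by (rule W(2)[OF z])
    show "\<Theta> z - \<Gamma> = defect B (adj \<Gamma>) o\<^sub>L W z o\<^sub>L defect A \<Gamma>"
      using factor[OF z] by (simp add: D_def E_def)
    have "z *\<^sub>C (adj \<Gamma> o\<^sub>L \<Psi> z) = adj \<Gamma> o\<^sub>L Z z"
      using clinearD(2)[OF contractionD(5)[OF c\<Gamma>']]
      by (intro blinfun_eqI) (simp add: \<Psi>(2)[OF z] scaleC_blinfun.rep_eq)
    then have "proj A' + z *\<^sub>C (adj \<Gamma> o\<^sub>L \<Psi> z) = R z" using ib[OF z] z by simp
    then show "is_inverse_on A' (proj A' + z *\<^sub>C (adj \<Gamma> o\<^sub>L \<Psi> z)) (proj A' - (adj \<Gamma> o\<^sub>L W z))"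
      using is_inverse_on_sym[OF S[OF z] R[OF z]] by (simp add: S_def)
    have "Z z o\<^sub>L S z = W z"
      using R[OF z] bop_proj_compose(1)[OF A'(1) B'(1) W(2)[OF z]]
      by (simp add: Z_def is_inverse_on_def blinfun_compose_assoc)
    then show "(z *\<^sub>C \<Psi> z) o\<^sub>L (proj A' - (adj \<Gamma> o\<^sub>L W z)) = W z"
      by (simp add: \<Psi>(2)[OF z] S_def)
  qed (rule \<Psi>(1))
qed

text \<open>
  Uniqueness of the Schur iterate: each solution \<open>\<Phi>\<close> satisfies \<open>z \<Phi> (I + z \<Gamma>\<^sup>* \<Phi>)\<^sup>-\<^sup>1 = W\<close>, since defect operators have dense
  range in the defect spaces. This determines the inverse as \<open>I - \<Gamma>\<^sup>* W\<close>, hence \<open>\<Phi>(z)\<close> for \<open>z \<noteq> 0\<close>, and at 0 by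
  continuity. The second claim is the defining equation written with vectors, where
  \<open>X = (I - \<Gamma>\<^sup>* W(z)) D\<^sub>\<Gamma> x\<close>.
\<close>

lemma schur_next_props:
  assumes A: "closed_csubspace A" and B: "closed_csubspace B" and \<Theta>: "\<Theta> \<in> schur_class A B"
  defines "\<Gamma> \<equiv> \<Theta> 0" and "A' \<equiv> defect_space A (\<Theta> 0)" and "B' \<equiv> defect_space B (adj (\<Theta> 0))"
  shows "schur_next A B \<Theta> \<in> schur_class A' B'"
    and "z \<in> ball 0 1 \<Longrightarrow> x \<in> A \<Longrightarrow>
      \<exists>X\<in>A'. elementary_rotation A B \<Gamma> (x, z *\<^sub>C schur_next A B \<Theta> z X) = (\<Theta> z x, X)"
proof -
  have c\<Gamma>: "contraction A B \<Gamma>"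
    unfolding \<Gamma>_def using schur_class_contraction[OF A B \<Theta>, of 0] by simp
  note c\<Gamma>' = contraction_adj[OF c\<Gamma>]
  obtain W \<Psi>0 where st: "\<Psi>0 \<in> schur_class A' B'"
    "\<And>z. z \<in> ball 0 1 \<Longrightarrow> W z \<in> bop A' B'"
    "\<And>z. z \<in> ball 0 1 \<Longrightarrow> \<Theta> z - \<Gamma> = defect B (adj \<Gamma>) o\<^sub>L W z o\<^sub>L defect A \<Gamma>"
    "\<And>z. z \<in> ball 0 1 \<Longrightarrow> is_inverse_on A' (proj A' + z *\<^sub>C (adj \<Gamma> o\<^sub>L \<Psi>0 z)) (proj A' - (adj \<Gamma> o\<^sub>L W z))"
    "\<And>z. z \<in> ball 0 1 \<Longrightarrow> (z *\<^sub>C \<Psi>0 z) o\<^sub>L (proj A' - (adj \<Gamma> o\<^sub>L W z)) = W z"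
    by (rule schur_step_exists[OF A B \<Theta>, folded A'_def B'_def, folded \<Gamma>_def]) (rule that)
  have A': "closed_csubspace A'" and B': "closed_csubspace B'"
    unfolding A'_def B'_def using defect_space_closed[OF c\<Gamma>] defect_space_closed[OF c\<Gamma>'] by (auto simp: \<Gamma>_def)
  have gmap: "adj \<Gamma> y \<in> A'" if "y \<in> B'" for y
    using maps_defect_space[OF c\<Gamma>', unfolded adj_adj[OF contractionD(5)[OF c\<Gamma>]], of y] that
    by (simp add: A'_def B'_def \<Gamma>_def)
  have GW: "adj \<Gamma> o\<^sub>L T \<in> bop A' A'" if "T \<in> bop A' B'" for T
    by (rule bopI[OF A'])
      (auto simp: bop_proj[OF A' that] intro!: gmap bopD(2)[OF that] cbl_compose bopD(1)[OF that]
        contractionD(5)[OF c\<Gamma>'])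
  define \<Psi> where "\<Psi> z = (if z \<in> ball 0 1 then \<Psi>0 z else 0)" for z
  have \<Psi>eq: "\<Psi> z = \<Psi>0 z" if "z \<in> ball 0 1" for z using that by (simp add: \<Psi>_def)
  have \<Psi>S: "\<Psi> \<in> schur_class A' B'"
    using st(1) holomorphic_op_cong[of "ball 0 1" \<Psi>0 \<Psi>] \<Psi>eq by (simp add: schur_class_def)
  let ?good = "\<lambda>\<Psi>. \<Psi> \<in> schur_class A' B' \<and>
       (\<forall>z\<in>ball 0 1. \<Theta> z = \<Gamma> + z *\<^sub>C (defect B (adj \<Gamma>) o\<^sub>L \<Psi> z o\<^sub>L
          op_inv A' (proj A' + z *\<^sub>C (adj \<Gamma> o\<^sub>L \<Psi> z)) o\<^sub>L defect A \<Gamma>)) \<and>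
       (\<forall>z. z \<notin> ball 0 1 \<longrightarrow> \<Psi> z = 0)"
  have good: "?good \<Psi>"
  proof (intro conjI ballI allI impI)
    fix z :: complex assume z: "z \<in> ball 0 1"
    have "(z *\<^sub>C \<Psi> z) o\<^sub>L op_inv A' (proj A' + z *\<^sub>C (adj \<Gamma> o\<^sub>L \<Psi> z)) = W z"
      unfolding \<Psi>eq[OF z] op_inv_eqI[OF A' st(4)[OF z]] by (rule st(5)[OF z])
    then have "z *\<^sub>C \<Psi> z (op_inv A' (proj A' + z *\<^sub>C (adj \<Gamma> o\<^sub>L \<Psi> z)) x) = W z x" for x
      by (metis blinfun_apply_blinfun_compose scaleC_blinfun.rep_eq)
    moreover have "\<Theta> z x = \<Gamma> x + defect B (adj \<Gamma>) (W z (defect A \<Gamma> x))" for x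
      using arg_cong[OF st(3)[OF z], of "\<lambda>F. blinfun_apply F x"] by (simp add: blinfun.diff_left algebra_simps)
    ultimately show "\<Theta> z = \<Gamma> + z *\<^sub>C (defect B (adj \<Gamma>) o\<^sub>L \<Psi> z o\<^sub>L
          op_inv A' (proj A' + z *\<^sub>C (adj \<Gamma> o\<^sub>L \<Psi> z)) o\<^sub>L defect A \<Gamma>)"
      by (intro blinfun_eqI)
        (simp add: blinfun.add_left scaleC_blinfun.rep_eq clinearD(2)[OF cbl_defect[OF c\<Gamma>'], symmetric])
  qed (auto simp: \<Psi>S \<Psi>_def)
  have uniq: "\<Phi> = \<Psi>" if \<Phi>: "?good \<Phi>" for \<Phi>
  proof -
    have eq: "\<Phi> z = \<Psi> z" if z: "z \<in> ball 0 1" "z \<noteq> 0" for z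
    proof -
      have \<Phi>A: "\<Phi> z \<in> bop A' B'" "norm (\<Phi> z) \<le> 1" using \<Phi> schur_classD(1,2) z(1) by blast+
      define N where "N = proj A' + z *\<^sub>C (adj \<Gamma> o\<^sub>L \<Phi> z)"
      have zG: "z *\<^sub>C (adj \<Gamma> o\<^sub>L \<Phi> z) \<in> bop A' A'" by (intro bop_scaleC A' GW \<Phi>A)
      have "norm (adj \<Gamma> o\<^sub>L \<Phi> z) \<le> 1 * 1"
        using norm_blinfun_compose[of "adj \<Gamma>" "\<Phi> z"] mult_mono[OF contractionD(4)[OF c\<Gamma>'] \<Phi>A(2)]
        by (auto intro: order_trans)
      then have "cmod z * norm (adj \<Gamma> o\<^sub>L \<Phi> z) \<le> cmod z * 1"
        by (intro mult_left_mono) simp_all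
      then have "norm (- (z *\<^sub>C (adj \<Gamma> o\<^sub>L \<Phi> z))) < 1"
        using z(1) unfolding norm_minus_cancel norm_scaleC by simp
      moreover have "- (z *\<^sub>C (adj \<Gamma> o\<^sub>L \<Phi> z)) \<in> bop A' A'"
        using bop_scaleC[OF A' A' zG, of "-1"] by simp
      ultimately obtain Q where "is_inverse_on A' (proj A' - (- (z *\<^sub>C (adj \<Gamma> o\<^sub>L \<Phi> z)))) Q"
        using neumann_inverse_on[OF A'] by blast
      then have Q: "is_inverse_on A' N Q" by (simp add: N_def)
      then have QA: "Q \<in> bop A' A'" "N o\<^sub>L Q = proj A'" "Q o\<^sub>L N = proj A'" by (auto simp: is_inverse_on_def)
      have cE: "cbl (defect B (adj \<Gamma>))" by (rule cbl_defect[OF c\<Gamma>'])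
      have \<Theta>z: "\<Theta> z x = \<Gamma> x + defect B (adj \<Gamma>) (z *\<^sub>C \<Phi> z (Q (defect A \<Gamma> x)))" for x
      proof -
        have "\<Theta> z = \<Gamma> + z *\<^sub>C (defect B (adj \<Gamma>) o\<^sub>L \<Phi> z o\<^sub>L op_inv A' N o\<^sub>L defect A \<Gamma>)"
          using \<Phi> z(1) unfolding N_def by blast
        then show ?thesis unfolding op_inv_eqI[OF A' Q]
          by (simp add: blinfun.add_left scaleC_blinfun.rep_eq clinearD(2)[OF cE])
      qed
      define V where "V = (z *\<^sub>C \<Phi> z) o\<^sub>L Q"
      have V: "V \<in> bop A' B'" unfolding V_def by (rule bop_compose[OF A' QA(1) bop_scaleC[OF A' B' \<Phi>A(1)]])
      have "V = W z"
      proof (rule bop_eqI[of "range (defect A \<Gamma>)" "range (defect B (adj \<Gamma>))"])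
        show "csubspace (range (defect A \<Gamma>))" "csubspace (range (defect B (adj \<Gamma>)))"
          by (intro csubspace_range cbl_defect[OF c\<Gamma>] cE)+
        show "V \<in> bop (closure (range (defect A \<Gamma>))) (closure (range (defect B (adj \<Gamma>))))"
          "W z \<in> bop (closure (range (defect A \<Gamma>))) (closure (range (defect B (adj \<Gamma>))))"
          using V st(2)[OF z(1)] by (simp_all add: A'_def B'_def \<Gamma>_def defect_space_def)
        fix v w assume "v \<in> range (defect A \<Gamma>)" "w \<in> range (defect B (adj \<Gamma>))"
        then obtain x y where v: "v = defect A \<Gamma> x" and w: "w = defect B (adj \<Gamma>) y" by auto
        have "defect B (adj \<Gamma>) (V v) = \<Theta> z x - \<Gamma> x"
          unfolding V_def v \<Theta>z by (simp add: scaleC_blinfun.rep_eq)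
        also have "\<dots> = defect B (adj \<Gamma>) (W z v)"
          using arg_cong[OF st(3)[OF z(1)], of "\<lambda>F. blinfun_apply F x"] by (simp add: blinfun.diff_left v)
        finally show "cinner (V v) w = cinner (W z v) w"
          unfolding w defect_selfadjoint[OF c\<Gamma>', symmetric] by simp
      qed
      have "Q = proj A' - (adj \<Gamma> o\<^sub>L W z)"
      proof (rule blinfun_eqI)
        fix u
        have "N (Q u) = proj A' u" using QA(2) by (metis blinfun_apply_blinfun_compose)
        moreover have "N (Q u) = Q u + adj \<Gamma> (V u)"
          by (simp add: N_def V_def blinfun.add_left scaleC_blinfun.rep_eq proj_ident[OF A' bopD(2)[OF QA(1)]]
              clinearD(2)[OF contractionD(5)[OF c\<Gamma>']])
        ultimately show "Q u = (proj A' - (adj \<Gamma> o\<^sub>L W z)) u"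
          using \<open>V = W z\<close> by (simp add: blinfun.diff_left algebra_simps)
      qed
      have "z *\<^sub>C \<Phi> z = (z *\<^sub>C \<Phi> z) o\<^sub>L Q o\<^sub>L N"
        using bop_proj_compose(1)[OF A' B' bop_scaleC[OF A' B' \<Phi>A(1)]] QA(3)
        by (simp add: blinfun_compose_assoc)
      also have "\<dots> = (z *\<^sub>C \<Psi>0 z) o\<^sub>L Q o\<^sub>L N"
        using \<open>V = W z\<close> st(5)[OF z(1)] \<open>Q = _\<close> unfolding V_def by simp
      also have "\<dots> = z *\<^sub>C \<Psi>0 z"
        using bop_proj_compose(1)[OF A' B' bop_scaleC[OF A' B' schur_classD(1)[OF st(1) z(1)]]] QA(3)
        by (simp add: blinfun_compose_assoc)
      finally have "inverse z *\<^sub>C z *\<^sub>C \<Phi> z = inverse z *\<^sub>C z *\<^sub>C \<Psi>0 z" by simp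
      then show ?thesis using z by (simp add: scaleC_scaleC \<Psi>eq)
    qed
    have "\<Phi> 0 = \<Psi> 0"
    proof (rule tendsto_unique[of "at (0::complex)"])
      show "(\<Phi> \<longlongrightarrow> \<Phi> 0) (at 0)"
        by (rule holomorphic_op_continuous[OF open_ball]) (use \<Phi> in \<open>auto simp: schur_class_def\<close>)
      have "(\<Psi> \<longlongrightarrow> \<Psi> 0) (at 0)"
        by (rule holomorphic_op_continuous[OF open_ball]) (use \<Psi>S in \<open>auto simp: schur_class_def\<close>)
      moreover have "\<forall>\<^sub>F z in at 0. \<Phi> z = \<Psi> z"
        unfolding eventually_at by (rule exI[of _ 1]) (use eq in \<open>auto simp: dist_norm\<close>)
      ultimately show "(\<Phi> \<longlongrightarrow> \<Psi> 0) (at 0)" by (simp cong: tendsto_cong)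
    qed simp
    then show "\<Phi> = \<Psi>" using eq \<Phi> good by (metis (no_types, lifting) ext)
  qed
  have A'eq: "A' = defect_space A \<Gamma>" "B' = defect_space B (adj \<Gamma>)"
    by (simp_all add: A'_def B'_def \<Gamma>_def)
  have next_eq: "schur_next A B \<Theta> = \<Psi>"
    unfolding schur_next_def Let_def \<Gamma>_def[symmetric] A'eq[symmetric]
    by (rule the_equality, rule good, rule uniq)
  show "schur_next A B \<Theta> \<in> schur_class A' B'" unfolding next_eq by (rule \<Psi>S)
  show "\<exists>X\<in>A'. elementary_rotation A B \<Gamma> (x, z *\<^sub>C schur_next A B \<Theta> z X) = (\<Theta> z x, X)"
    if z: "z \<in> ball 0 1" and x: "x \<in> A"
  proof
    let ?S = "proj A' - (adj \<Gamma> o\<^sub>L W z)" and ?d = "defect A \<Gamma> x"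
    have d: "?d \<in> A'" unfolding A'_def \<Gamma>_def[symmetric] by (rule defect_mem[OF c\<Gamma>])
    show "?S ?d \<in> A'"
      by (rule bopD(2)[OF bop_add(2)[OF A' A' GW[OF st(2)[OF z]] proj_bop[OF A']]])
    have "z *\<^sub>C \<Psi> z (?S ?d) = W z ?d"
      using arg_cong[OF st(5)[OF z], of "\<lambda>F. blinfun_apply F ?d"] by (simp add: \<Psi>eq[OF z] scaleC_blinfun.rep_eq)
    moreover have "\<Theta> z x = \<Gamma> x + defect B (adj \<Gamma>) (W z ?d)"
      using arg_cong[OF st(3)[OF z], of "\<lambda>F. blinfun_apply F x"] by (simp add: blinfun.diff_left algebra_simps)
    moreover have "?S ?d = ?d - adj \<Gamma> (W z ?d)"
      by (simp add: blinfun.diff_left proj_ident[OF A' d])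
    ultimately show "elementary_rotation A B \<Gamma> (x, z *\<^sub>C schur_next A B \<Theta> z (?S ?d)) = (\<Theta> z x, ?S ?d)"
      unfolding next_eq by (simp add: elementary_rotation_def)
  qed
qed

section \<open>Integrals with respect to an operator measure\<close>

abbreviation "circle_borel \<equiv> restrict_space (borel :: complex measure) (sphere 0 1)"

definition bounded_borel :: "(complex \<Rightarrow> complex) \<Rightarrow> real \<Rightarrow> bool" where
  "bounded_borel f B \<longleftrightarrow> f \<in> borel_measurable circle_borel \<and> 0 \<le> B \<and> (\<forall>\<xi>\<in>sphere 0 1. cmod (f \<xi>) \<le> B)"

lemma bounded_borel_continuous:
  "continuous_on (sphere 0 1) f \<Longrightarrow> 0 \<le> B \<Longrightarrow> (\<And>\<xi>. cmod \<xi> = 1 \<Longrightarrow> cmod (f \<xi>) \<le> B) \<Longrightarrow> bounded_borel f B"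
  by (auto simp: bounded_borel_def intro: borel_measurable_continuous_on_restrict)

text \<open>
  Polarization turns the convergence of the quadratic forms into that of the sesquilinear forms, and
  the limit form inherits the bound \<open>K\<close>.
\<close>

lemma tendsto_quadratic_form_operator:
  fixes T :: "nat \<Rightarrow> 'm::chilbert \<Rightarrow>\<^sub>L 'm"
  assumes T: "\<And>i. cbl (T i)" and K: "\<And>i. norm (T i) \<le> K"
    and lim: "\<And>x. (\<lambda>i. cinner (T i x) x) \<longlonglongrightarrow> Q x"
  obtains S where "cbl S" "\<And>x. cinner (blinfun_apply S x) x = Q x"
proof -
  have K0: "0 \<le> K" using order_trans[OF norm_ge_zero K] .
  define q where "q x y = (Q (x + y) - Q (x - y) + \<i> * Q (x + \<i> *\<^sub>C y) - \<i> * Q (x - \<i> *\<^sub>C y)) / 4" for x y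
  have qlim: "(\<lambda>i. cinner (T i x) y) \<longlonglongrightarrow> q x y" for x y
  proof -
    have "cinner (T i x) y = (cinner (T i (x + y)) (x + y) - cinner (T i (x - y)) (x - y)
      + \<i> * cinner (T i (x + \<i> *\<^sub>C y)) (x + \<i> *\<^sub>C y) - \<i> * cinner (T i (x - \<i> *\<^sub>C y)) (x - \<i> *\<^sub>C y)) / 4" for i
      unfolding polarization[OF T, symmetric] by simp
    then show ?thesis unfolding q_def by (simp only:) (intro tendsto_intros lim, simp)
  qed
  have sq: "sesquilinear q"
    unfolding sesquilinear_def
  proof (intro conjI allI)
    fix x x' y y' c
    note u = LIMSEQ_unique[OF qlim]
    show "q (x + x') y = q x y + q x' y"
      by (rule u) (simp add: clinearD[OF T] cinner_simps, intro tendsto_add qlim)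
    show "q x (y + y') = q x y + q x y'"
      by (rule u) (simp add: clinearD[OF T] cinner_simps, intro tendsto_add qlim)
    show "q (c *\<^sub>C x) y = c * q x y"
      by (rule u) (simp add: clinearD[OF T] cinner_simps, intro tendsto_mult_left qlim)
    show "q x (c *\<^sub>C y) = cnj c * q x y"
      by (rule u) (simp add: clinearD[OF T] cinner_simps, intro tendsto_mult_left qlim)
  qed
  have qb: "cmod (q x y) \<le> K * norm (id_blinfun x :: 'm) * norm (id_blinfun y :: 'm)" for x y
  proof (rule LIMSEQ_le_const2[OF tendsto_norm[OF qlim]], intro exI allI impI)
    fix i
    have "cmod (cinner (T i x) y) \<le> norm (T i x) * norm y" by (rule cinner_Cauchy_Schwarz)
    also have "\<dots> \<le> (K * norm x) * norm y"
      by (intro mult_right_mono order_trans[OF norm_blinfun mult_right_mono[OF K]]) auto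
    finally show "cmod (cinner (T i x) y) \<le> K * norm (id_blinfun x :: 'm) * norm (id_blinfun y :: 'm)" by simp
  qed
  obtain S :: "'m \<Rightarrow>\<^sub>L 'm" where
    "S \<in> bop (closure (range (id_blinfun :: 'm \<Rightarrow>\<^sub>L 'm))) (closure (range (id_blinfun :: 'm \<Rightarrow>\<^sub>L 'm)))"
    "\<And>x y. cinner (S (id_blinfun x)) (id_blinfun y) = q x y"
    by (rule form_operator[OF cbl_simps(1) cbl_simps(1) K0 sq qb]) (rule that)
  moreover have "q x x = Q x" for x by (rule LIMSEQ_unique[OF qlim lim])
  ultimately show thesis using bopD(1) by (intro that[of S]) auto
qed

lemma circle_sets_Pow: "circle_sets \<subseteq> Pow (sphere 0 1)"
  unfolding circle_sets_def using sets.sets_into_space by fastforce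

lemma sphere_circle_sets: "sphere 0 1 \<in> circle_sets"
  unfolding circle_sets_def using sets.top[of circle_borel] by simp

context
  fixes \<mu> :: "complex set \<Rightarrow> 'm::chilbert \<Rightarrow>\<^sub>L 'm"
  assumes \<mu>: "op_measure \<mu>"
begin

abbreviation (input) "mu_at \<equiv> scalar_measure \<mu>"

lemma space_mu [simp]: "space (mu_at x) = sphere 0 1"
  unfolding scalar_measure_def by (rule space_measure_of[OF circle_sets_Pow])

lemma sets_mu: "sets (mu_at x) = sets circle_borel"
proof -
  have "sets (mu_at x) = sigma_sets (sphere 0 1) circle_sets"
    unfolding scalar_measure_def by (rule sets_measure_of[OF circle_sets_Pow])
  also have "\<dots> = circle_sets"
    unfolding circle_sets_def using sets.sigma_sets_eq[of circle_borel] by simp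
  finally show ?thesis by (simp add: circle_sets_def)
qed

lemma measurable_mu: "f \<in> borel_measurable circle_borel \<Longrightarrow> f \<in> borel_measurable (mu_at x)"
  using measurable_cong_sets[OF sets_mu refl] by blast

lemma mu_form_real: "X \<in> circle_sets \<Longrightarrow> cinner (\<mu> X x) x = of_real (Re (cinner (\<mu> X x) x))"
  "X \<in> circle_sets \<Longrightarrow> 0 \<le> Re (cinner (\<mu> X x) x)" "X \<in> circle_sets \<Longrightarrow> cbl (\<mu> X)"
  using \<mu> unfolding op_measure_def nonneg_op_def by (auto simp: of_real_Re)

lemma emeasure_mu:
  assumes "X \<in> circle_sets"
  shows "emeasure (mu_at x) X = ennreal (Re (cinner (\<mu> X x) x))"
proof (rule emeasure_measure_of[OF scalar_measure_def circle_sets_Pow])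
  show "X \<in> sets (mu_at x)" using assms by (simp add: sets_mu circle_sets_def)
  show "positive (sets (mu_at x)) (\<lambda>X. ennreal (Re (cinner (\<mu> X x) x)))"
    using \<mu> by (simp add: positive_def op_measure_def)
  show "countably_additive (sets (mu_at x)) (\<lambda>X. ennreal (Re (cinner (\<mu> X x) x)))"
  proof (rule countably_additiveI)
    fix A :: "nat \<Rightarrow> complex set" assume A: "range A \<subseteq> sets (mu_at x)" "disjoint_family A"
    then have "(\<lambda>n. \<mu> (A n) x) sums (\<mu> (\<Union>n. A n) x)"
      using \<mu> by (simp add: op_measure_def sets_mu circle_sets_def)
    then have "(\<lambda>n. Re (cinner (\<mu> (A n) x) x)) sums Re (cinner (\<mu> (\<Union>n. A n) x) x)"
      by (intro bounded_linear.sums[OF bounded_linear_Re] bounded_linear.sums[OF cinner.bounded_linear_left])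
    then show "(\<Sum>i. ennreal (Re (cinner (\<mu> (A i) x) x))) = ennreal (Re (cinner (\<mu> (\<Union> (range A)) x) x))"
      using A(1) by (intro suminf_ennreal_eq mu_form_real(2)) (auto simp: sets_mu circle_sets_def)
  qed
qed

lemma measure_mu: "X \<in> circle_sets \<Longrightarrow> cinner (\<mu> X x) x = of_real (measure (mu_at x) X)"
  using mu_form_real emeasure_mu by (simp add: measure_def)

lemma finite_measure_mu: "finite_measure (mu_at x)"
  by (rule finite_measureI) (simp add: emeasure_mu[OF sphere_circle_sets])

lemma integrable_mu:
  assumes "bounded_borel f B"
  shows "integrable (mu_at x) f"
  using assms by (intro finite_measure.integrable_const_bound[OF finite_measure_mu, of _ B])
    (auto simp: bounded_borel_def measurable_mu intro!: AE_I2)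

lemma integral_mu_bound:
  assumes f: "bounded_borel f B"
  shows "cmod (\<integral>\<xi>. f \<xi> \<partial>mu_at x) \<le> B * measure (mu_at x) (sphere 0 1)"
proof -
  interpret finite_measure "mu_at x" by (rule finite_measure_mu)
  have "cmod (\<integral>\<xi>. f \<xi> \<partial>mu_at x) \<le> (\<integral>\<xi>. cmod (f \<xi>) \<partial>mu_at x)"
    by (rule integral_norm_bound)
  also have "\<dots> \<le> (\<integral>\<xi>. B \<partial>mu_at x)"
    using f integrable_mu[OF f] by (intro integral_mono) (auto simp: bounded_borel_def)
  also have "\<dots> = B * measure (mu_at x) (sphere 0 1)" by (simp add: mult.commute)
  finally show ?thesis .
qed

text \<open>
  The integral of a simple function is a combination of the operators \<open>\<mu> X\<close>.
\<close>

lemma simple_integral_operator: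
  assumes s: "simple_function circle_borel s"
  obtains T where "cbl T" "\<And>x. cinner (blinfun_apply T x) x = (\<integral>\<xi>. s \<xi> \<partial>mu_at x)"
proof -
  let ?F = "s ` sphere 0 1" and ?A = "\<lambda>v. s -` {v} \<inter> sphere 0 1"
  have F: "finite ?F" and A: "?A v \<in> circle_sets" for v
    using s simple_functionD[OF s] by (auto simp: circle_sets_def)
  define T where "T = (\<Sum>v\<in>?F. v *\<^sub>C \<mu> (?A v))"
  have cT: "cbl (\<Sum>v\<in>F. v *\<^sub>C \<mu> (?A v))" if "finite F" for F
    using that
  proof (induction F)
    case (insert v F)
    then show ?case
      unfolding sum.insert[OF insert(1,2)] by (intro cbl_add cbl_scaleC mu_form_real(3)[OF A])
  qed (simp only: sum.empty cbl_simps)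
  have "cinner (T x) x = (\<integral>\<xi>. s \<xi> \<partial>mu_at x)" for x
  proof -
    interpret finite_measure "mu_at x" by (rule finite_measure_mu)
    have Am: "?A v \<in> sets (mu_at x)" for v using A by (simp add: sets_mu circle_sets_def)
    have "(\<integral>\<xi>. s \<xi> \<partial>mu_at x) = (\<integral>\<xi>. (\<Sum>v\<in>?F. indicator (?A v) \<xi> *\<^sub>R v) \<partial>mu_at x)"
    proof (rule Bochner_Integration.integral_cong[OF refl])
      fix \<xi> assume "\<xi> \<in> space (mu_at x)"
      then have \<xi>: "\<xi> \<in> sphere 0 1" by simp
      have "(\<Sum>v\<in>?F. indicator (?A v) \<xi> *\<^sub>R v) = (\<Sum>v\<in>{s \<xi>}. indicator (?A v) \<xi> *\<^sub>R v)"
        using \<xi> by (intro sum.mono_neutral_right[OF F]) auto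
      also have "\<dots> = s \<xi>" using \<xi> by simp
      finally show "s \<xi> = (\<Sum>v\<in>?F. indicator (?A v) \<xi> *\<^sub>R v)" by (rule sym)
    qed
    also have "\<dots> = (\<Sum>v\<in>?F. (\<integral>\<xi>. indicator (?A v) \<xi> *\<^sub>R v \<partial>mu_at x))"
      using Am by (intro Bochner_Integration.integral_sum) (auto intro!: integrable_real_indicator simp: less_top[symmetric])
    also have "\<dots> = (\<Sum>v\<in>?F. measure (mu_at x) (?A v) *\<^sub>R v)"
      using Am by (intro sum.cong refl) (simp add: integrable_real_indicator less_top[symmetric])
    also have "\<dots> = (\<Sum>v\<in>?F. cinner ((v *\<^sub>C \<mu> (?A v)) x) x)"
      by (intro sum.cong refl)
        (simp add: scaleC_blinfun.rep_eq cinner_simps measure_mu[OF A] scaleR_conv_of_real mult.commute)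
    also have "\<dots> = cinner (T x) x"
      unfolding T_def by (simp add: blinfun.sum_left cinner.sum_left)
    finally show ?thesis by simp
  qed
  with cT[OF F] show thesis by (intro that[of T]) (auto simp: T_def)
qed

end

context
  fixes \<mu> :: "complex set \<Rightarrow> 'm::chilbert \<Rightarrow>\<^sub>L 'm"
  assumes \<mu>': "probability_op_measure \<mu>"
begin

lemma op_measure_mu: "op_measure \<mu>"
  using \<mu>' by (simp add: probability_op_measure_def)

lemma measure_mu_total: "measure (scalar_measure \<mu> x) (sphere 0 1) = (norm x)\<^sup>2"
proof -
  have "complex_of_real (measure (scalar_measure \<mu> x) (sphere 0 1)) = cinner x x"
    using measure_mu[OF op_measure_mu sphere_circle_sets, where x = x] \<mu>'
    by (simp add: probability_op_measure_def)
  then show ?thesis unfolding cinner_self of_real_eq_iff .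
qed

lemma integral_bound:
  "bounded_borel f B \<Longrightarrow> cmod (\<integral>\<xi>. f \<xi> \<partial>scalar_measure \<mu> x) \<le> B * (norm x)\<^sup>2"
  using integral_mu_bound[OF op_measure_mu, of f B x] by (simp add: measure_mu_total)

text \<open>
  Simple functions converge to \<open>f\<close> pointwise and boundedly, so that the quadratic forms converge by dominated
  convergence.
\<close>

lemma op_integral_exists:
  assumes f: "bounded_borel f B"
  obtains T where "cbl T" "\<And>x. cinner (blinfun_apply T x) x = (\<integral>\<xi>. f \<xi> \<partial>scalar_measure \<mu> x)"
proof -
  have fm: "f \<in> borel_measurable circle_borel" and fB: "\<And>\<xi>. \<xi> \<in> sphere 0 1 \<Longrightarrow> cmod (f \<xi>) \<le> B" and B: "0 \<le> B"
    using f by (auto simp: bounded_borel_def)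
  obtain s where s: "\<And>i. simple_function circle_borel (s i)"
    "\<And>\<xi>. \<xi> \<in> sphere 0 1 \<Longrightarrow> (\<lambda>i. s i \<xi>) \<longlonglongrightarrow> f \<xi>"
    "\<And>i \<xi>. \<xi> \<in> sphere 0 1 \<Longrightarrow> cmod (s i \<xi>) \<le> 2 * cmod (f \<xi>)"
  proof -
    obtain F where F: "(\<forall>i. simple_function circle_borel (F i)) \<and>
      (\<forall>x\<in>space circle_borel. (\<lambda>i. F i x) \<longlonglongrightarrow> f x) \<and>
      (\<forall>i. \<forall>x\<in>space circle_borel. dist (F i x) 0 \<le> 2 * dist (f x) 0)"
      using borel_measurable_implies_sequence_metric[OF fm, of 0] by blast
    show thesis by (rule that[of F]) (use F in auto)
  qed
  have sb: "bounded_borel (s i) (2 * B)" for i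
    using order_trans[OF s(3) mult_left_mono[OF fB]] borel_measurable_simple_function[OF s(1)] B
    by (auto simp: bounded_borel_def)
  have "\<exists>T. cbl T \<and> (\<forall>x. cinner (blinfun_apply T x) x = (\<integral>\<xi>. s i \<xi> \<partial>scalar_measure \<mu> x))" for i
    using simple_integral_operator[OF op_measure_mu s(1)[of i]] by metis
  then obtain T where T: "\<And>i. cbl (T i)"
    "\<And>i x. cinner (blinfun_apply (T i) x) x = (\<integral>\<xi>. s i \<xi> \<partial>scalar_measure \<mu> x)" by metis
  show thesis
  proof (rule tendsto_quadratic_form_operator[of T "2 * (2 * B)" "\<lambda>x. \<integral>\<xi>. f \<xi> \<partial>scalar_measure \<mu> x"])
    show "norm (T i) \<le> 2 * (2 * B)" for i
      using integral_bound[OF sb] B by (intro norm_le_quadratic_form T) (auto simp: T(2))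
    fix x
    interpret finite_measure "scalar_measure \<mu> x" by (rule finite_measure_mu[OF op_measure_mu])
    show "(\<lambda>i. cinner (T i x) x) \<longlonglongrightarrow> (\<integral>\<xi>. f \<xi> \<partial>scalar_measure \<mu> x)"
      unfolding T(2)
    proof (rule integral_dominated_convergence[where w = "\<lambda>_. 2 * B"])
      show "AE \<xi> in scalar_measure \<mu> x. (\<lambda>i. s i \<xi>) \<longlonglongrightarrow> f \<xi>"
        using s(2) by (intro AE_I2) (simp add: space_mu[OF op_measure_mu])
      show "AE \<xi> in scalar_measure \<mu> x. norm (s i \<xi>) \<le> 2 * B" for i
        using sb by (intro AE_I2) (simp add: space_mu[OF op_measure_mu] bounded_borel_def)
      show "f \<in> borel_measurable (scalar_measure \<mu> x)" "s i \<in> borel_measurable (scalar_measure \<mu> x)" for i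
        by (intro measurable_mu[OF op_measure_mu] fm borel_measurable_simple_function[OF s(1)])+
    qed simp
  qed (auto intro: T that)
qed

lemma op_integral_eqI:
  assumes "cbl T" "\<And>x. cinner (blinfun_apply T x) x = (\<integral>\<xi>. f \<xi> \<partial>scalar_measure \<mu> x)"
  shows "op_integral \<mu> f = T"
  unfolding op_integral_def
  by (rule the_equality) (use assms in \<open>auto intro: quadratic_form_determines\<close>)

lemma op_integral_form:
  assumes "bounded_borel f B"
  shows "cbl (op_integral \<mu> f)" "cinner (op_integral \<mu> f x) x = (\<integral>\<xi>. f \<xi> \<partial>scalar_measure \<mu> x)"
proof -
  obtain T where T: "cbl T" "\<And>x. cinner (blinfun_apply T x) x = (\<integral>\<xi>. f \<xi> \<partial>scalar_measure \<mu> x)"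
    using op_integral_exists[OF assms] by metis
  show "cbl (op_integral \<mu> f)" "cinner (op_integral \<mu> f x) x = (\<integral>\<xi>. f \<xi> \<partial>scalar_measure \<mu> x)"
    unfolding op_integral_eqI[OF T] by (rule T)+
qed

section \<open>The functions \<open>F\<close> and \<open>E\<close>\<close>

definition power_moment :: "nat \<Rightarrow> 'm \<Rightarrow> complex" where
  "power_moment k x = (\<integral>\<xi>. \<xi> powi (- int k) \<partial>scalar_measure \<mu> x)"

lemma bounded_borel_powi: "bounded_borel (\<lambda>\<xi>. \<xi> powi n) 1"
  by (rule bounded_borel_continuous) (auto intro!: continuous_intros simp: norm_power_int)

lemma bounded_borel_kernel:
  assumes z: "cmod z < 1"
  shows "bounded_borel (\<lambda>\<xi>. (\<xi> + z) / (\<xi> - z)) (2 / (1 - cmod z))"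
proof (rule bounded_borel_continuous)
  show "continuous_on (sphere 0 1) (\<lambda>\<xi>. (\<xi> + z) / (\<xi> - z))"
    using z by (intro continuous_intros) auto
  fix \<xi> :: complex assume \<xi>: "cmod \<xi> = 1"
  have "cmod (\<xi> + z) \<le> 2" using norm_triangle_ineq[of \<xi> z] \<xi> z by simp
  moreover have "1 - cmod z \<le> cmod (\<xi> - z)" using norm_triangle_ineq2[of \<xi> z] \<xi> by simp
  ultimately show "cmod ((\<xi> + z) / (\<xi> - z)) \<le> 2 / (1 - cmod z)"
    using z unfolding norm_divide by (intro frac_le) auto
qed (use z in auto)

text \<open>
  Half of the kernel plus 1 is \<open>\<xi> / (\<xi> - z) = \<Sum> (z / \<xi>)\<^sup>k\<close>.
\<close>

lemma power_moment_sums: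
  assumes z: "cmod z < 1"
  shows "(\<lambda>k. power_moment k x * z ^ k) sums ((cinner (F_fun \<mu> z x) x + of_real ((norm x)\<^sup>2)) / 2)"
proof -
  let ?M = "scalar_measure \<mu> x"
  interpret finite_measure ?M by (rule finite_measure_mu[OF op_measure_mu])
  note sp = space_mu[OF op_measure_mu] and im = integrable_mu[OF op_measure_mu]
  define f where "f k \<xi> = \<xi> powi (- int k) * z ^ k" for k \<xi>
  have nf: "cmod (f k \<xi>) = cmod z ^ k" if "\<xi> \<in> sphere 0 1" for k \<xi>
    using that by (simp add: f_def norm_mult norm_power norm_power_int)
  have fi: "integrable ?M (f k)" for k
    unfolding f_def[abs_def] by (intro integrable_mult_left im[OF bounded_borel_powi])
  have "(\<lambda>k. integral\<^sup>L ?M (f k)) sums (\<integral>\<xi>. (\<Sum>k. f k \<xi>) \<partial>?M)"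
  proof (rule sums_integral[OF fi])
    show "AE \<xi> in ?M. summable (\<lambda>k. norm (f k \<xi>))"
      using z by (intro AE_I2) (simp add: sp nf summable_geometric)
    have "(\<integral>\<xi>. norm (f k \<xi>) \<partial>?M) = (\<integral>\<xi>. cmod z ^ k \<partial>?M)" for k
      by (rule Bochner_Integration.integral_cong[OF refl]) (simp add: sp nf)
    then have "(\<integral>\<xi>. norm (f k \<xi>) \<partial>?M) = (norm x)\<^sup>2 * cmod z ^ k" for k
      by (simp add: sp measure_mu_total)
    then show "summable (\<lambda>k. \<integral>\<xi>. norm (f k \<xi>) \<partial>?M)"
      using z by (simp add: summable_mult summable_geometric)
  qed
  moreover have "integral\<^sup>L ?M (f k) = power_moment k x * z ^ k" for k
    unfolding f_def[abs_def] power_moment_def by simp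
  moreover have "(\<integral>\<xi>. (\<Sum>k. f k \<xi>) \<partial>?M) = (\<integral>\<xi>. ((\<xi> + z) / (\<xi> - z) + 1) / 2 \<partial>?M)"
  proof (rule Bochner_Integration.integral_cong[OF refl])
    fix \<xi> assume "\<xi> \<in> space ?M"
    then have \<xi>: "cmod \<xi> = 1" "\<xi> \<noteq> 0" by (auto simp: sp)
    have "f k \<xi> = (z / \<xi>) ^ k" for k
      by (simp add: f_def power_int_minus divide_inverse power_mult_distrib power_inverse mult.commute)
    then have "(\<Sum>k. f k \<xi>) = 1 / (1 - z / \<xi>)"
      using z \<xi> by (simp add: suminf_geometric norm_divide)
    also have "\<dots> = ((\<xi> + z) / (\<xi> - z) + 1) / 2"
    proof -
      have "\<xi> - z \<noteq> 0" using z \<xi> by auto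
      then show ?thesis using \<xi> by (simp add: field_simps)
    qed
    finally show "(\<Sum>k. f k \<xi>) = ((\<xi> + z) / (\<xi> - z) + 1) / 2" .
  qed
  moreover have "(\<integral>\<xi>. ((\<xi> + z) / (\<xi> - z) + 1) / 2 \<partial>?M) = (cinner (F_fun \<mu> z x) x + of_real ((norm x)\<^sup>2)) / 2"
    using im[OF bounded_borel_kernel[OF z]] op_integral_form(2)[OF bounded_borel_kernel[OF z], of x]
    by (simp add: F_fun_def sp measure_mu_total scaleR_conv_of_real)
  ultimately show ?thesis by simp
qed

lemma cbl_F: "cmod z < 1 \<Longrightarrow> cbl (F_fun \<mu> z)"
  unfolding F_fun_def by (rule op_integral_form(1)[OF bounded_borel_kernel])

lemma norm_F: assumes "cmod z < 1" shows "norm (F_fun \<mu> z) \<le> 4 / (1 - cmod z)"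
proof -
  have "norm (F_fun \<mu> z) \<le> 2 * (2 / (1 - cmod z))"
    using assms integral_bound[OF bounded_borel_kernel[OF assms]]
    by (intro norm_le_quadratic_form cbl_F)
      (auto simp: F_fun_def op_integral_form(2)[OF bounded_borel_kernel[OF assms]])
  then show ?thesis by simp
qed

text \<open>
  The real part of the kernel is the Poisson kernel.
\<close>

lemma Re_F:
  assumes z: "cmod z < 1"
  shows "0 \<le> Re (cinner (F_fun \<mu> z x) x)"
proof -
  let ?M = "scalar_measure \<mu> x"
  have "Re (cinner (F_fun \<mu> z x) x) = (\<integral>\<xi>. Re ((\<xi> + z) / (\<xi> - z)) \<partial>?M)"
    unfolding F_fun_def op_integral_form(2)[OF bounded_borel_kernel[OF z]]
    by (rule integral_Re[symmetric, OF integrable_mu[OF op_measure_mu bounded_borel_kernel[OF z]]])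
  also have "0 \<le> \<dots>"
  proof (rule integral_nonneg_AE, rule AE_I2)
    fix \<xi> assume "\<xi> \<in> space ?M"
    then have \<xi>: "cmod \<xi> = 1" by (simp add: space_mu[OF op_measure_mu])
    have "Re ((\<xi> + z) * cnj (\<xi> - z)) = (cmod \<xi>)\<^sup>2 - (cmod z)\<^sup>2"
      by (simp only: cmod_power2) (simp add: power2_eq_square algebra_simps)
    also have "0 \<le> \<dots>" using \<xi> z by (simp add: power_le_one)
    finally have "0 \<le> Re ((\<xi> + z) * cnj (\<xi> - z)) / (cmod (\<xi> - z))\<^sup>2" by simp
    also have "\<dots> = Re ((\<xi> + z) / (\<xi> - z))"
      unfolding complex_div_cnj[of "\<xi> + z"] by (simp only: of_real_power[symmetric] Re_divide_of_real)
    finally show "0 \<le> Re ((\<xi> + z) / (\<xi> - z))" .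
  qed
  finally show ?thesis .
qed

lemma F_0: "F_fun \<mu> 0 = id_blinfun"
  unfolding F_fun_def
proof (rule op_integral_eqI)
  fix x
  let ?M = "scalar_measure \<mu> x"
  interpret finite_measure ?M by (rule finite_measure_mu[OF op_measure_mu])
  have "(\<integral>\<xi>. (\<xi> + 0) / (\<xi> - 0) \<partial>?M) = (\<integral>\<xi>. 1 \<partial>?M)"
    by (rule Bochner_Integration.integral_cong[OF refl]) (auto simp: space_mu[OF op_measure_mu])
  also have "\<dots> = of_real ((norm x)\<^sup>2)"
    by (simp add: space_mu[OF op_measure_mu] measure_mu_total scaleR_conv_of_real)
  finally show "cinner (id_blinfun x) x = (\<integral>\<xi>. (\<xi> + 0) / (\<xi> - 0) \<partial>?M)" by (simp add: cinner_self)
qed simp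

text \<open>
  The quadratic forms are power series in \<open>z\<close>; polarization and \<open>form_family_holomorphic\<close> do the rest.
\<close>

lemma holomorphic_F: "holomorphic_op (F_fun \<mu>) (ball 0 1)"
proof -
  have quad: "(\<lambda>z. cinner (F_fun \<mu> z x) x) holomorphic_on ball 0 1" for x
  proof -
    have "(\<lambda>z. (cinner (F_fun \<mu> z x) x + of_real ((norm x)\<^sup>2)) / 2) holomorphic_on ball 0 1"
    proof (rule power_series_holomorphic)
      fix w :: complex assume "w \<in> ball 0 1"
      then show "(\<lambda>k. power_moment k x * (w - 0) ^ k) sums ((cinner (F_fun \<mu> w x) x + of_real ((norm x)\<^sup>2)) / 2)"
        using power_moment_sums[of w x] by simp
    qed
    note h = holomorphic_on_diff[OF holomorphic_on_mult[OF holomorphic_on_const[of 2] this]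
        holomorphic_on_const[of "of_real ((norm x)\<^sup>2)"]]
    show ?thesis by (rule holomorphic_transform[OF h]) (simp add: field_simps)
  qed
  have form: "(\<lambda>z. cinner (F_fun \<mu> z x) y) holomorphic_on ball 0 1" for x y
  proof (rule holomorphic_transform)
    show "(\<lambda>z. (cinner (F_fun \<mu> z (x + y)) (x + y) - cinner (F_fun \<mu> z (x - y)) (x - y)
      + \<i> * cinner (F_fun \<mu> z (x + \<i> *\<^sub>C y)) (x + \<i> *\<^sub>C y) - \<i> * cinner (F_fun \<mu> z (x - \<i> *\<^sub>C y)) (x - \<i> *\<^sub>C y)) / 4)
      holomorphic_on ball 0 1"
      by (intro holomorphic_intros quad) simp
    show "(cinner (F_fun \<mu> z (x + y)) (x + y) - cinner (F_fun \<mu> z (x - y)) (x - y)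
      + \<i> * cinner (F_fun \<mu> z (x + \<i> *\<^sub>C y)) (x + \<i> *\<^sub>C y) - \<i> * cinner (F_fun \<mu> z (x - \<i> *\<^sub>C y)) (x - \<i> *\<^sub>C y)) / 4
      = cinner (F_fun \<mu> z x) y" if "z \<in> ball 0 1" for z
      using that unfolding polarization[OF cbl_F, symmetric, of z, OF that[simplified]] by simp
  qed
  obtain T where T: "holomorphic_op T (ball 0 1)"
    "\<And>z x y. z \<in> ball 0 1 \<Longrightarrow> cinner (blinfun_apply (T z) (id_blinfun x)) (id_blinfun y) = cinner (F_fun \<mu> z x) y"
  proof (rule form_family_holomorphic[of "id_blinfun :: 'm \<Rightarrow>\<^sub>L 'm" "id_blinfun :: 'm \<Rightarrow>\<^sub>L 'm"
      "\<lambda>z x y. cinner (F_fun \<mu> z x) y" "\<lambda>r. 4 / (1 - r)"])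
    fix r :: real and z :: complex and x y :: 'm assume r: "0 < r" "r < 1" "z \<in> ball 0 r"
    have "cmod (cinner (F_fun \<mu> z x) y) \<le> norm (F_fun \<mu> z x) * norm y" by (rule cinner_Cauchy_Schwarz)
    also have "\<dots> \<le> (norm (F_fun \<mu> z) * norm x) * norm y" by (intro mult_right_mono norm_blinfun) simp
    also have "\<dots> \<le> (4 / (1 - r) * norm x) * norm y"
    proof (intro mult_right_mono)
      have "norm (F_fun \<mu> z) \<le> 4 / (1 - cmod z)" using r by (intro norm_F) auto
      also have "\<dots> \<le> 4 / (1 - r)" using r by (intro divide_left_mono mult_pos_pos) auto
      finally show "norm (F_fun \<mu> z) \<le> 4 / (1 - r)" .
    qed auto
    finally show "cmod (cinner (F_fun \<mu> z x) y) \<le> 4 / (1 - r) * norm (id_blinfun x :: 'm) * norm (id_blinfun y :: 'm)"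
      by simp
  qed (auto intro!: form sesquilinear_cinner cbl_F)
  show ?thesis
  proof (rule holomorphic_op_cong[OF open_ball T(1)])
    show "F_fun \<mu> z = T z" if "z \<in> ball 0 1" for z
      using T(2)[OF that] by (intro blinfun_eqI cinner_extI) simp
  qed
qed

lemma F_plus_inverse:
  assumes "cmod z < 1"
  shows "is_inverse_on UNIV (F_fun \<mu> z + id_blinfun) (op_inv UNIV (F_fun \<mu> z + id_blinfun))"
    "norm (op_inv UNIV (F_fun \<mu> z + id_blinfun)) \<le> 1"
proof -
  obtain R where R: "is_inverse_on UNIV (F_fun \<mu> z + id_blinfun) R" "norm R \<le> 1"
  proof (rule coercive_inverse)
    show "cbl (F_fun \<mu> z + id_blinfun)" by (intro cbl_add cbl_F assms) simp
    show "(norm x)\<^sup>2 \<le> Re (cinner ((F_fun \<mu> z + id_blinfun) x) x)" for x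
      using Re_F[OF assms, of x] by (simp add: blinfun.add_left cinner_simps cinner_self)
  qed
  then show "is_inverse_on UNIV (F_fun \<mu> z + id_blinfun) (op_inv UNIV (F_fun \<mu> z + id_blinfun))"
    "norm (op_inv UNIV (F_fun \<mu> z + id_blinfun)) \<le> 1"
    by (simp_all add: op_inv_eqI[OF closed_csubspace_UNIV R(1)])
qed

definition cayley_F :: "complex \<Rightarrow> 'm \<Rightarrow>\<^sub>L 'm" where
  "cayley_F z = (F_fun \<mu> z - id_blinfun) o\<^sub>L op_inv UNIV (F_fun \<mu> z + id_blinfun)"

lemma bop_UNIV: "T \<in> bop UNIV UNIV \<longleftrightarrow> cbl T"
  using bopD(1) bopI[OF closed_csubspace_UNIV, of T] by (auto simp: proj_ident)

lemma op_inv_F_apply: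
  assumes "cmod z < 1"
  shows "op_inv UNIV (F_fun \<mu> z + id_blinfun) (F_fun \<mu> z x + x) = x"
    "F_fun \<mu> z (op_inv UNIV (F_fun \<mu> z + id_blinfun) x) + op_inv UNIV (F_fun \<mu> z + id_blinfun) x = x"
proof -
  note i = F_plus_inverse(1)[OF assms, unfolded is_inverse_on_def proj_UNIV]
  show "op_inv UNIV (F_fun \<mu> z + id_blinfun) (F_fun \<mu> z x + x) = x"
    using arg_cong[OF conjunct1[OF conjunct2[OF i]], of "\<lambda>S. blinfun_apply S x"] by (simp add: blinfun.add_left)
  show "F_fun \<mu> z (op_inv UNIV (F_fun \<mu> z + id_blinfun) x) + op_inv UNIV (F_fun \<mu> z + id_blinfun) x = x"
    using arg_cong[OF conjunct2[OF conjunct2[OF i]], of "\<lambda>S. blinfun_apply S x"] by (simp add: blinfun.add_left)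
qed

text \<open>
  For \<open>x = (F + I) u\<close> the image is \<open>(F - I) u\<close>, and the squares of the two norms differ by \<open>4 Re \<langle>F u, u\<rangle> \<ge> 0\<close>.
\<close>

lemma cayley_F_schur: "cayley_F \<in> schur_class UNIV UNIV"
proof -
  let ?R = "\<lambda>z. op_inv UNIV (F_fun \<mu> z + id_blinfun)"
  have cR: "cbl (?R z)" if "cmod z < 1" for z
    using F_plus_inverse(1)[OF that] bopD(1) by (auto simp: is_inverse_on_def)
  have hFI: "holomorphic_op (\<lambda>z. F_fun \<mu> z + id_blinfun) (ball 0 1)"
    using holomorphic_op_diff[OF open_ball holomorphic_F holomorphic_op_const[OF open_ball, of "- id_blinfun :: 'm \<Rightarrow>\<^sub>L 'm"]]
    by simp
  have hR: "holomorphic_op ?R (ball 0 1)"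
    by (rule holomorphic_op_inverse[OF open_ball closed_csubspace_UNIV hFI, of _ 1])
      (auto simp: bop_UNIV intro!: F_plus_inverse cbl_add cbl_F)
  have "holomorphic_op cayley_F (ball 0 1)"
    unfolding cayley_F_def[abs_def]
    by (intro holomorphic_op_compose holomorphic_op_diff holomorphic_F holomorphic_op_const open_ball hR)
      (auto intro!: cbl_diff cbl_F)
  moreover have "cbl (cayley_F z)" "norm (cayley_F z) \<le> 1" if z: "cmod z < 1" for z
  proof -
    show "cbl (cayley_F z)" unfolding cayley_F_def by (intro cbl_compose cbl_diff cbl_F cR z) simp
    show "norm (cayley_F z) \<le> 1"
    proof (rule norm_blinfun_bound)
      fix x
      define u where "u = ?R z x"
      have x: "x = F_fun \<mu> z u + u" unfolding u_def using op_inv_F_apply(2)[OF z, of x] by simp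
      have "cayley_F z x = F_fun \<mu> z u - u" by (simp add: cayley_F_def u_def blinfun.diff_left)
      then have "(norm (cayley_F z x))\<^sup>2 \<le> (norm x)\<^sup>2"
        unfolding x using Re_F[OF z, of u] by (simp add: norm_add_square norm_diff_square)
      then show "norm (cayley_F z x) \<le> 1 * norm x" using power2_le_imp_le[OF _ norm_ge_zero] by simp
    qed simp
  qed
  ultimately show ?thesis by (simp add: schur_class_def bop_UNIV)
qed

text \<open>
  The Cayley transform vanishes at 0, so that the Schwarz lemma divides it by \<open>z\<close>; the quotient is continuous, and
  its value at 0 is the limit that defines \<open>E(0)\<close>.
\<close>

lemma
  shows E_fun_schur: "E_fun \<mu> \<in> schur_class UNIV UNIV"
    and E_fun_cayley: "cmod z < 1 \<Longrightarrow> z *\<^sub>C E_fun \<mu> z = cayley_F z"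
proof -
  have "cayley_F 0 = 0" by (rule blinfun_eqI) (simp add: cayley_F_def F_0)
  then obtain \<Psi> where \<Psi>: "\<Psi> \<in> schur_class UNIV UNIV" "\<And>z. z \<in> ball 0 1 \<Longrightarrow> cayley_F z = z *\<^sub>C \<Psi> z"
    using schur_schwarz[OF closed_csubspace_UNIV closed_csubspace_UNIV cayley_F_schur] by blast
  have q: "E_quotient \<mu> z = \<Psi> z" if "z \<in> ball 0 1" "z \<noteq> 0" for z
    using \<Psi>(2)[OF that(1)] that(2) by (simp add: E_quotient_def cayley_F_def[symmetric] scaleC_scaleC)
  have "(\<Psi> \<longlongrightarrow> \<Psi> 0) (at 0)"
    by (rule holomorphic_op_continuous[OF open_ball]) (use \<Psi>(1) in \<open>auto simp: schur_class_def\<close>)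
  moreover have "\<forall>\<^sub>F z in at 0. E_quotient \<mu> z = \<Psi> z"
    unfolding eventually_at by (rule exI[of _ 1]) (use q in \<open>auto simp: dist_norm\<close>)
  ultimately have "(E_quotient \<mu> \<longlongrightarrow> \<Psi> 0) (at 0)" by (simp cong: tendsto_cong)
  then have "Lim (at 0) (E_quotient \<mu>) = \<Psi> 0" by (intro tendsto_Lim) auto
  then have E: "E_fun \<mu> z = \<Psi> z" if "z \<in> ball 0 1" for z
    using q[OF that] by (simp add: E_fun_def)
  show "E_fun \<mu> \<in> schur_class UNIV UNIV"
    using \<Psi>(1) holomorphic_op_cong[of "ball 0 1" \<Psi> "E_fun \<mu>"] E by (simp add: schur_class_def)
  show "z *\<^sub>C E_fun \<mu> z = cayley_F z" if "cmod z < 1"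
    using E[of z] \<Psi>(2)[of z] that by simp
qed

lemma E_fun_apply:
  assumes z: "cmod z < 1"
  shows "z *\<^sub>C E_fun \<mu> z (F_fun \<mu> z x + x) = F_fun \<mu> z x - x"
  using arg_cong[OF E_fun_cayley[OF z], of "\<lambda>S. blinfun_apply S (F_fun \<mu> z x + x)"]
  by (simp add: scaleC_blinfun.rep_eq cayley_F_def op_inv_F_apply(1)[OF z] blinfun.diff_left)

end

section \<open>The moments of the CMV matrix\<close>

text \<open>
  The recursion for \<open>schur_iterate\<close> changes the spaces before it descends, the recursion for the parameter
  spaces afterwards. Iterating one map on triples describes both.
\<close>

definition schur_state_step ::
  "'a::chilbert set \<times> 'b::chilbert set \<times> (complex \<Rightarrow> 'a \<Rightarrow>\<^sub>L 'b) \<Rightarrow> 'a set \<times> 'b set \<times> (complex \<Rightarrow> 'a \<Rightarrow>\<^sub>L 'b)"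
  where "schur_state_step = (\<lambda>(A, B, \<Theta>). (defect_space A (\<Theta> 0), defect_space B (adj (\<Theta> 0)), schur_next A B \<Theta>))"

lemma schur_state_step [simp]:
  "schur_state_step (A, B, \<Theta>) = (defect_space A (\<Theta> 0), defect_space B (adj (\<Theta> 0)), schur_next A B \<Theta>)"
  by (simp add: schur_state_step_def)

lemma schur_iterate_state: "schur_iterate n A B \<Theta> = snd (snd ((schur_state_step ^^ n) (A, B, \<Theta>)))"
  by (induction n arbitrary: A B \<Theta>) (simp_all add: funpow_Suc_right del: funpow.simps(2))

lemma schur_param_state:
  "(schur_state_step ^^ n) (UNIV, UNIV, \<Theta>)
    = (param_dom (schur_parameter UNIV UNIV \<Theta>) n, param_cod (schur_parameter UNIV UNIV \<Theta>) n, schur_iterate n UNIV UNIV \<Theta>)"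
proof (induction n)
  case (Suc n)
  let ?G = "schur_parameter UNIV UNIV \<Theta>"
  have 1: "(schur_state_step ^^ Suc n) (UNIV, UNIV, \<Theta>) = (param_dom ?G (Suc n), param_cod ?G (Suc n),
      schur_next (param_dom ?G n) (param_cod ?G n) (schur_iterate n UNIV UNIV \<Theta>))"
    by (simp add: Suc) (simp add: schur_parameter_def)
  then show ?case
    using schur_iterate_state[of "Suc n" UNIV UNIV \<Theta>] by (simp only: fst_conv snd_conv)
qed simp

lemma schur_iterate_Suc:
  "schur_iterate (Suc n) UNIV UNIV \<Theta> = schur_next (param_dom (schur_parameter UNIV UNIV \<Theta>) n)
    (param_cod (schur_parameter UNIV UNIV \<Theta>) n) (schur_iterate n UNIV UNIV \<Theta>)"
  unfolding schur_iterate_state[of "Suc n"] by (simp add: schur_param_state)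

lemma schur_iterate_schur_class:
  assumes "\<Theta> \<in> schur_class UNIV UNIV" and "G = schur_parameter UNIV UNIV \<Theta>"
  shows "closed_csubspace (param_dom G n) \<and> closed_csubspace (param_cod G n) \<and>
    schur_iterate n UNIV UNIV \<Theta> \<in> schur_class (param_dom G n) (param_cod G n)"
proof (induction n)
  case (Suc n)
  then have A: "closed_csubspace (param_dom G n)" and B: "closed_csubspace (param_cod G n)"
    and \<Theta>: "schur_iterate n UNIV UNIV \<Theta> \<in> schur_class (param_dom G n) (param_cod G n)" by auto
  have g: "schur_iterate n UNIV UNIV \<Theta> 0 = G n" by (simp add: assms schur_parameter_def)
  note c = schur_class_contraction[OF A B \<Theta>, of 0, simplified, unfolded g]
  show ?case
    using schur_next_props(1)[OF A B \<Theta>] defect_space_closed[OF c] defect_space_closed[OF contraction_adj[OF c]]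
    by (simp add: schur_iterate_Suc assms(2)[symmetric] g del: schur_iterate.simps)
qed (use assms in simp)

lemma contractive_params_schur:
  assumes "\<Theta> \<in> schur_class UNIV UNIV" and "G = schur_parameter UNIV UNIV \<Theta>"
  shows "contractive_params G"
  unfolding contractive_params_def
proof
  fix n
  have "schur_iterate n UNIV UNIV \<Theta> 0 = G n" by (simp add: assms schur_parameter_def)
  then show "contraction (param_dom G n) (param_cod G n) (G n)"
    using schur_iterate_schur_class[OF assms, of n] schur_class_contraction[of "param_dom G n" "param_cod G n" "schur_iterate n UNIV UNIV \<Theta>" 0]
    by simp
qed

text \<open>
  From \<open>X\<^sub>0 = x\<close> on, \<open>schur_next_props\<close> supplies vectors \<open>X\<^sub>n\<close> which, together with \<open>Y\<^sub>n = \<Theta>\<^sub>n(z) X\<^sub>n\<close>, satisfy the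
  recursion of \<open>cmv_resolvent_vector\<close>.
\<close>

lemma cmv_transfer_series:
  fixes \<Theta> :: "complex \<Rightarrow> 'm::chilbert \<Rightarrow>\<^sub>L 'm"
  assumes \<Theta>: "\<Theta> \<in> schur_class UNIV UNIV" and G: "G = schur_parameter UNIV UNIV \<Theta>" and z: "cmod z \<le> 1 / 2"
  shows "(\<lambda>k. z ^ k * cinner ((cmv G ^^ k) (x - z *\<^sub>C \<Theta> z x, 0)) (y, 0)) sums cinner x y"
proof -
  let ?\<Theta> = "\<lambda>n. schur_iterate n UNIV UNIV \<Theta>"
  note cp = contractive_params_schur[OF \<Theta> G] and sc = schur_iterate_schur_class[OF \<Theta> G]
  have zb: "z \<in> ball 0 1" using z by simp
  have g: "?\<Theta> n 0 = G n" for n by (simp add: G schur_parameter_def)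
  have "\<exists>X. \<forall>n. (X n \<in> param_dom G n \<and> (n = 0 \<longrightarrow> X n = x)) \<and>
    param_rotation G n (X n, z *\<^sub>C ?\<Theta> (Suc n) z (X (Suc n))) = (?\<Theta> n z (X n), X (Suc n))"
  proof (rule dependent_nat_choice)
    fix X n assume X: "X \<in> param_dom G n \<and> (n = 0 \<longrightarrow> X = x)"
    obtain X' where "X' \<in> defect_space (param_dom G n) (?\<Theta> n 0)"
      "elementary_rotation (param_dom G n) (param_cod G n) (?\<Theta> n 0)
        (X, z *\<^sub>C schur_next (param_dom G n) (param_cod G n) (?\<Theta> n) z X') = (?\<Theta> n z X, X')"
      using schur_next_props(2)[of "param_dom G n" "param_cod G n" "?\<Theta> n" z X] sc[of n] zb X by blast
    then show "\<exists>X'. (X' \<in> param_dom G (Suc n) \<and> (Suc n = 0 \<longrightarrow> X' = x)) \<and>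
      param_rotation G n (X, z *\<^sub>C ?\<Theta> (Suc n) z X') = (?\<Theta> n z X, X')"
      by (intro exI[of _ X'])
        (simp add: g schur_iterate_Suc G[symmetric] param_rotation_def del: schur_iterate.simps)
  qed simp
  then obtain X where X: "\<And>n. X n \<in> param_dom G n" "X 0 = x"
    "\<And>n. param_rotation G n (X n, z *\<^sub>C ?\<Theta> (Suc n) z (X (Suc n))) = (?\<Theta> n z (X n), X (Suc n))"
    by blast
  have cz: "contraction (param_dom G n) (param_cod G n) (?\<Theta> n z)" for n
    using schur_class_contraction sc zb by blast
  obtain v where v: "v \<in> UNIV \<times> cmv_sum G" "fst v = X 0"
    "v = (X 0 - z *\<^sub>C ?\<Theta> 0 z (X 0), 0) + z *\<^sub>C cmv G v"
    by (rule cmv_resolvent_vector[OF cp z X(1) contractionD(6)[OF cz] X(3) contractionD(8)[OF cz]])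
  show ?thesis
    using cmv_resolvent_series[OF cp z v(1,3), of y] by (simp add: v(2) X(2))
qed

lemma power_series_coeff_unique:
  fixes a b :: "nat \<Rightarrow> complex"
  assumes r: "0 < r" and a: "\<And>z. cmod z < r \<Longrightarrow> (\<lambda>k. a k * z ^ k) sums f z"
    and b: "\<And>z. cmod z < r \<Longrightarrow> (\<lambda>k. b k * z ^ k) sums f z"
  shows "a k = b k"
proof (rule ccontr)
  assume ne: "a k \<noteq> b k"
  have s: "(\<lambda>k. (a k - b k) * (z - 0) ^ k) sums 0" if "cmod (z - 0) < r" for z
    using sums_diff[OF a[of z] b[of z]] that by (simp add: left_diff_distrib)
  have "(\<lambda>k. (a k - b k) * 0 ^ k) sums 0" using s[of 0] r by simp
  then have "0 = a 0 - b 0" by (rule sums_unique2[OF _ powser_sums_zero[of "\<lambda>k. a k - b k"]])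
  then have "a 0 = b 0" by simp
  then have "k > 0" using ne by (cases k) auto
  obtain t where t: "0 < t" "\<And>z::complex. z \<in> cball 0 t - {0} \<Longrightarrow> (\<lambda>_. 0::complex) z \<noteq> 0"
  proof (rule powser_0_nonzero[where a = "\<lambda>k. a k - b k" and f = "\<lambda>_. 0" and \<xi> = 0 and m = k, OF r])
    show "a k - b k \<noteq> 0" using ne by simp
  qed (use s \<open>k > 0\<close> that in blast)+
  have "complex_of_real t \<in> cball 0 t - {0}" using t(1) by auto
  then show False using t(2) by blast
qed

lemma cmv_moments:
  assumes \<mu>: "probability_op_measure \<mu>" and G: "G = schur_parameter UNIV UNIV (E_fun \<mu>)"
  shows "cinner ((cmv G ^^ k) (x, 0)) (x, 0) = (\<integral>\<xi>. \<xi> powi (- int k) \<partial>scalar_measure \<mu> x)"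
proof -
  have "cinner ((cmv G ^^ k) (x, 0)) (x, 0) = power_moment \<mu> k x"
  proof (rule power_series_coeff_unique[of "1/2" _ "\<lambda>z. (cinner (F_fun \<mu> z x) x + of_real ((norm x)\<^sup>2)) / 2"])
    fix z :: complex assume z: "cmod z < 1 / 2"
    then have z1: "cmod z < 1" by simp
    show "(\<lambda>k. power_moment \<mu> k x * z ^ k) sums ((cinner (F_fun \<mu> z x) x + of_real ((norm x)\<^sup>2)) / 2)"
      by (rule power_moment_sums[OF \<mu> z1])
    \<comment> \<open>The choice for which \<open>X - z E(z) X = x\<close>.\<close>
    define X where "X = (1/2) *\<^sub>R (F_fun \<mu> z x + x)"
    have "z *\<^sub>C E_fun \<mu> z X = (1/2) *\<^sub>R (F_fun \<mu> z x - x)"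
      unfolding X_def blinfun.scaleR_right scaleC.scaleR_right E_fun_apply[OF \<mu> z1] ..
    moreover have "X - (1/2) *\<^sub>R (F_fun \<mu> z x - x) = x"
      by (simp add: X_def scaleR_right_diff_distrib scaleR_right_distrib scaleR_left_distrib[symmetric])
    ultimately have e: "X - z *\<^sub>C E_fun \<mu> z X = x" by simp
    have "cinner X x = (cinner (F_fun \<mu> z x) x + of_real ((norm x)\<^sup>2)) / 2"
      by (simp add: X_def cinner.scaleR_left cinner_simps cinner_self scaleR_conv_of_real add_divide_distrib)
    then show "(\<lambda>k. cinner ((cmv G ^^ k) (x, 0)) (x, 0) * z ^ k) sums ((cinner (F_fun \<mu> z x) x + of_real ((norm x)\<^sup>2)) / 2)"
      using cmv_transfer_series[OF E_fun_schur[OF \<mu>] G less_imp_le[OF z], of X x]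
      by (simp only: e mult.commute)
  qed simp
  then show ?thesis by (simp add: power_moment_def[OF \<mu>])
qed

section \<open>A criterion for minimal Naimark dilations\<close>

lemma closed_csubspace_range_iota: "closed_csubspace (range (\<lambda>x :: 'm::chilbert. (x, 0 :: 'k::chilbert)))"
proof -
  have "closed_csubspace ({0} :: 'k set)"
    by (auto simp: closed_csubspace_def complex_vector.subspace_def)
  then have "closed_csubspace ((UNIV :: 'm set) \<times> ({0} :: 'k set))"
    by (intro closed_csubspace_Times closed_csubspace_UNIV)
  also have "(UNIV :: 'm set) \<times> ({0} :: 'k set) = range (\<lambda>x. (x, 0))" by auto
  finally show ?thesis .
qed

lemma proj_range_iota: "proj (range (\<lambda>x :: 'm::chilbert. (x, 0 :: 'k::chilbert))) h = (fst h, 0)"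
  by (rule proj_eqI[OF closed_csubspace_range_iota]) (auto simp: cinner_prod_def)

lemma closed_subspace_eqI:
  assumes K: "closed_csubspace K" and H: "csubspace H" and KH: "K \<subseteq> H"
    and orth: "\<And>h. h \<in> H \<Longrightarrow> (\<And>k. k \<in> K \<Longrightarrow> cinner h k = 0) \<Longrightarrow> h = 0"
  shows "K = H"
proof (intro subset_antisym KH subsetI)
  fix h assume h: "h \<in> H"
  have "h - proj K h = 0"
    using proj_mem[OF K, of h] KH proj_orthogonal[OF K, of _ h] by (intro orth csubspaceD(3)[OF H h]) auto
  then show "h \<in> K" using proj_mem[OF K, of h] by simp
qed

text \<open>
  The finite sums of vectors \<open>f i q\<close>, with \<open>q\<close> in a countable dense set, form a countable set. Its closure contains
  all \<open>f i x\<close> and is a subspace, since the ranges of the \<open>f i\<close> are invariant under scalars.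
\<close>

lemma separable_closed_span:
  fixes f :: "'i::countable \<Rightarrow> 'm::complex_normed_vector \<Rightarrow> 'h::chilbert"
  assumes H: "closed_csubspace H" and fH: "\<And>i x. f i x \<in> H"
    and f: "\<And>i x c. f i (c *\<^sub>C x) = c *\<^sub>C f i x" "\<And>i. continuous_on UNIV (f i)"
    and span: "H \<subseteq> closure (cspan (\<Union>i. range (f i)))"
    and sep: "separable_space (euclidean :: 'm topology)"
  shows "separable_space (top_of_set H)"
proof -
  note sH = csubspaceD[OF closed_csubspaceD(1)[OF H]]
  obtain Q :: "'m set" where Q: "countable Q" "closure Q = UNIV"
    using sep unfolding separable_space_def by auto
  define D where "D = (\<Union>i. f i ` Q)"
  define C where "C = sum_list ` lists D"
  have cC: "countable C" unfolding C_def D_def using Q(1) by (intro countable_image countable_lists countable_UN) auto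
  have addC: "x + y \<in> C" if xy: "x \<in> C" "y \<in> C" for x y
  proof -
    obtain xs ys where "x = sum_list xs" "xs \<in> lists D" "y = sum_list ys" "ys \<in> lists D"
      using xy unfolding C_def by blast
    then show ?thesis unfolding C_def by (intro image_eqI[of _ _ "xs @ ys"]) auto
  qed
  have CH: "C \<subseteq> H"
  proof
    fix x assume "x \<in> C"
    then obtain xs where xs: "x = sum_list xs" "xs \<in> lists D" unfolding C_def by blast
    have "sum_list xs \<in> H" using xs(2) by (induction xs) (auto simp: D_def intro: sH fH)
    then show "x \<in> H" using xs(1) by simp
  qed
  have addcl: "x + y \<in> closure C" if xy: "x \<in> closure C" "y \<in> closure C" for x y
  proof -
    obtain X Y where "\<And>n. X n \<in> C" "X \<longlonglongrightarrow> x" "\<And>n. Y n \<in> C" "Y \<longlonglongrightarrow> y"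
      using xy unfolding closure_sequential by blast
    then show ?thesis unfolding closure_sequential
      by (intro exI[of _ "\<lambda>n. X n + Y n"]) (auto intro: tendsto_add addC)
  qed
  have gen: "f i x \<in> closure C" for i x
  proof -
    have "x \<in> closure Q" using Q(2) by simp
    then obtain q where q: "\<And>n. q n \<in> Q" "q \<longlonglongrightarrow> x" unfolding closure_sequential by blast
    have "(\<lambda>n. f i (q n)) \<longlonglongrightarrow> f i x"
      using f(2)[of i] q(2) by (simp add: continuous_on_eq_continuous_at isCont_tendsto_compose)
    moreover have "f i (q n) \<in> C" for n
      unfolding C_def D_def using q(1) by (intro image_eqI[of _ _ "[f i (q n)]"]) auto
    ultimately show ?thesis
      unfolding closure_sequential by (intro exI[of _ "\<lambda>n. f i (q n)"]) auto
  qed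
  have "csubspace (closure C)"
    unfolding complex_vector.subspace_def
  proof (intro conjI ballI allI)
    have "0 \<in> C" unfolding C_def by (intro image_eqI[of _ _ "[]"]) auto
    then show "0 \<in> closure C" by (rule subsetD[OF closure_subset])
    fix c x assume x: "x \<in> closure C"
    have cC: "c *\<^sub>C y \<in> closure C" if y: "y \<in> C" for y
    proof -
      obtain ys where ys: "y = sum_list ys" "ys \<in> lists D" using y unfolding C_def by blast
      have "c *\<^sub>C sum_list ys \<in> closure C"
        using ys(2)
      proof (induction ys)
        case (Cons d ys)
        then have "c *\<^sub>C d \<in> closure C" using gen by (auto simp: D_def f(1)[symmetric])
        then show ?case using Cons addcl by (simp add: scaleC_add_right)
      qed (simp add: \<open>0 \<in> closure C\<close>)
      then show ?thesis using ys(1) by simp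
    qed
    obtain X where X: "\<And>n. X n \<in> C" "X \<longlonglongrightarrow> x" using x unfolding closure_sequential by blast
    have "(\<lambda>n. c *\<^sub>C X n) \<longlonglongrightarrow> c *\<^sub>C x" by (intro scaleC.tendsto X tendsto_const)
    then show "c *\<^sub>C x \<in> closure C"
      by (rule closed_sequentially[OF closed_closure cC[OF X(1)]])
  qed (use addcl in auto)
  then have "cspan (\<Union>i. range (f i)) \<subseteq> closure C"
    using gen by (intro complex_vector.span_minimal) auto
  then have "closure (cspan (\<Union>i. range (f i))) \<subseteq> closure C" by (intro closure_minimal) auto
  then have "H \<subseteq> closure C" using span by blast
  then have "top_of_set H closure_of C = H"
    using CH by (simp add: closure_of_subtopology Int_absorb1 Int_absorb2)
  then show ?thesis
    unfolding separable_space_def using cC CH by (intro exI[of _ C]) auto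
qed

text \<open>
  The compressions of negative powers are adjoint to those of positive powers, and operators are determined
  by their quadratic forms. Separability follows from minimality, as the space is spanned by countably many
  isometric images of \<open>M\<close>.
\<close>

lemma minimal_naimark_dilationI:
  fixes \<mu> :: "complex set \<Rightarrow> 'm::chilbert \<Rightarrow>\<^sub>L 'm" and S :: "'k::chilbert set"
  assumes sep: "separable_space (euclidean :: 'm topology)" and \<mu>: "probability_op_measure \<mu>"
    and S: "closed_csubspace S" and U: "unitary_between (UNIV \<times> S) (UNIV \<times> S) U"
    and mom: "\<And>k x. cinner ((U ^^ k) (x, 0)) (x, 0) = (\<integral>\<xi>. \<xi> powi (- int k) \<partial>scalar_measure \<mu> x)"
    and orth: "\<And>h. h \<in> UNIV \<times> S \<Longrightarrow>
      (\<And>n x. cinner h (int_power (UNIV \<times> S) U n (x, 0)) = 0) \<Longrightarrow> h = 0"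
  shows "minimal_naimark_dilation \<mu> (\<lambda>x. (x, 0)) (UNIV \<times> S) U"
proof -
  let ?H = "(UNIV :: 'm set) \<times> S" and ?\<iota> = "\<lambda>x :: 'm. (x, 0 :: 'k)"
  let ?P = "\<lambda>n. int_power ?H U n"
  have H: "closed_csubspace ?H" by (intro closed_csubspace_Times closed_csubspace_UNIV S)
  note sH = closed_csubspaceD(1)[OF H]
  have \<iota>H: "(x, 0) \<in> ?H" for x using csubspaceD(1)[OF closed_csubspaceD(1)[OF S]] by auto
  note P = unitary_betweenD[OF unitary_int_power[OF U sH]]
  have \<iota>_lin: "?\<iota> (x + y) = ?\<iota> x + ?\<iota> y" "?\<iota> (c *\<^sub>C x) = c *\<^sub>C ?\<iota> x" for x y c
    by (auto simp: scaleC_prod_def)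
  have Pl: "?P n (x + y, 0) = ?P n (x, 0) + ?P n (y, 0)" "?P n (c *\<^sub>C x, 0) = c *\<^sub>C ?P n (x, 0)" for n x y c
    unfolding \<iota>_lin by (rule P(1)[OF \<iota>H \<iota>H], rule P(2)[OF \<iota>H])
  have Pn: "norm (?P n (x, 0)) = norm x" for n x
    using unitary_between_norm[OF unitary_int_power[OF U sH] \<iota>H] by simp
  have quad: "cinner (?P n (x, 0)) (x, 0) = (\<integral>\<xi>. \<xi> powi (- n) \<partial>scalar_measure \<mu> x)" for n x
  proof (cases "0 \<le> n")
    case True
    then show ?thesis using mom[of "nat n" x] by (simp add: int_power_def)
  next
    case False
    define k where "k = nat (- n)"
    have n: "n = - int k" using False by (simp add: k_def)
    have "cinner (?P n (x, 0)) (x, 0) = cnj (cinner ((U ^^ k) (x, 0)) (x, 0))"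
      using unitary_funpow_adjoint[OF U sH \<iota>H \<iota>H, of k x x] False
      by (simp add: int_power_def k_def[symmetric] cinner_commute[symmetric])
    also have "\<dots> = (\<integral>\<xi>. cnj (\<xi> powi (- int k)) \<partial>scalar_measure \<mu> x)"
      unfolding mom by (rule Bochner_Integration.integral_cnj[symmetric])
    also have "\<dots> = (\<integral>\<xi>. \<xi> powi (- n) \<partial>scalar_measure \<mu> x)"
    proof (rule Bochner_Integration.integral_cong[OF refl])
      fix \<xi> assume "\<xi> \<in> space (scalar_measure \<mu> x)"
      then have "cmod \<xi> = 1" using space_mu \<mu> by (auto simp: probability_op_measure_def)
      then have "cnj \<xi> = inverse \<xi>"
        using complex_norm_square[of \<xi>] by (intro inverse_unique[symmetric]) simp
      then show "cnj (\<xi> powi (- int k)) = \<xi> powi (- n)"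
        by (simp add: n power_int_minus power_inverse[symmetric])
    qed
    finally show ?thesis .
  qed
  have moment: "moment \<mu> n x = fst (?P n (x, 0))" for n x
  proof -
    obtain T where T: "\<And>x. blinfun_apply T x = fst (?P n (x, 0))" "cbl T"
    proof (rule Blinfun_cbl[of "\<lambda>x. fst (?P n (x, 0))" 1])
      show "norm (fst (?P n (x, 0))) \<le> 1 * norm x" for x
        using norm_fst_le[of "fst (?P n (x, 0))" "snd (?P n (x, 0))"] Pn[of n x] by simp
    qed (auto simp: Pl scaleC_prod_def)
    have "cinner (T x) x = (\<integral>\<xi>. \<xi> powi (- n) \<partial>scalar_measure \<mu> x)" for x
      unfolding quad[symmetric] by (simp add: T cinner_prod_def)
    then show ?thesis
      unfolding moment_def using op_integral_eqI[OF \<mu> T(2)] T(1) by simp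
  qed
  have min: "closure (cspan (\<Union>n. ?P n ` range ?\<iota>)) = ?H"
  proof (rule closed_subspace_eqI[OF _ sH])
    show "closed_csubspace (closure (cspan (\<Union>n. ?P n ` range ?\<iota>)))"
      by (intro closed_csubspace_closure complex_vector.subspace_span)
    show "closure (cspan (\<Union>n. ?P n ` range ?\<iota>)) \<subseteq> ?H"
    proof (intro closure_minimal complex_vector.span_minimal sH closed_csubspaceD(2)[OF H])
      show "(\<Union>n. ?P n ` range ?\<iota>) \<subseteq> ?H" using P(4)[OF \<iota>H] by blast
    qed
    fix h assume "h \<in> ?H" and h: "\<And>k. k \<in> closure (cspan (\<Union>n. ?P n ` range ?\<iota>)) \<Longrightarrow> cinner h k = 0"
    have "cinner h (?P n (x, 0)) = 0" for n x
      by (intro h subsetD[OF closure_subset] complex_vector.span_base) auto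
    then show "h = 0" using orth[OF \<open>h \<in> ?H\<close>] by blast
  qed
  have "separable_space (top_of_set ?H)"
  proof (rule separable_closed_span[OF H, where f = "\<lambda>n x. ?P n (x, 0)"])
    show "?P n (x, 0) \<in> ?H" for n x by (rule P(4)[OF \<iota>H])
    show "?P n (c *\<^sub>C x, 0) = c *\<^sub>C ?P n (x, 0)" for n x c by (rule Pl)
    show "continuous_on UNIV (\<lambda>x. ?P n (x, 0))" for n
    proof (rule linear_continuous_on, rule bounded_linear_intro[where K = 1])
      show "?P n (r *\<^sub>R x, 0) = r *\<^sub>R ?P n (x, 0)" for r x
        using Pl(2)[of n "complex_of_real r" x] by (simp add: scaleC_of_real)
    qed (auto simp: Pl Pn)
    show "?H \<subseteq> closure (cspan (\<Union>n. range (\<lambda>x. ?P n (x, 0))))"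
      using min by (simp add: image_image)
  qed (rule sep)
  then show ?thesis
    unfolding minimal_naimark_dilation_def naimark_dilation_def
  proof (intro conjI allI)
    show "clinear ?\<iota>" by (simp add: clinear_iff \<iota>_lin[symmetric])
    show "cinner (?\<iota> x) (?\<iota> y) = cinner x y" for x y by (simp add: cinner_prod_def)
    show "range ?\<iota> \<subseteq> ?H" using \<iota>H by blast
    show "?\<iota> (moment \<mu> n x) = proj (range ?\<iota>) (?P n (?\<iota> x))" for n x
      by (simp add: proj_range_iota moment)
  qed (rule H min U | assumption)+
qed

section \<open>CMV matrices as Naimark dilations\<close>

text \<open>
  The two matrices are \<open>L W\<close> and \<open>W L\<close> with the unitary \<open>W = I \<oplus> V\<close>, which fixes \<open>M\<close>. So \<open>W\<close> intertwines them and
  carries moments and minimality over from the first to the second.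
\<close>

theorem theorem7p9:
  fixes \<mu> :: "complex set \<Rightarrow> 'm::chilbert \<Rightarrow>\<^sub>L 'm"
    and G :: "nat \<Rightarrow> 'm \<Rightarrow>\<^sub>L 'm"
  assumes "separable_space (euclidean :: 'm topology)"
    and "probability_op_measure \<mu>"
    and "G = schur_parameter UNIV UNIV (E_fun \<mu>)"
  shows "E_fun \<mu> \<in> schur_class UNIV UNIV \<and>
    minimal_naimark_dilation \<mu> (\<lambda>x. (x, 0)) (UNIV \<times> cmv_sum G) (cmv G) \<and>
    minimal_naimark_dilation \<mu> (\<lambda>x. (x, 0)) (UNIV \<times> cmv_sum' G) (cmv' G) \<and>
    unitarily_equivalent_dilations
      (\<lambda>x. (x, 0)) (UNIV \<times> cmv_sum G) (cmv G)
      (\<lambda>x. (x, 0)) (UNIV \<times> cmv_sum' G) (cmv' G)"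
proof -
  note E = E_fun_schur[OF assms(2)]
  note cp = contractive_params_schur[OF E assms(3)]
  let ?H = "(UNIV :: 'm set) \<times> cmv_sum G" and ?H' = "(UNIV :: 'm set) \<times> cmv_sum' G"
  define W where "W = map_prod (id :: 'm \<Rightarrow> 'm) (cmv_V G)"
  have W: "unitary_between ?H ?H' W" unfolding W_def by (rule unitary_cmv_W[OF cp])
  note w = unitary_betweenD[OF W]
  note U = unitary_cmv[OF cp] and U' = unitary_cmv'[OF cp]
  note sH = closed_csubspaceD(1)[OF closed_csubspace_cmv(1)[OF cp]]
    and sH' = closed_csubspaceD(1)[OF closed_csubspace_cmv(2)[OF cp]]
  have inter: "W (cmv G h) = cmv' G (W h)" for h
    by (simp add: W_def cmv_def cmv'_def)
  have \<iota>H: "(x, 0) \<in> ?H" for x :: 'm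
    using csubspaceD(1)[OF closed_csubspaceD(1)[OF closed_csubspace_cmv_sum(1)[OF cp]]] by auto
  have W\<iota>: "W (x, 0) = (x, 0)" for x
  proof -
    have "W (x, 0) = (x, cmv_V G 0)" by (simp add: W_def)
    moreover have "cmv_V G 0 = 0"
      using unitary_betweenD(2)[OF unitary_cmv_V[OF cp], of 0 0] \<iota>H by auto
    ultimately show ?thesis by simp
  qed
  have Wpow: "W ((cmv G ^^ k) h) = (cmv' G ^^ k) (W h)" for k h
    by (induction k) (simp_all add: inter)
  have Wint: "W (int_power ?H (cmv G) n h) = int_power ?H' (cmv' G) n (W h)" if h: "h \<in> ?H" for n h
  proof (cases "0 \<le> n")
    case True then show ?thesis by (simp add: int_power_def Wpow)
  next
    case False
    note i = unitary_inv_into[OF U sH] and i' = unitary_inv_into[OF U' sH']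
    have Winv: "W (inv_into ?H (cmv G) g) = inv_into ?H' (cmv' G) (W g)" if g: "g \<in> ?H" for g
    proof -
      have "W g = cmv' G (W (inv_into ?H (cmv G) g))" using i(2)[OF g] inter by metis
      then show ?thesis using i'(3)[OF w(4)[OF unitary_betweenD(4)[OF i(1) g]]] by simp
    qed
    have "W ((inv_into ?H (cmv G) ^^ k) h) = (inv_into ?H' (cmv' G) ^^ k) (W h)" for k
    proof (induction k)
      case (Suc k)
      have "(inv_into ?H (cmv G) ^^ k) h \<in> ?H"
        by (rule unitary_betweenD(4)[OF unitary_funpow[OF i(1) sH] h])
      then show ?case using Suc by (simp add: Winv)
    qed simp
    then show ?thesis using False by (simp add: int_power_def)
  qed
  note mom = cmv_moments[OF assms(2,3)]
  have dil: "minimal_naimark_dilation \<mu> (\<lambda>x. (x, 0)) ?H (cmv G)"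
    by (rule minimal_naimark_dilationI[OF assms(1,2) closed_csubspace_cmv_sum(1)[OF cp] U mom cmv_minimal[OF cp]])
  have dil': "minimal_naimark_dilation \<mu> (\<lambda>x. (x, 0)) ?H' (cmv' G)"
  proof (rule minimal_naimark_dilationI[OF assms(1,2) closed_csubspace_cmv_sum(2)[OF cp] U'])
    fix k and x :: 'm
    have "cinner ((cmv' G ^^ k) (x, 0)) (x, 0) = cinner (W ((cmv G ^^ k) (x, 0))) (W (x, 0))"
      by (simp add: Wpow W\<iota>)
    also have "\<dots> = cinner ((cmv G ^^ k) (x, 0)) (x, 0)"
      by (rule w(3)[OF unitary_betweenD(4)[OF unitary_funpow[OF U sH] \<iota>H] \<iota>H])
    finally show "cinner ((cmv' G ^^ k) (x, 0)) (x, 0) = (\<integral>\<xi>. \<xi> powi (- int k) \<partial>scalar_measure \<mu> x)"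
      by (simp add: mom)
  next
    fix h' assume h': "h' \<in> ?H'" and orth: "\<And>n x. cinner h' (int_power ?H' (cmv' G) n (x, 0)) = 0"
    obtain h where h: "h \<in> ?H" "h' = W h" using h' w(5) by blast
    have "cinner h (int_power ?H (cmv G) n (x, 0)) = 0" for n x
    proof -
      have "cinner h (int_power ?H (cmv G) n (x, 0)) = cinner (W h) (W (int_power ?H (cmv G) n (x, 0)))"
        by (rule w(3)[symmetric, OF h(1) unitary_betweenD(4)[OF unitary_int_power[OF U sH] \<iota>H]])
      then show ?thesis using orth[of n x] by (simp add: Wint[OF \<iota>H] W\<iota> h(2))
    qed
    then have "h = 0" using cmv_minimal[OF cp h(1)] by blast
    then show "h' = 0" using W\<iota>[of 0] h(2) by (simp add: zero_prod_def)
  qed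
  have "unitarily_equivalent_dilations (\<lambda>x. (x, 0)) ?H (cmv G) (\<lambda>x. (x, 0)) ?H' (cmv' G)"
    unfolding unitarily_equivalent_dilations_def using W inter W\<iota> by blast
  with E dil dil' show ?thesis by blast
qed

end
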